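(* The groups $SO(n+2,2)$, for every integer $n\geq 1$, and the group $SU(2,2)$ are tame.
   Context: Let $G$ be a real reductive group with maximal compact subgroup $K$ and corresponding Cartan involution $\theta$. Let $N$ be a maximal unipotent subgroup and $A$ the identity component of a maximal $\mathbb{R}$-split torus of $G$ normalizing $N$, such that $G=\theta(N)AK$ is an Iwasawa decomposition. For $g=vak$ with $v\in\theta(N)$, $a\in A$, $k\in K$, set $a(g)=a$, and for $a\in A$ set $a^{\rho}=\bigl(\det \mathrm{Ad}(a)|_{\mathrm{Lie}(N)}\bigr)^{1/2}$. The group $G$ is called tame if $$\int_{[N,N]}a(n)^{-\rho}\bigl(1+\log (a(n)^{\rho})\bigr)^{d}\,dn<\infty\quad\text{for all } d>0,$$ where $[N,N]$ is the commutator subgroup of $N$ and $dn$ is a Haar measure on $[N,N]$. *)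

theory Defs
  imports "HOL-Analysis.Analysis" "HOL-Algebra.Generated_Groups"
begin

text \<open>Real reductive groups are taken to be linear: they are sets of invertible complex
  matrices, cut out by real polynomials in the real and imaginary parts of the entries.\<close>

definition GL :: "(complex^'m^'m) monoid" where
  "GL = \<lparr>carrier = {g. invertible g}, mult = (**), one = mat 1\<rparr>"

definition ctranspose :: "complex^'m^'m \<Rightarrow> complex^'m^'m" where
  "ctranspose g = (\<chi> i j. cnj (g $ j $ i))"

definition real_algebraic :: "(complex^'m^'m) set \<Rightarrow> bool" where
  "real_algebraic G \<longleftrightarrow>
     (\<exists>S. (\<forall>p\<in>S. real_polynomial_function p) \<and>
          G = {g. invertible g \<and> (\<forall>p\<in>S. p g = 0)})"

definition maximal_with :: "('a set \<Rightarrow> bool) \<Rightarrow> 'a set \<Rightarrow> bool" where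
  "maximal_with P H \<longleftrightarrow> P H \<and> (\<forall>H'. P H' \<and> H \<subseteq> H' \<longrightarrow> H' = H)"

definition maximal_compact :: "(complex^'m^'m) set \<Rightarrow> (complex^'m^'m) set \<Rightarrow> bool" where
  "maximal_compact G K \<longleftrightarrow> maximal_with (\<lambda>H. H \<subseteq> G \<and> subgroup H GL \<and> compact H) K"

text \<open>The Cartan involutions of a linear reductive group are the involutions preserving it which,
  after a change \<open>h\<close> of the basis (that is, for a suitable Hermitian inner product), become the
  inverse conjugate transpose. The corresponding maximal compact subgroup \<open>K\<close> is the fixed point
  group. Only the values of \<open>\<theta>\<close> on \<open>G\<close> matter.\<close>

definition cartan_involution ::
    "(complex^'m^'m) set \<Rightarrow> (complex^'m^'m \<Rightarrow> complex^'m^'m) \<Rightarrow> bool" where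
  "cartan_involution G \<theta> \<longleftrightarrow>
     \<theta> ` G = G \<and>
     (\<exists>h :: complex^'m^'m. invertible h \<and>
        (\<forall>g\<in>G. \<theta> g =
           matrix_inv h ** matrix_inv (ctranspose (h ** g ** matrix_inv h)) ** h))"

definition real_reductive :: "(complex^'m^'m) set \<Rightarrow> bool" where
  "real_reductive G \<longleftrightarrow> subgroup G GL \<and> real_algebraic G \<and> (\<exists>\<theta>. cartan_involution G \<theta>)"

definition unipotent :: "complex^'m^'m \<Rightarrow> bool" where
  "unipotent u \<longleftrightarrow> (\<exists>k. (((**) (u - mat 1)) ^^ k) (mat 1) = 0)"

definition maximal_unipotent :: "(complex^'m^'m) set \<Rightarrow> (complex^'m^'m) set \<Rightarrow> bool" where
  "maximal_unipotent G N \<longleftrightarrow>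
     maximal_with (\<lambda>U. U \<subseteq> G \<and> subgroup U GL \<and> (\<forall>u\<in>U. unipotent u)) N"

text \<open>A real-split torus is a Zariski connected real algebraic group that is simultaneously
  diagonalizable with real eigenvalues. Zariski connected means that there is no proper algebraic
  subgroup of finite index; the set of real points need not be connected for the usual
  topology.\<close>

definition split_torus :: "(complex^'m^'m) set \<Rightarrow> bool" where
  "split_torus T \<longleftrightarrow>
     subgroup T GL \<and> real_algebraic T \<and>
     (\<forall>H. subgroup H GL \<and> real_algebraic H \<and> H \<subseteq> T \<and> finite ((\<lambda>t. ((**) t) ` H) ` T)
          \<longrightarrow> H = T) \<and>
     (\<exists>h :: complex^'m^'m. invertible h \<and>
        (\<forall>t\<in>T. \<forall>i j. (i \<noteq> j \<longrightarrow> (h ** t ** matrix_inv h) $ i $ j = 0) \<and>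
                      (h ** t ** matrix_inv h) $ i $ i \<in> \<real>))"

definition maximal_split_torus :: "(complex^'m^'m) set \<Rightarrow> (complex^'m^'m) set \<Rightarrow> bool" where
  "maximal_split_torus G T \<longleftrightarrow> maximal_with (\<lambda>S. S \<subseteq> G \<and> split_torus S) T"

text \<open>\<open>G = \<theta>(N) A K\<close> is an Iwasawa decomposition: \<open>A\<close> is compatible with the Cartan involution,
  and the product map is bijective.\<close>

definition iwasawa ::
    "(complex^'m^'m) set \<Rightarrow> (complex^'m^'m \<Rightarrow> complex^'m^'m) \<Rightarrow>
     (complex^'m^'m) set \<Rightarrow> (complex^'m^'m) set \<Rightarrow> (complex^'m^'m) set \<Rightarrow> bool" where
  "iwasawa G \<theta> N A K \<longleftrightarrow>
     cartan_involution G \<theta> \<and>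
     maximal_compact G K \<and> K = {g\<in>G. \<theta> g = g} \<and>
     maximal_unipotent G N \<and>
     (\<exists>T. maximal_split_torus G T \<and>
          (\<forall>t\<in>T. (\<lambda>n. t ** n ** matrix_inv t) ` N = N) \<and>
          A = connected_component_set T (mat 1)) \<and>
     (\<forall>a\<in>A. \<theta> a = matrix_inv a) \<and>
     bij_betw (\<lambda>(v, a, k). v ** a ** k) (\<theta> ` N \<times> A \<times> K) G"

definition iwasawa_A ::
    "(complex^'m^'m \<Rightarrow> complex^'m^'m) \<Rightarrow> (complex^'m^'m) set \<Rightarrow> (complex^'m^'m) set \<Rightarrow>
     (complex^'m^'m) set \<Rightarrow> complex^'m^'m \<Rightarrow> complex^'m^'m" where
  "iwasawa_A \<theta> N A K g = (THE a. a \<in> A \<and> (\<exists>v\<in>\<theta> ` N. \<exists>k\<in>K. g = v ** a ** k))"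

text \<open>For a closed linear group, the velocities at the identity of curves in the group.\<close>

definition lie_algebra :: "(complex^'m^'m) set \<Rightarrow> (complex^'m^'m) set" where
  "lie_algebra H =
     {X. \<exists>c :: real \<Rightarrow> complex^'m^'m.
          c 0 = mat 1 \<and> range c \<subseteq> H \<and> (c has_vector_derivative X) (at 0)}"

text \<open>The determinant of an endomorphism \<open>f\<close> of a real subspace \<open>V\<close>, by the Leibniz formula in
  some basis \<open>B\<close> of \<open>V\<close>.\<close>

definition det_on :: "'a::euclidean_space set \<Rightarrow> ('a \<Rightarrow> 'a) \<Rightarrow> real" where
  "det_on V f =
     (let B = (SOME B. B \<subseteq> V \<and> independent B \<and> V \<subseteq> span B)
      in \<Sum>p | p permutes B. of_int (sign p) * (\<Prod>b\<in>B. representation B (f b) (p b)))"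

definition a_rho :: "(complex^'m^'m) set \<Rightarrow> complex^'m^'m \<Rightarrow> real" where
  "a_rho N a = sqrt (det_on (lie_algebra N) (\<lambda>X. a ** X ** matrix_inv a))"

definition haar_measure :: "(complex^'m^'m) set \<Rightarrow> (complex^'m^'m) measure \<Rightarrow> bool" where
  "haar_measure H M \<longleftrightarrow>
     sets M = sets (restrict_space borel H) \<and>
     (\<forall>h\<in>H. \<forall>B\<in>sets M. emeasure M ((\<lambda>x. h ** x) ` B) = emeasure M B) \<and>
     (\<forall>C. compact C \<and> C \<subseteq> H \<longrightarrow> emeasure M C < \<infinity>) \<and>
     emeasure M H \<noteq> 0"

definition tame :: "(complex^'m^'m) set \<Rightarrow> bool" where
  "tame G \<longleftrightarrow>
     real_reductive G \<and>
     (\<forall>\<theta> N A K M. iwasawa G \<theta> N A K \<and> haar_measure (derived GL N) M \<longrightarrow>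
        (\<forall>d::real. d > 0 \<longrightarrow>
           integrable M (\<lambda>n. inverse (a_rho N (iwasawa_A \<theta> N A K n)) *
                             (1 + ln (a_rho N (iwasawa_A \<theta> N A K n))) powr d)))"

definition I_indef :: "'a::comm_ring_1^('p::finite + 'q::finite)^('p + 'q)" where
  "I_indef = (\<chi> i j. if i = j then (case i of Inl _ \<Rightarrow> 1 | Inr _ \<Rightarrow> -1) else 0)"

text \<open>\<open>SO(p,q)\<close> and \<open>SU(p,q)\<close> for \<open>p = CARD('p)\<close> and \<open>q = CARD('q)\<close>.\<close>

definition SO_indef :: "(complex^('p::finite + 'q::finite)^('p + 'q)) set" where
  "SO_indef = map_matrix complex_of_real `
     {g :: real^('p + 'q)^('p + 'q). transpose g ** I_indef ** g = I_indef \<and> det g = 1}"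

definition SU_indef :: "(complex^('p::finite + 'q::finite)^('p + 'q)) set" where
  "SU_indef = {g. ctranspose g ** I_indef ** g = I_indef \<and> det g = 1}"

end

theory Submission
  imports Defs "HOL-Computational_Algebra.Fundamental_Theorem_Algebra"
begin

text \<open>Write \<open>F\<close> for the reals in the case \<open>SO(n+2,2)\<close> and for the complex numbers in the case
  \<open>SU(2,2)\<close>. By Kolchin's theorem a maximal unipotent subgroup \<open>N\<close> fixes a full isotropic flag
  \<open>F e \<subset> F e + F d\<close> of the form, and by maximality it is the whole unipotent group of this flag.
  The Cartan involution is conjugation by some \<open>J\<close> for which \<open>(x, J y)\<close> is positive definite; its
  square centralises the group, so it is a positive scalar and may be taken to be \<open>1\<close>. In a basis
  \<open>e, d, J d, J e\<close> extended by orthonormal vectors of the positive definite complement everything is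
  explicit: \<open>[N,N]\<close> is a vector group of dimension \<open>n + 1\<close> (with \<open>n = 2\<close> for \<open>SU(2,2)\<close>), the elements
  of \<open>A\<close> are \<open>diag(p, q, 1, ..., 1, 1/q, 1/p)\<close>, and for \<open>g = v a k\<close> the numbers \<open>p\<close> and \<open>p q\<close> are the
  norms of the first row of \<open>g\<close> and of the exterior product of its first two rows. This gives
  \<open>a(u)\<^sup>\<rho> = sqrt ((1 + r)\<^sup>2 + t\<^sup>2) * (1 + r + t\<^sup>2) powr (n/2)\<close>, for \<open>u\<close> in \<open>[N,N]\<close>, where \<open>r\<close> is a
  positive definite quadratic form in \<open>n\<close> of the coordinates and \<open>t\<close> is the last one. It dominates
  a product of powers greater than one of the individual coordinates, and Haar measure is controlled
  by covering \<open>[N,N]\<close> with the integer translates of a compact cube.\<close>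

section \<open>Kolchin's theorem\<close>

text \<open>\<open>tame\<close> quantifies over every Iwasawa decomposition and every Haar measure,
  so no standard \<open>N\<close> and \<open>\<theta>\<close> can be fixed in advance: adapted
  coordinates have to be produced from the given ones. The flag is built one layer at a time and
  both fields are treated at once, so Kolchin's theorem is stated for quotients of real subspaces.
  At each layer a fixed vector is not enough, it must also be isotropic; the indefinite form
  supplies this, and the flag ends after two layers because the form is negative on only two
  coordinates. The density is expressed through row norms of the group element itself, which makes
  it continuous, whereas the Iwasawa component is given by a definite description. Haar measure
  enters through left invariance and finiteness on compact sets. The estimate leaves an exponent 1 +
  \<epsilon> on each coordinate; the logarithmic factor uses up part of \<epsilon>, and the sum over
  the lattice factors into convergent series in one variable.\<close>

lemma scaleR_complex: "r *\<^sub>R z = of_real r * z" for z :: complex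
  by (rule scaleR_conv_of_real)

lemma det_one_plus_poly:
  fixes X :: "complex^'m^'m"
  obtains p where "\<And>z. det (\<chi> i j. (if i = j then 1 else 0) + z * X $ i $ j) = poly p z"
proof
  fix z
  show "det (\<chi> i j. (if i = j then 1 else 0) + z * X $ i $ j) =
    poly (\<Sum>\<sigma> | \<sigma> permutes UNIV. of_int (sign \<sigma>) * (\<Prod>i\<in>UNIV. [:if i = \<sigma> i then 1 else 0, X $ i $ \<sigma> i:])) z"
    by (simp add: det_def poly_sum poly_prod)
qed

text \<open>A permutation other than the identity moves at least two indices, so its term has two
  factors vanishing at 0 and derivative zero there; the identity contributes the trace.\<close>

lemma det_one_plus_deriv:
  fixes X :: "complex^'m^'m"
  shows "((\<lambda>z. det (\<chi> i j. (if i = j then 1 else 0) + z * X $ i $ j)) has_field_derivative trace X) (at 0)"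
proof -
  let ?e = "\<lambda>\<sigma> (i::'m). if i = \<sigma> i then 1 else (0::complex)"
  let ?d = "\<lambda>\<sigma>. \<Sum>i\<in>UNIV. X $ i $ \<sigma> i * (\<Prod>j\<in>UNIV-{i}. ?e \<sigma> j + 0 * X $ j $ \<sigma> j)"
  have 1: "((\<lambda>z. det (\<chi> i j. (if i = j then 1 else 0) + z * X $ i $ j)) has_field_derivative
      (\<Sum>\<sigma> | \<sigma> permutes UNIV. of_int (sign \<sigma>) * ?d \<sigma>)) (at 0)"
    unfolding det_def vec_lambda_beta
    by (intro DERIV_sum DERIV_cmult has_field_derivative_prod) (auto intro!: derivative_eq_intros)
  have 2: "?d \<sigma> = (if \<sigma> = id then trace X else 0)" if "\<sigma> permutes UNIV" for \<sigma>
  proof (cases "\<sigma> = id")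
    case True
    then show ?thesis by (simp add: trace_def)
  next
    case False
    then obtain k where k: "\<sigma> k \<noteq> k" by (auto simp: fun_eq_iff)
    with that have k': "\<sigma> (\<sigma> k) \<noteq> \<sigma> k" by (metis permutes_inj injD)
    have "(\<Prod>j\<in>UNIV-{i}. ?e \<sigma> j + 0 * X $ j $ \<sigma> j) = 0" for i
    proof (cases "i = k")
      case True
      then show ?thesis using k k' by (intro prod_zero bexI[of _ "\<sigma> k"]) auto
    next
      case False
      then show ?thesis using k by (intro prod_zero bexI[of _ k]) auto
    qed
    then have "?d \<sigma> = 0" by (intro sum.neutral) simp
    then show ?thesis using False by simp
  qed
  have "(\<Sum>\<sigma> | \<sigma> permutes (UNIV::'m set). of_int (sign \<sigma>) * ?d \<sigma>) =
      (\<Sum>\<sigma> | \<sigma> permutes (UNIV::'m set). if \<sigma> = id then trace X else 0)"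
    by (rule sum.cong) (use 2 in auto)
  also have "\<dots> = trace X"
    by (simp add: finite_permutations permutes_id)
  finally show ?thesis using 1 by simp
qed

lemma matrix_pow_vec:
  fixes X :: "'a::field^'m^'m"
  assumes "X *v v = c *s v"
  shows "((((**) X) ^^ k) (mat 1)) *v v = c ^ k *s v"
  by (induction k) (simp_all add: matrix_vector_mul_assoc[symmetric] vector_scalar_commute assms mult.commute)

lemma invertible_iff_ker:
  fixes A :: "'a::field^'m^'m"
  shows "invertible A \<longleftrightarrow> (\<forall>x. A *v x = 0 \<longrightarrow> x = 0)"
  by (simp add: invertible_left_inverse matrix_left_invertible_ker)

text \<open>A zero of det (1 + z X) would make - 1 / z an eigenvalue of the nilpotent
  \<open>X\<close>. A polynomial without zeros is constant; its derivative at 0 is the trace and its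
  value at 1 the determinant.\<close>

lemma nilpotent_trace_det:
  fixes X :: "complex^'m^'m"
  assumes "(((**) X) ^^ k) (mat 1) = 0"
  shows "trace X = 0" "det (mat 1 + X) = 1"
proof -
  obtain p where p: "\<And>z. det (\<chi> i j. (if i = j then 1 else 0) + z * X $ i $ j) = poly p z"
    using det_one_plus_poly by blast
  have mv: "(\<chi> i j. (if i = j then 1 else 0) + z * X $ i $ j) *v v = v + z *s (X *v v)" for z v
    by (simp add: vec_eq_iff matrix_vector_mult_def distrib_right sum.distrib sum_distrib_left mult.assoc
        if_distrib[of "\<lambda>a. a * _"] cong: if_cong)
  have nz: "poly p z \<noteq> 0" for z
  proof -
    have "v = 0" if v: "v + z *s (X *v v) = 0" for v
    proof (cases "z = 0")
      case False
      have "X *v v = (- inverse z) *s v"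
        using v False by (simp add: vec_eq_iff add_eq_0_iff field_simps)
      from matrix_pow_vec[OF this, of k] have "(- inverse z) ^ k *s v = 0"
        using assms by simp
      then show ?thesis using False by simp
    qed (use that in simp)
    then have "invertible (\<chi> i j. (if i = j then 1 else 0) + z * X $ i $ j)"
      unfolding invertible_iff_ker mv by blast
    then show ?thesis by (simp add: invertible_det_nz p)
  qed
  then have c: "constant (poly p)" using fundamental_theorem_of_algebra by blast
  then have c0: "poly p z = poly p 0" for z by (auto simp: constant_def)
  have p0: "poly p 0 = 1" using p[of 0] by (simp add: mat_def[symmetric])
  have "((\<lambda>z. poly p z) has_field_derivative trace X) (at 0)"
    using det_one_plus_deriv[of X] by (simp add: p)
  moreover have "((\<lambda>z. poly p z) has_field_derivative 0) (at 0)"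
  proof -
    have "(\<lambda>z. poly p z) = (\<lambda>_. poly p 0)" using c0 by blast
    then show ?thesis by (metis DERIV_const)
  qed
  ultimately show "trace X = 0" by (rule DERIV_unique)
  have "mat 1 + X = (\<chi> i j. (if i = j then 1 else 0) + 1 * X $ i $ j)"
    by (simp add: vec_eq_iff mat_def)
  then show "det (mat 1 + X) = 1" using p[of 1] c0[of 1] p0 by simp
qed

lemma unipotent_trace_det:
  assumes "unipotent (u :: complex^'m^'m)"
  shows "trace (u - mat 1) = 0" "det u = 1"
  using assms nilpotent_trace_det[of _ "u - mat 1"] unfolding unipotent_def by auto

lemma matrix_diff_ldistrib:
  fixes A :: "'a::ring_1^'m^'n"
  shows "A ** (B - C) = A ** B - A ** C"
  by (simp add: vec_eq_iff matrix_matrix_mult_def right_diff_distrib sum_subtractf)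

lemma matrix_diff_rdistrib:
  fixes A :: "'a::ring_1^'m^'n"
  shows "(A - B) ** C = A ** C - B ** C"
  by (simp add: vec_eq_iff matrix_matrix_mult_def left_diff_distrib sum_subtractf)

lemma linear_matrix_vector_left: "linear (\<lambda>x. (x :: complex^'m^'m) *v w)"
  by (rule linearI) (simp_all add: vec_eq_iff matrix_vector_mult_def distrib_right sum.distrib scaleR_sum_right)

lemma linear_matrix_vector_right: "linear (\<lambda>w. (x :: complex^'m^'m) *v w)"
  by (rule linearI) (simp_all add: vec_eq_iff matrix_vector_mult_def distrib_left sum.distrib scaleR_sum_right)

lemma linear_matrix_mul_left: "linear (\<lambda>x. (x :: complex^'m^'m) ** y)"
  by (rule linearI) (simp_all add: vec_eq_iff matrix_matrix_mult_def distrib_right sum.distrib scaleR_sum_right)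

lemma linear_matrix_mul_right: "linear (\<lambda>y. (x :: complex^'m^'m) ** y)"
  by (rule linearI) (simp_all add: vec_eq_iff matrix_matrix_mult_def distrib_left sum.distrib scaleR_sum_right)

lemma linear_trace: "linear (trace :: complex^'m^'m \<Rightarrow> complex)"
  by (rule linearI) (simp_all add: trace_def sum.distrib scaleR_sum_right)

text \<open>If all powers of \<open>x\<close> are traceless then \<open>q z = det (1 - z x)\<close> satisfies \<open>q q' = 0\<close> at real points,
  because \<open>q' = - q tr ((1 - z x)\<inverse> x)\<close>, so it is constant.\<close>

lemma invertible_one_minus_traceless:
  fixes S :: "(complex^'m^'m) set"
  assumes S: "subspace S" and mult: "\<And>x y. x \<in> S \<Longrightarrow> y \<in> S \<Longrightarrow> x ** y \<in> S"
    and tr: "\<And>x. x \<in> S \<Longrightarrow> trace x = 0" and x: "x \<in> S"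
  shows "invertible (mat 1 - x)"
proof -
  obtain q where q: "\<And>z. det (\<chi> i j. (if i = j then 1 else 0) + z * (- x) $ i $ j) = poly q z"
    using det_one_plus_poly by blast
  have qr: "poly q (of_real t) = det (mat 1 - t *\<^sub>R x)" for t
    unfolding q[symmetric] by (rule arg_cong[of _ _ det]) (simp add: vec_eq_iff mat_def scaleR_complex)
  have key: "poly q (of_real t) * poly (pderiv q) (of_real t) = 0" for t
  proof (cases "poly q (of_real t) = 0")
    case False
    then have inv: "invertible (mat 1 - t *\<^sub>R x)" by (simp add: qr invertible_det_nz)
    let ?L = "\<lambda>s. (mat 1 - t *\<^sub>R x) ** s"
    have lin: "linear ?L"
      by (rule linear_matrix_mul_right)
    have inj: "inj ?L"
    proof (rule injI)
      fix a b assume ab: "?L a = ?L b"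
      obtain B where "B ** (mat 1 - t *\<^sub>R x) = mat 1" using inv invertible_left_inverse by blast
      then show "a = b" using ab by (metis matrix_mul_assoc matrix_mul_lid)
    qed
    have LS: "?L ` S \<subseteq> S"
    proof
      fix y assume "y \<in> ?L ` S"
      then obtain s where s: "s \<in> S" "y = ?L s" by auto
      have "y = s - t *\<^sub>R (x ** s)"
        unfolding s by (simp add: vec_eq_iff matrix_matrix_mult_def left_diff_distrib sum_subtractf mat_def if_distrib[of "\<lambda>a. a * _"] scaleR_sum_right cong: if_cong)
      then show "y \<in> S" using S mult[OF x s(1)] s(1) by (simp add: subspace_diff subspace_scale)
    qed
    \<comment> \<open>An injective linear map of the finite dimensional \<open>S\<close> into itself
      is onto, so the preimage of \<open>x\<close> under 1 - t x lies in \<open>S\<close> and is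
      traceless.\<close>
    have "dim (?L ` S) = dim S" by (rule dim_image_eq[OF lin]) (rule inj_on_subset[OF inj subset_UNIV])
    moreover have "subspace (?L ` S)" using lin S by (rule linear_subspace_image)
    ultimately have "?L ` S = S" using S LS by (metis subspace_dim_equal order_refl)
    with x have "x \<in> ?L ` S" by simp
    then obtain y where y: "y \<in> S" "?L y = x" by (elim imageE) simp
    obtain r where r: "\<And>z. det (\<chi> i j. (if i = j then 1 else 0) + z * (- y) $ i $ j) = poly r z"
      using det_one_plus_poly by blast
    \<comment> \<open>Factor 1 - (t + h) x = (1 - t x) (1 - h y), where y = (1 - t x)^-1 x.\<close>
    have pq: "poly q (of_real t + h) = poly q (of_real t) * poly r h" for h
    proof -
      have yx: "(\<Sum>k\<in>UNIV. ((if i = k then 1 else 0) - of_real t * x $ i $ k) * y $ k $ j) = x $ i $ j" for i j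
        using y(2) by (simp add: vec_eq_iff matrix_matrix_mult_def mat_def scaleR_complex)
      have eq: "(\<chi> i j. (if i = j then 1 else 0) + (of_real t + h) * (- x) $ i $ j) =
        (mat 1 - t *\<^sub>R x) ** (\<chi> i j. (if i = j then 1 else 0) + h * (- y) $ i $ j)"
      proof -
        have "(\<Sum>k\<in>UNIV. ((if i = k then 1 else 0) - of_real t * x $ i $ k) * ((if k = j then 1 else 0) - h * y $ k $ j)) =
          ((if i = j then 1 else 0) - of_real t * x $ i $ j) - h * x $ i $ j" for i j
        proof -
          have "(\<Sum>k\<in>UNIV. ((if i = k then 1 else 0) - of_real t * x $ i $ k) * ((if k = j then 1 else 0) - h * y $ k $ j)) =
             (\<Sum>k\<in>UNIV. (if k = j then ((if i = k then 1 else 0) - of_real t * x $ i $ k) else 0)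
              - h * (((if i = k then 1 else 0) - of_real t * x $ i $ k) * y $ k $ j))"
            by (rule sum.cong) (auto simp: algebra_simps)
          also have "\<dots> = ((if i = j then 1 else 0) - of_real t * x $ i $ j) - h * x $ i $ j"
            unfolding sum_subtractf sum_distrib_left[symmetric] yx by simp
          finally show ?thesis .
        qed
        then show ?thesis
          by (simp add: vec_eq_iff matrix_matrix_mult_def mat_def scaleR_complex algebra_simps)
      qed
      show ?thesis unfolding q[of "of_real t + h", symmetric] eq det_mul qr r ..
    qed
    have d1: "((\<lambda>h. poly q (of_real t + h)) has_field_derivative (poly q (of_real t) * trace (- y))) (at 0)"
      unfolding pq by (rule DERIV_cmult[OF det_one_plus_deriv[of "-y", unfolded r]])
    have "trace (- y) = 0" using tr[OF y(1)] by (simp add: trace_def sum_negf)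
    moreover have d2: "((\<lambda>h. poly q (of_real t + h)) has_field_derivative (poly (pderiv q) (of_real t))) (at 0)"
    proof -
      have "((\<lambda>z. poly q z) has_field_derivative (poly (pderiv q) (of_real t))) (at (0 + of_real t))"
        by (simp add: poly_DERIV)
      then show ?thesis unfolding DERIV_shift by (simp add: add.commute)
    qed
    ultimately have "poly (pderiv q) (of_real t) = 0" using DERIV_unique[OF d1 d2] by simp
    then show ?thesis by simp
  qed simp
  have "q * pderiv q = 0"
  proof (rule ccontr)
    assume "q * pderiv q \<noteq> 0"
    then have "finite {z. poly (q * pderiv q) z = 0}" by (rule poly_roots_finite)
    moreover have "range complex_of_real \<subseteq> {z. poly (q * pderiv q) z = 0}" using key by auto
    ultimately have "finite (range complex_of_real)" by (rule rev_finite_subset)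
    then show False by (metis finite_imageD infinite_UNIV_char_0 inj_of_real)
  qed
  moreover have q0: "poly q 0 = 1" using qr[of 0] by simp
  ultimately have "pderiv q = 0" by (metis mult_eq_0_iff poly_0 zero_neq_one)
  then have "degree q = 0" by (simp add: pderiv_eq_0_iff)
  then have "poly q 1 = 1" using q0 by (metis degree_eq_zeroE poly_const_conv)
  then show ?thesis using qr[of 1] by (simp add: invertible_det_nz)
qed

text \<open>Kolchin's theorem for the quotient \<open>B / A\<close>: on a minimal stable subspace \<open>M\<close> above \<open>A\<close> the
  augmentation ideal must act by zero, since otherwise one of its elements has a fixed vector modulo \<open>A\<close>.\<close>

lemma kolchin:
  fixes N :: "(complex^'m^'m) set" and A B :: "(complex^'m) set"
  assumes mult: "\<And>u w. u \<in> N \<Longrightarrow> w \<in> N \<Longrightarrow> u ** w \<in> N"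
    and uni: "\<And>u. u \<in> N \<Longrightarrow> unipotent u"
    and A: "subspace A" and B: "subspace B" and AB: "A \<subset> B"
    and NA: "\<And>u x. u \<in> N \<Longrightarrow> x \<in> A \<Longrightarrow> u *v x \<in> A"
    and NB: "\<And>u x. u \<in> N \<Longrightarrow> x \<in> B \<Longrightarrow> u *v x \<in> B"
  shows "\<exists>w\<in>B - A. \<forall>u\<in>N. u *v w - w \<in> A"
proof -
  define S where "S = span ((\<lambda>u. u - mat 1) ` N)"
  have S: "subspace S" by (simp add: S_def)
  have gen: "u - mat 1 \<in> S" if "u \<in> N" for u
    unfolding S_def using that by (auto intro: span_base)
  have tr: "trace x = 0" if "x \<in> S" for x
    using that unfolding S_def
  proof (induction rule: span_induct)
    case base
    show ?case using linear_subspace_vimage[OF linear_trace subspace_single_0] by (simp add: vimage_def)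
  next
    case (step x)
    then show ?case using unipotent_trace_det uni by auto
  qed
  have smult: "x ** y \<in> S" if "x \<in> S" "y \<in> S" for x y
  proof -
    have 1: "(u - mat 1) ** y \<in> S" if "u \<in> N" "y \<in> S" for u y
      using that(2) unfolding S_def
    proof (induction rule: span_induct)
      case base
      have "subspace S" by (simp add: S_def)
      from linear_subspace_vimage[OF linear_matrix_mul_right[of "u - mat 1"] this]
      show ?case by (simp add: S_def vimage_def)
    next
      case (step y)
      then obtain w where w: "w \<in> N" "y = w - mat 1" by auto
      have "(u - mat 1) ** y = (u ** w - mat 1) - (u - mat 1) - (w - mat 1)"
        unfolding w by (simp add: matrix_diff_ldistrib matrix_diff_rdistrib)
      then show ?case unfolding S_def[symmetric]
        by (simp only:) (intro subspace_diff S gen mult that(1) w(1))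
    qed
    show ?thesis using that(1) unfolding S_def
    proof (induction rule: span_induct)
      case base
      from linear_subspace_vimage[OF linear_matrix_mul_left[of y] S]
      show ?case by (simp add: S_def vimage_def)
    next
      case (step x)
      then show ?case using 1 that(2) by (auto simp: S_def)
    qed
  qed
  have inv: "invertible (mat 1 - x)" if "x \<in> S" for x
    by (rule invertible_one_minus_traceless[OF S smult tr that])
  have stab: "x *v w \<in> M" if "x \<in> S" "w \<in> M" "subspace M" "\<And>u x. u \<in> N \<Longrightarrow> x \<in> M \<Longrightarrow> u *v x \<in> M" for x w M
    using that(1) unfolding S_def
  proof (induction rule: span_induct)
    case base
    from linear_subspace_vimage[OF linear_matrix_vector_left[of w] that(3)]
    show ?case by (simp add: vimage_def)
  next
    case (step x)
    then show ?case using that by (auto simp: matrix_vector_mult_diff_rdistrib subspace_diff)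
  qed
  define P where "P M \<longleftrightarrow> subspace M \<and> A \<subset> M \<and> M \<subseteq> B \<and> (\<forall>u\<in>N. \<forall>x\<in>M. u *v x \<in> M)" for M
  have "P B" using B AB NB by (auto simp: P_def)
  then obtain M where M: "P M" and min: "\<And>M'. P M' \<Longrightarrow> dim M \<le> dim M'"
    using ex_has_least_nat[of P B dim] by blast
  from M have sM: "subspace M" and AM: "A \<subset> M" and MB: "M \<subseteq> B" and NM: "\<And>u x. u \<in> N \<Longrightarrow> x \<in> M \<Longrightarrow> u *v x \<in> M"
    by (auto simp: P_def)
  obtain w where w: "w \<in> M" "w \<notin> A" using AM by auto
  \<comment> \<open>The sum of S w and \<open>A\<close> is stable and lies between \<open>A\<close>
    and \<open>M\<close>, so minimality of \<open>M\<close> leaves only these two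
    possibilities.\<close>
  let ?M = "{y + a |y a. y \<in> (\<lambda>x. x *v w) ` S \<and> a \<in> A}"
  have "subspace ?M"
    by (rule subspace_sums[OF linear_subspace_image[OF linear_matrix_vector_left S] A])
  moreover have "A \<subseteq> ?M"
  proof
    fix a assume a: "a \<in> A"
    have "(0::complex^'m) = 0 *v w" by simp
    then have "0 \<in> (\<lambda>x. x *v w) ` S" using S by (metis imageI subspace_0)
    then show "a \<in> ?M" using a by force
  qed
  moreover have MM: "?M \<subseteq> M"
    using stab[OF _ w(1) sM NM] AM sM by (auto intro!: subspace_add)
  moreover have "u *v z \<in> ?M" if "u \<in> N" "z \<in> ?M" for u z
  proof -
    from that(2) obtain x a where x: "x \<in> S" "a \<in> A" "z = x *v w + a" by auto
    have "u *v z = ((u - mat 1) ** x + x) *v w + u *v a"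
      unfolding x by (simp add: matrix_vector_right_distrib matrix_vector_mul_assoc matrix_diff_rdistrib)
    moreover have "(u - mat 1) ** x + x \<in> S" using smult[OF gen[OF that(1)] x(1)] x(1) S by (simp add: subspace_add)
    ultimately show ?thesis using NA[OF that(1) x(2)] by blast
  qed
  ultimately have PM: "P ?M" if "?M \<noteq> A"
    using MB that unfolding P_def by blast
  have "?M = A"
  proof (rule ccontr)
    assume "?M \<noteq> A"
    from PM[OF this] have PM: "P ?M" .
    then have "?M = M" using min[OF PM] MM sM by (metis (no_types, lifting) P_def subspace_dim_equal)
    with w have "w \<in> ?M" by simp
    then obtain y a where ya: "y \<in> (\<lambda>x. x *v w) ` S" "a \<in> A" "w = y + a" by blast
    from ya(1) obtain x where xS: "x \<in> S" and y: "y = x *v w" by (elim imageE)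
    note x = xS ya(2) ya(3)[unfolded y]
    \<comment> \<open>Here (1 - x) w = a lies in \<open>A\<close>. As 1 - x is injective and maps
      \<open>A\<close> onto itself, \<open>a\<close> already has a preimage in \<open>A\<close>, and
      this preimage must be \<open>w\<close>.\<close>
    let ?L = "\<lambda>v. (mat 1 - x) *v v"
    have inj: "inj ?L"
    proof (rule injI)
      fix b c assume "?L b = ?L c"
      then have "?L (b - c) = 0" by (simp add: matrix_vector_mult_diff_distrib)
      then show "b = c" using inv[OF x(1)] unfolding invertible_iff_ker by (metis eq_iff_diff_eq_0)
    qed
    have lin: "linear ?L" by (rule linear_matrix_vector_right)
    have LA: "?L ` A \<subseteq> A" using stab[OF x(1) _ A NA] A by (auto simp: matrix_vector_mult_diff_rdistrib subspace_diff)
    have "dim (?L ` A) = dim A" by (rule dim_image_eq[OF lin]) (rule inj_on_subset[OF inj subset_UNIV])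
    then have "?L ` A = A" using LA A lin by (metis linear_subspace_image subspace_dim_equal order_refl)
    moreover have "?L w = a" using x(3) by (simp add: matrix_vector_mult_diff_rdistrib algebra_simps)
    ultimately obtain a' where "a' \<in> A" "?L a' = ?L w" using x(2) by (metis imageE)
    then show False using inj w(2) by (metis injD)
  qed
  have "u *v w - w \<in> A" if "u \<in> N" for u
  proof -
    have "(u - mat 1) *v w + 0 \<in> ?M" using gen[OF that] subspace_0[OF A] by blast
    then show ?thesis using \<open>?M = A\<close> by (simp add: matrix_vector_mult_diff_rdistrib)
  qed
  then show ?thesis using w MB by blast
qed

section \<open>Determinants on subspaces\<close>

text \<open>A determinant indexed by a finite set rather than a type, because \<open>det_on\<close>
  uses the basis itself as index set.\<close>

definition leibniz :: "'i set \<Rightarrow> ('i \<Rightarrow> 'i \<Rightarrow> real) \<Rightarrow> real" where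
  "leibniz S A = (\<Sum>p | p permutes S. of_int (sign p) * (\<Prod>i\<in>S. A i (p i)))"

lemma leibniz_permute_rows:
  assumes "finite S" "q permutes S"
  shows "leibniz S (\<lambda>i. A (q i)) = of_int (sign q) * leibniz S A"
proof -
  have pq: "permutation q" using assms permutation_permutes by blast
  have "leibniz S (\<lambda>i. A (q i)) = (\<Sum>p | p permutes S. of_int (sign (p \<circ> q)) * (\<Prod>i\<in>S. A (q i) ((p \<circ> q) i)))"
    unfolding leibniz_def by (rule sum_permutations_compose_right[OF assms(2)])
  also have "\<dots> = (\<Sum>p | p permutes S. of_int (sign q) * (of_int (sign p) * (\<Prod>i\<in>S. A i (p i))))"
  proof (rule sum.cong)
    fix p assume "p \<in> {p. p permutes S}"
    then have "permutation p" using assms permutation_permutes by blast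
    then have "sign (p \<circ> q) = sign p * sign q" using pq by (rule sign_compose)
    moreover have "(\<Prod>i\<in>S. A (q i) ((p \<circ> q) i)) = (\<Prod>i\<in>S. A i (p i))"
      using prod.permute[OF assms(2), of "\<lambda>i. A i (p i)"] by (simp add: o_def)
    ultimately show "of_int (sign (p \<circ> q)) * (\<Prod>i\<in>S. A (q i) ((p \<circ> q) i)) =
      of_int (sign q) * (of_int (sign p) * (\<Prod>i\<in>S. A i (p i)))" by simp
  qed simp
  finally show ?thesis by (simp add: leibniz_def sum_distrib_left)
qed

lemma leibniz_cong:
  assumes "\<And>i j. i \<in> S \<Longrightarrow> j \<in> S \<Longrightarrow> A i j = B i j"
  shows "leibniz S A = leibniz S B"
  unfolding leibniz_def
  by (intro sum.cong refl arg_cong2[of _ _ _ _ "(*)"] prod.cong) (auto simp: assms permutes_in_image)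

lemma leibniz_equal_rows:
  assumes "finite S" "a \<in> S" "b \<in> S" "a \<noteq> b" "A a = A b"
  shows "leibniz S A = 0"
proof -
  have "leibniz S (\<lambda>i. A (Transposition.transpose a b i)) = - leibniz S A"
    using leibniz_permute_rows[OF assms(1), of "Transposition.transpose a b" A] assms
    by (simp add: permutes_swap_id sign_swap_id)
  moreover have "(\<lambda>i. A (Transposition.transpose a b i)) = A"
    using assms(5) by (auto simp: fun_eq_iff Transposition.transpose_def)
  ultimately show ?thesis by simp
qed

text \<open>Expanding the product of sums gives one term for each function from \<open>S\<close> to
  itself. Functions that are not injective repeat a row and contribute zero; the others are
  permutations.\<close>

lemma leibniz_mult:
  assumes "finite S"
  shows "leibniz S (\<lambda>i j. \<Sum>k\<in>S. C i k * A k j) = leibniz S C * leibniz S A"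
proof -
  have "leibniz S (\<lambda>i j. \<Sum>k\<in>S. C i k * A k j) =
    (\<Sum>p | p permutes S. of_int (sign p) * (\<Sum>f\<in>PiE S (\<lambda>_. S). \<Prod>i\<in>S. C i (f i) * A (f i) (p i)))"
    unfolding leibniz_def by (simp add: prod_sum_PiE assms)
  also have "\<dots> = (\<Sum>f\<in>PiE S (\<lambda>_. S). (\<Prod>i\<in>S. C i (f i)) * leibniz S (\<lambda>i. A (f i)))"
    unfolding leibniz_def sum_distrib_left
    by (subst sum.swap) (simp add: prod.distrib mult_ac)
  also have "\<dots> = (\<Sum>f\<in>{f\<in>PiE S (\<lambda>_. S). inj_on f S}. (\<Prod>i\<in>S. C i (f i)) * leibniz S (\<lambda>i. A (f i)))"
  proof (rule sum.mono_neutral_right)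
    show "\<forall>f\<in>PiE S (\<lambda>_. S) - {f \<in> PiE S (\<lambda>_. S). inj_on f S}. (\<Prod>i\<in>S. C i (f i)) * leibniz S (\<lambda>i. A (f i)) = 0"
    proof
      fix f assume "f \<in> PiE S (\<lambda>_. S) - {f \<in> PiE S (\<lambda>_. S). inj_on f S}"
      then obtain a b where "a \<in> S" "b \<in> S" "a \<noteq> b" "f a = f b" by (auto simp: inj_on_def)
      then have "leibniz S (\<lambda>i. A (f i)) = 0" using assms leibniz_equal_rows[of S a b "\<lambda>i. A (f i)"] by simp
      then show "(\<Prod>i\<in>S. C i (f i)) * leibniz S (\<lambda>i. A (f i)) = 0" by simp
    qed
  qed (use assms in \<open>auto intro: finite_PiE\<close>)
  also have "\<dots> = (\<Sum>q | q permutes S. (\<Prod>i\<in>S. C i (q i)) * leibniz S (\<lambda>i. A (q i)))"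
  proof (rule sum.reindex_bij_witness[where j = "\<lambda>f x. if x \<in> S then f x else x" and i = "\<lambda>q. restrict q S"])
    fix f assume f: "f \<in> {f \<in> PiE S (\<lambda>_. S). inj_on f S}"
    show "restrict (\<lambda>x. if x \<in> S then f x else x) S = f" using f by (auto simp: fun_eq_iff PiE_def extensional_def)
    have "f ` S \<subseteq> S" "inj_on f S" using f by auto
    with assms have "bij_betw f S S" by (simp add: bij_betw_def endo_inj_surj)
    then have "bij_betw (\<lambda>x. if x \<in> S then f x else x) S S" by (rule bij_betw_cong[THEN iffD1, rotated]) auto
    then show "(\<lambda>x. if x \<in> S then f x else x) \<in> {q. q permutes S}" by (auto intro: bij_imp_permutes)
    show "(\<Prod>i\<in>S. C i (if i \<in> S then f i else i)) * leibniz S (\<lambda>i. A (if i \<in> S then f i else i)) =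
      (\<Prod>i\<in>S. C i (f i)) * leibniz S (\<lambda>i. A (f i))"
      by (intro arg_cong2[of _ _ _ _ "(*)"] prod.cong leibniz_cong) auto
  next
    fix q assume q: "q \<in> {q. q permutes S}"
    show "(\<lambda>x. if x \<in> S then restrict q S x else x) = q" using q by (auto simp: fun_eq_iff permutes_not_in)
    show "restrict q S \<in> {f \<in> PiE S (\<lambda>_. S). inj_on f S}" using q
      by (auto simp: permutes_in_image inj_on_def dest: permutes_inj_on[THEN inj_onD])
  qed
  also have "\<dots> = (\<Sum>q | q permutes S. of_int (sign q) * (\<Prod>i\<in>S. C i (q i)) * leibniz S A)"
    by (rule sum.cong) (simp_all add: leibniz_permute_rows assms)
  also have "\<dots> = leibniz S C * leibniz S A" by (simp add: leibniz_def sum_distrib_right)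
  finally show ?thesis .
qed

lemma leibniz_diagonal:
  assumes "finite S"
  shows "leibniz S (\<lambda>i j. if i = j then d i else 0) = (\<Prod>i\<in>S. d i)"
proof -
  have "(\<Prod>i\<in>S. if i = p i then d i else 0) = 0" if pS: "p permutes S" and pid: "p \<noteq> id" for p
  proof -
    obtain x where "p x \<noteq> x" using pid by (auto simp: fun_eq_iff)
    moreover then have "x \<in> S" using pS by (metis permutes_not_in)
    ultimately show ?thesis using assms by (intro prod_zero bexI[of _ x]) auto
  qed
  then have "leibniz S (\<lambda>i j. if i = j then d i else 0) =
     (\<Sum>p | p permutes S. if p = id then \<Prod>i\<in>S. d i else 0)"
    unfolding leibniz_def by (intro sum.cong) auto
  then show ?thesis using assms by (simp add: finite_permutations permutes_id)
qed

text \<open>The basis inside \<open>det_on\<close> is an unspecified choice, so the eigenbasis has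
  to be compared with it. The transition matrix \<open>?C\<close> intertwines the matrix of
  \<open>f\<close> with the diagonal one, and its determinant can be cancelled because
  \<open>?C'\<close> is inverse to it.\<close>

lemma det_on_eigenbasis:
  fixes V :: "'a::euclidean_space set"
  assumes V: "subspace V" and f: "linear f"
    and D: "finite D" "inj_on d D" "independent (d ` D)" "span (d ` D) = V"
    and eig: "\<And>k. k \<in> D \<Longrightarrow> f (d k) = \<mu> k *\<^sub>R d k"
  shows "det_on V f = (\<Prod>k\<in>D. \<mu> k)"
proof -
  define B where "B = (SOME B. B \<subseteq> V \<and> independent B \<and> V \<subseteq> span B)"
  have "\<exists>B. B \<subseteq> V \<and> independent B \<and> V \<subseteq> span B" using basis_exists[of V] by metis
  from someI_ex[OF this] have B: "B \<subseteq> V" "independent B" "V \<subseteq> span B" unfolding B_def by blast+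
  have spB: "span B = V" using B V by (metis span_minimal subset_antisym)
  have finB: "finite B" using B(2) by (rule independent_imp_finite)
  let ?E = "d ` D"
  have "card B = dim V" using B by (metis dim_eq_card_independent spB dim_span)
  moreover have "card ?E = dim V" using D by (metis dim_eq_card_independent dim_span)
  ultimately obtain e where e: "bij_betw e B ?E" using finB D(1) by (metis finite_imageI finite_same_card_bij)
  have eV: "e b \<in> V" if "b \<in> B" for b using that e D(4) by (metis bij_betwE span_base)
  define \<nu> where "\<nu> b = \<mu> (the_inv_into D d (e b))" for b
  have fe: "f (e b) = \<nu> b *\<^sub>R e b" if "b \<in> B" for b
  proof -
    have "e b \<in> d ` D" using that e by (rule bij_betwE[rule_format, rotated])
    then obtain k where k: "k \<in> D" "e b = d k" by auto
    then show ?thesis using eig[OF k(1)] D(2) by (simp add: \<nu>_def the_inv_into_f_f)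
  qed
  have fV: "f x \<in> V" if "x \<in> V" for x
  proof -
    have "f ` span ?E \<subseteq> span ?E"
      unfolding linear_span_image[OF f, symmetric]
    proof (rule span_minimal)
      show "f ` ?E \<subseteq> span ?E"
      proof clarify
        fix k assume "k \<in> D"
        then have "\<mu> k *\<^sub>R d k \<in> span ?E" by (intro span_scale span_base imageI)
        then show "f (d k) \<in> span ?E" using eig[OF \<open>k \<in> D\<close>] by simp
      qed
    qed simp
    then show ?thesis using that D(4) by blast
  qed
  let ?R = "representation B"
  have rep_lin: "?R (f x) c = (\<Sum>b\<in>B. ?R x b * ?R (f b) c)" if "x \<in> V" for x c
  proof -
    have "x = (\<Sum>b\<in>B. ?R x b *\<^sub>R b)"
      using sum_representation_eq[OF B(2), of x B] that B finB by auto
    then have fx: "f x = (\<Sum>b\<in>B. ?R x b *\<^sub>R f b)" by (metis (no_types, lifting) f linear_sum linear_cmul sum.cong)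
    have "?R (f x) c = (\<Sum>b\<in>B. ?R (?R x b *\<^sub>R f b) c)" unfolding fx
      by (subst representation_sum[OF B(2)]) (use fV B spB in \<open>auto intro!: span_scale simp: subset_iff\<close>)
    also have "\<dots> = (\<Sum>b\<in>B. ?R x b * ?R (f b) c)"
      by (intro sum.cong refl) (use representation_scale[OF B(2)] fV B spB in \<open>auto simp: subset_iff\<close>)
    finally show ?thesis .
  qed
  let ?A = "\<lambda>b c. ?R (f b) c"
  let ?C = "\<lambda>b c. ?R (e b) c"
  let ?C' = "\<lambda>b c. representation ?E b (e c)"
  have "leibniz B ?C * leibniz B ?A = leibniz B (\<lambda>b c. \<Sum>k\<in>B. ?C b k * ?A k c)"
    by (rule leibniz_mult[OF finB, symmetric])
  also have "\<dots> = leibniz B (\<lambda>b c. \<Sum>k\<in>B. (if b = k then \<nu> b else 0) * ?C k c)"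
  proof (rule leibniz_cong)
    fix b c assume bc: "b \<in> B" "c \<in> B"
    have "(\<Sum>k\<in>B. ?C b k * ?A k c) = ?R (f (e b)) c" using rep_lin[OF eV[OF bc(1)]] by simp
    also have "\<dots> = \<nu> b * ?R (e b) c" unfolding fe[OF bc(1)]
      using representation_scale[OF B(2)] eV[OF bc(1)] spB by simp
    finally show "(\<Sum>k\<in>B. ?C b k * ?A k c) = (\<Sum>k\<in>B. (if b = k then \<nu> b else 0) * ?C k c)"
      using bc finB by (simp add: if_distrib[of "\<lambda>x. x * _"] cong: if_cong)
  qed
  also have "\<dots> = (\<Prod>b\<in>B. \<nu> b) * leibniz B ?C"
    by (simp add: leibniz_mult[OF finB] leibniz_diagonal[OF finB])
  finally have 1: "leibniz B ?C * leibniz B ?A = (\<Prod>b\<in>B. \<nu> b) * leibniz B ?C" .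
  have "leibniz B ?C' * leibniz B ?C = leibniz B (\<lambda>b c. \<Sum>k\<in>B. ?C' b k * ?C k c)"
    by (rule leibniz_mult[OF finB, symmetric])
  also have "\<dots> = leibniz B (\<lambda>b c. if b = c then 1 else 0)"
  proof (rule leibniz_cong)
    fix b c assume bc: "b \<in> B" "c \<in> B"
    have "b = (\<Sum>x\<in>?E. representation ?E b x *\<^sub>R x)"
      using sum_representation_eq[OF D(3), of b ?E] D bc B by auto
    also have "\<dots> = (\<Sum>k\<in>B. ?C' b k *\<^sub>R e k)"
      by (rule sum.reindex_bij_betw[OF e, symmetric])
    finally have "?R b c = ?R (\<Sum>k\<in>B. ?C' b k *\<^sub>R e k) c" by simp
    also have "\<dots> = (\<Sum>k\<in>B. ?R (?C' b k *\<^sub>R e k) c)"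
      by (subst representation_sum[OF B(2)]) (use eV spB in \<open>auto intro!: span_scale\<close>)
    also have "\<dots> = (\<Sum>k\<in>B. ?C' b k * ?C k c)"
      by (intro sum.cong refl) (use representation_scale[OF B(2)] eV spB in auto)
    finally show "(\<Sum>k\<in>B. ?C' b k * ?C k c) = (if b = c then 1 else 0)"
      using representation_basis[OF B(2) bc(1)] by (simp add: eq_commute[of c b])
  qed
  also have "\<dots> = 1" by (simp add: leibniz_diagonal[OF finB])
  finally have "leibniz B ?C \<noteq> 0" by auto
  with 1 have "leibniz B ?A = (\<Prod>b\<in>B. \<nu> b)" by simp
  also have "\<dots> = (\<Prod>x\<in>?E. \<mu> (the_inv_into D d x))"
    unfolding \<nu>_def by (rule prod.reindex_bij_betw[OF e])
  also have "\<dots> = (\<Prod>k\<in>D. \<mu> k)"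
    using D(2) by (simp add: prod.reindex the_inv_into_f_f)
  finally show ?thesis unfolding det_on_def leibniz_def B_def by (simp add: Let_def)
qed

section \<open>Conjugate transposes, matrix inverses and diagonal matrices\<close>

lemma ctranspose_nth [simp]: "ctranspose g $ i $ j = cnj (g $ j $ i)"
  by (simp add: ctranspose_def)

lemma ctranspose_mult: "ctranspose (g ** h) = ctranspose h ** ctranspose g"
  by (simp add: vec_eq_iff matrix_matrix_mult_def mult.commute)

lemma ctranspose_ctranspose [simp]: "ctranspose (ctranspose g) = g"
  by (simp add: vec_eq_iff)

lemma ctranspose_one [simp]: "ctranspose (mat 1) = mat 1"
  by (simp add: vec_eq_iff mat_def)

lemma invertibleI: "A ** B = mat 1 \<Longrightarrow> invertible (A :: 'a::field^'m^'m)"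
  by (meson invertible_right_inverse)

lemma matrix_inv_eqI:
  fixes A :: "'a::field^'m^'m"
  assumes "A ** B = mat 1"
  shows "matrix_inv A = B" "matrix_inv B = A"
proof -
  have BA: "B ** A = mat 1" using assms by (simp add: matrix_left_right_inverse)
  then have "invertible A" using assms unfolding invertible_def by blast
  then have 1: "A ** matrix_inv A = mat 1" "matrix_inv A ** A = mat 1"
    unfolding matrix_inv_def invertible_def by (metis (mono_tags, lifting) someI_ex)+
  show "matrix_inv A = B" by (metis 1 BA matrix_mul_assoc matrix_mul_lid matrix_mul_rid)
  have "invertible B" using assms BA unfolding invertible_def by blast
  then have 2: "B ** matrix_inv B = mat 1" "matrix_inv B ** B = mat 1"
    unfolding matrix_inv_def invertible_def by (metis (mono_tags, lifting) someI_ex)+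
  show "matrix_inv B = A" by (metis 2 BA assms matrix_mul_assoc matrix_mul_lid matrix_mul_rid)
qed

lemma matrix_inv_mult:
  assumes "invertible (A :: 'a::field^'m^'m)"
  shows "A ** matrix_inv A = mat 1" "matrix_inv A ** A = mat 1"
  using assms unfolding matrix_inv_def invertible_def by (metis (mono_tags, lifting) someI_ex)+

lemma GL_simps [simp]:
  "carrier GL = {g. invertible g}" "x \<otimes>\<^bsub>GL\<^esub> y = x ** y" "\<one>\<^bsub>GL\<^esub> = mat 1"
  by (simp_all add: GL_def)

lemma group_GL: "group (GL :: (complex^'m^'m) monoid)"
proof (rule groupI)
  fix x :: "complex^'m^'m" assume "x \<in> carrier GL"
  then show "\<exists>y\<in>carrier GL. y \<otimes>\<^bsub>GL\<^esub> x = \<one>\<^bsub>GL\<^esub>"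
    using matrix_inv_mult[of x] invertible_def[of "matrix_inv x"] by auto
qed (auto simp: matrix_mul_assoc intro: invertible_mult invertibleI[of "mat 1" "mat 1"])

lemma inv_GL: "invertible x \<Longrightarrow> inv\<^bsub>GL\<^esub> x = matrix_inv x"
  by (rule group.inv_equality[OF group_GL]) (use matrix_inv_mult[of x] invertible_def[of "matrix_inv x"] in auto)

lemma invertible_imp_matrix_inv: "invertible (x :: 'a::field^'m^'m) \<Longrightarrow> invertible (matrix_inv x)"
  using matrix_inv_mult[of x] invertible_def by blast

definition diagm :: "('m \<Rightarrow> complex) \<Rightarrow> complex^'m^'m" where
  "diagm d = (\<chi> i j. if i = j then d i else 0)"

lemma diagm_mult_nth: "(diagm d ** X) $ i $ j = d i * X $ i $ j"
proof -
  have "(diagm d ** X) $ i $ j = (\<Sum>k\<in>UNIV. if k = i then d i * X $ i $ j else 0)"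
    unfolding diagm_def matrix_matrix_mult_def vec_lambda_beta by (rule sum.cong) auto
  then show ?thesis by simp
qed

lemma mult_diagm_nth: "(X ** diagm d) $ i $ j = d j * X $ i $ j"
proof -
  have "(X ** diagm d) $ i $ j = (\<Sum>k\<in>UNIV. if k = j then d j * X $ i $ j else 0)"
    unfolding diagm_def matrix_matrix_mult_def vec_lambda_beta by (rule sum.cong) auto
  then show ?thesis by simp
qed

locale real_or_complex =
  fixes F :: "complex set"
  assumes F: "F = \<real> \<or> F = UNIV"
begin

lemma F_closed [simp, intro]:
  "0 \<in> F" "1 \<in> F" "a \<in> F \<Longrightarrow> b \<in> F \<Longrightarrow> a + b \<in> F" "a \<in> F \<Longrightarrow> b \<in> F \<Longrightarrow> a * b \<in> F"
  "a \<in> F \<Longrightarrow> - a \<in> F" "a \<in> F \<Longrightarrow> b \<in> F \<Longrightarrow> a - b \<in> F" "a \<in> F \<Longrightarrow> cnj a \<in> F" "of_real r \<in> F"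
  using F by (auto simp: Reals_cnj_iff)

lemma F_sum: "(\<And>k. k \<in> A \<Longrightarrow> h k \<in> F) \<Longrightarrow> (\<Sum>k\<in>A. h k) \<in> F"
  by (induction A rule: infinite_finite_induct) auto

lemma matrix_mult_F:
  "(\<And>i j. A $ i $ j \<in> F) \<Longrightarrow> (\<And>i j. B $ i $ j \<in> F) \<Longrightarrow> (A ** B) $ i $ j \<in> F"
  unfolding matrix_matrix_mult_def by (auto intro!: F_sum)

end

section \<open>The unipotent group of an isotropic flag\<close>

text \<open>Coordinates adapted to a flag: the basis vectors \<open>i1\<close>, \<open>i2\<close> are isotropic with duals \<open>j1\<close>, \<open>j2\<close>,
  the others are orthonormal. So \<open>S\<close> is the Gram matrix, \<open>lv\<close> the grading refining the flag, and \<open>NS\<close>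
  consists of the isometries that are unipotent with respect to it.\<close>

locale split_frame =
  fixes i1 i2 j2 j1 :: "'m::finite" and F :: "complex set"
  assumes dist: "distinct [i1, i2, j2, j1]"
    and F_cases: "F = \<real> \<and> - {i1, i2, j2, j1} \<noteq> {} \<or> F = UNIV \<and> - {i1, i2, j2, j1} = {}"

sublocale split_frame \<subseteq> real_or_complex F
  by unfold_locales (use F_cases in auto)

context split_frame
begin

definition P0 :: "'m set" where "P0 = - {i1, i2, j2, j1}"

definition sw :: "'m \<Rightarrow> 'm" where
  "sw k = (if k = i1 then j1 else if k = j1 then i1 else if k = i2 then j2 else if k = j2 then i2 else k)"

definition lv :: "'m \<Rightarrow> int" where
  "lv k = (if k = i1 then 2 else if k = i2 then 1 else if k = j2 then - 1 else if k = j1 then - 2 else 0)"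

definition S :: "complex^'m^'m" where
  "S = (\<chi> i j. if j = sw i then 1 else 0)"

definition upper :: "complex^'m^'m \<Rightarrow> bool" where
  "upper X \<longleftrightarrow> (\<forall>i j. X $ i $ j \<noteq> 0 \<longrightarrow> lv j < lv i)"

definition NS :: "(complex^'m^'m) set" where
  "NS = {g. (\<forall>i j. g $ i $ j \<in> F) \<and> upper (g - mat 1) \<and> ctranspose g ** S ** g = S}"

definition rl :: bool where "rl \<longleftrightarrow> F = \<real>"

lemma F_iff: "a \<in> F \<longleftrightarrow> (rl \<longrightarrow> Im a = 0)"
  using F_cases by (auto simp: rl_def complex_is_Real_iff)

lemma rl_iff: "rl \<longleftrightarrow> P0 \<noteq> {}"
proof -
  have "(UNIV::complex set) \<noteq> \<real>" by (metis UNIV_I complex_is_Real_iff imaginary_unit.simps(2) zero_neq_one)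
  then show ?thesis using F_cases unfolding P0_def rl_def by auto
qed

lemma dist' [simp]:
  "i1 \<noteq> i2" "i1 \<noteq> j2" "i1 \<noteq> j1" "i2 \<noteq> j2" "i2 \<noteq> j1" "j2 \<noteq> j1"
  "i2 \<noteq> i1" "j2 \<noteq> i1" "j1 \<noteq> i1" "j2 \<noteq> i2" "j1 \<noteq> i2" "j1 \<noteq> j2"
  using dist by auto

lemma not_P0 [simp]: "i1 \<notin> P0" "i2 \<notin> P0" "j2 \<notin> P0" "j1 \<notin> P0"
  by (auto simp: P0_def)

lemma P0_neq [simp]:
  assumes "k \<in> P0"
  shows "k \<noteq> i1" "k \<noteq> i2" "k \<noteq> j2" "k \<noteq> j1" "i1 \<noteq> k" "i2 \<noteq> k" "j2 \<noteq> k" "j1 \<noteq> k"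
  using assms by (auto simp: P0_def)

lemma index_cases [case_names i1 i2 j2 j1 P0]:
  obtains "k = i1" | "k = i2" | "k = j2" | "k = j1" | "k \<in> P0"
  unfolding P0_def by blast

lemma sw_simps [simp]:
  "sw i1 = j1" "sw j1 = i1" "sw i2 = j2" "sw j2 = i2" "k \<in> P0 \<Longrightarrow> sw k = k"
  by (auto simp: sw_def)

lemma sw_sw [simp]: "sw (sw k) = k"
  by (cases k rule: index_cases) auto

lemma sw_inj [simp]: "sw a = sw b \<longleftrightarrow> a = b"
  by (metis sw_sw)

lemma sw_eq: "sw a = b \<longleftrightarrow> a = sw b"
  by auto

lemma lv_simps [simp]:
  "lv i1 = 2" "lv i2 = 1" "lv j2 = - 1" "lv j1 = - 2" "k \<in> P0 \<Longrightarrow> lv k = 0"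
  by (auto simp: lv_def)

lemma lv_sw [simp]: "lv (sw k) = - lv k"
  by (cases k rule: index_cases) auto

lemma sum_split: "(\<Sum>k\<in>UNIV. h k) = h i1 + h i2 + h j2 + h j1 + (\<Sum>k\<in>P0. h k)" for h :: "'m \<Rightarrow> 'b::comm_monoid_add"
proof -
  have "UNIV = {i1, i2, j2, j1} \<union> P0" by (auto simp: P0_def)
  then have "(\<Sum>k\<in>UNIV. h k) = (\<Sum>k\<in>{i1, i2, j2, j1}. h k) + (\<Sum>k\<in>P0. h k)"
    by (metis sum.union_disjoint finite Compl_disjoint P0_def)
  then show ?thesis by (simp add: add_ac)
qed

lemma S_mult_nth [simp]: "(S ** g) $ i $ j = g $ sw i $ j"
proof -
  have "(S ** g) $ i $ j = (\<Sum>k\<in>UNIV. if k = sw i then g $ k $ j else 0)"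
    unfolding S_def matrix_matrix_mult_def by (simp add: if_distrib[of "\<lambda>a. a * _"] cong: if_cong)
  then show ?thesis by simp
qed

lemma mult_S_nth [simp]: "(g ** S) $ i $ j = g $ i $ sw j"
proof -
  have "(g ** S) $ i $ j = (\<Sum>k\<in>UNIV. if k = sw j then g $ i $ k else 0)"
    unfolding S_def matrix_matrix_mult_def vec_lambda_beta by (intro sum.cong) auto
  then show ?thesis by simp
qed

lemma S_nth: "S $ i $ j = (if j = sw i then 1 else 0)" by (simp add: S_def)

lemma S_S [simp]: "S ** S = mat 1"
  by (simp add: vec_eq_iff mat_def S_nth)

lemma S_S' [simp]: "S ** (S ** g) = g" "g ** S ** S = g"
  by (simp_all add: vec_eq_iff)

lemma ctranspose_S [simp]: "ctranspose S = S"
  by (auto simp: vec_eq_iff S_nth)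

lemma upper_0 [simp]: "upper 0" by (simp add: upper_def)

lemma upper_add: "upper X \<Longrightarrow> upper Y \<Longrightarrow> upper (X + Y)"
  unfolding upper_def by (metis add.right_neutral vector_add_component)

lemma upper_scaleR: "upper X \<Longrightarrow> upper (r *\<^sub>R X)"
  unfolding upper_def by auto

lemma mult_nz:
  assumes "((X :: complex^'m^'m) ** Y) $ i $ j \<noteq> 0"
  obtains k where "X $ i $ k \<noteq> 0" "Y $ k $ j \<noteq> 0"
proof -
  have "\<exists>k. X $ i $ k * Y $ k $ j \<noteq> 0"
    using assms unfolding matrix_matrix_mult_def by (metis (mono_tags, lifting) sum.neutral vec_lambda_beta)
  then show ?thesis using that by auto
qed

lemma upper_mult: "upper X \<Longrightarrow> upper Y \<Longrightarrow> upper (X ** Y)"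
  unfolding upper_def by (metis mult_nz less_trans)

lemma upper_pow:
  assumes "upper X" "(((**) X) ^^ k) (mat 1) $ i $ j \<noteq> 0"
  shows "lv j + int k \<le> lv i"
  using assms(2)
proof (induction k arbitrary: i)
  case 0
  then show ?case by (auto simp: mat_def split: if_splits)
next
  case (Suc k)
  then have "(X ** (((**) X) ^^ k) (mat 1)) $ i $ j \<noteq> 0" by simp
  then obtain l where l: "X $ i $ l \<noteq> 0" "(((**) X) ^^ k) (mat 1) $ l $ j \<noteq> 0" by (rule mult_nz)
  from Suc.IH[OF l(2)] assms(1) l(1) show ?case unfolding upper_def by force
qed

lemma lv_bounds: "- 2 \<le> lv i" "lv i \<le> 2"
  by (cases i rule: index_cases; simp)+

text \<open>Levels lie between - 2 and 2, so a chain of nonzero entries has at most four strict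
  steps.\<close>

lemma upper_nilpotent:
  assumes "upper X"
  shows "(((**) X) ^^ 5) (mat 1) = 0"
proof (rule ccontr)
  assume "(((**) X) ^^ 5) (mat 1) \<noteq> 0"
  then obtain i j where "(((**) X) ^^ 5) (mat 1) $ i $ j \<noteq> 0" by (auto simp: vec_eq_iff)
  from upper_pow[OF assms this] show False using lv_bounds[of i] lv_bounds[of j] by simp
qed

lemma unit_entry:
  assumes "upper (g - mat 1)" "lv i \<le> lv j"
  shows "g $ i $ j = (if i = j then 1 else 0)"
proof -
  have "(g - mat 1) $ i $ j = 0" using assms unfolding upper_def by (meson leD)
  then show ?thesis by (simp add: mat_def split: if_splits)
qed

lemma isometry_nth: "(ctranspose g ** S ** g) $ a $ b = (\<Sum>k\<in>UNIV. cnj (g $ k $ a) * g $ sw k $ b)"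
  unfolding matrix_mul_assoc[symmetric] by (simp add: matrix_matrix_mult_def[of "ctranspose g"])

lemma NS_unipotent: "g \<in> NS \<Longrightarrow> unipotent g"
  unfolding NS_def unipotent_def using upper_nilpotent by blast

lemma NS_det: "g \<in> NS \<Longrightarrow> det g = 1"
  using NS_unipotent unipotent_trace_det by blast

lemma isometry_inverse:
  assumes "ctranspose g ** S ** g = S"
  shows "(S ** ctranspose g ** S) ** g = mat 1" "g ** (S ** ctranspose g ** S) = mat 1"
proof -
  have "(S ** ctranspose g ** S) ** g = S ** (ctranspose g ** S ** g)" by (simp add: matrix_mul_assoc)
  then show 1: "(S ** ctranspose g ** S) ** g = mat 1" by (simp add: assms)
  show "g ** (S ** ctranspose g ** S) = mat 1" using 1 by (simp add: matrix_left_right_inverse)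
qed

lemma NS_inverse:
  assumes "g \<in> NS"
  shows "invertible g" "matrix_inv g = S ** ctranspose g ** S" "matrix_inv g \<in> NS"
proof -
  have iso: "ctranspose g ** S ** g = S" using assms by (simp add: NS_def)
  note inv = isometry_inverse[OF iso]
  show "invertible g" using inv invertible_def by blast
  show eq: "matrix_inv g = S ** ctranspose g ** S" by (rule matrix_inv_eqI(1)[OF inv(2)])
  have nth: "matrix_inv g $ i $ j = cnj (g $ sw j $ sw i)" for i j unfolding eq by simp
  have "upper (matrix_inv g - mat 1)"
    unfolding upper_def
  proof (intro allI impI)
    fix i j assume "(matrix_inv g - mat 1) $ i $ j \<noteq> 0"
    then have "(g - mat 1) $ sw j $ sw i \<noteq> 0"
      by (auto simp: nth mat_def sw_eq split: if_splits)
    then have "lv (sw i) < lv (sw j)" using assms unfolding NS_def upper_def by blast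
    then show "lv j < lv i" by simp
  qed
  moreover have "ctranspose (matrix_inv g) ** S ** matrix_inv g = S"
  proof -
    have "ctranspose (matrix_inv g) ** S ** matrix_inv g = S ** (g ** (S ** ctranspose g ** S))"
      by (simp add: eq ctranspose_mult matrix_mul_assoc)
    then show ?thesis by (simp add: inv)
  qed
  ultimately show "matrix_inv g \<in> NS" using assms by (simp add: NS_def nth)
qed

lemma NS_mult:
  assumes "g \<in> NS" "h \<in> NS"
  shows "g ** h \<in> NS"
proof -
  have eq: "g ** h - mat 1 = (g - mat 1) ** (h - mat 1) + (g - mat 1) + (h - mat 1)"
    by (simp add: matrix_diff_ldistrib matrix_diff_rdistrib)
  have "upper (g ** h - mat 1)" unfolding eq using assms by (intro upper_add upper_mult) (auto simp: NS_def)
  moreover have "ctranspose (g ** h) ** S ** (g ** h) = ctranspose h ** (ctranspose g ** S ** g) ** h"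
    by (simp add: ctranspose_mult matrix_mul_assoc)
  moreover have "(g ** h) $ i $ j \<in> F" for i j
    using assms by (intro matrix_mult_F) (auto simp: NS_def)
  ultimately show ?thesis using assms by (simp add: NS_def)
qed

lemma one_NS: "mat 1 \<in> NS"
proof -
  have "(mat 1 :: complex^'m^'m) $ i $ j \<in> F" for i j by (simp add: mat_def)
  then show ?thesis by (simp add: NS_def)
qed

lemma subgroup_NS: "subgroup NS GL"
  by (rule group.subgroupI[OF group_GL]) (use one_NS NS_inverse NS_mult in \<open>auto simp: inv_GL\<close>)

text \<open>A flag prescribes the columns \<open>i1\<close> and \<open>i2\<close> and, modulo the
  plane they span, those in \<open>P0\<close>. The isometry relation then forces rows
  \<open>j1\<close> and \<open>j2\<close>, which is enough for triangularity with respect to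
  \<open>lv\<close>.\<close>

lemma NS_from_columns:
  assumes F: "\<And>i j. g $ i $ j \<in> F" and iso: "ctranspose g ** S ** g = S"
    and c1: "\<And>k. g $ k $ i1 = (if k = i1 then 1 else 0)"
    and c2: "\<And>k. k \<noteq> i1 \<Longrightarrow> g $ k $ i2 = (if k = i2 then 1 else 0)"
    and cf: "\<And>f k. f \<in> P0 \<Longrightarrow> k \<noteq> i1 \<Longrightarrow> k \<noteq> i2 \<Longrightarrow> g $ k $ f = (if k = f then 1 else 0)"
  shows "g \<in> NS"
proof -
  have e: "(\<Sum>k\<in>UNIV. cnj (g $ k $ a) * g $ sw k $ b) = S $ a $ b" for a b
    using iso by (simp add: isometry_nth[symmetric])
  have r1: "g $ j1 $ b = (if b = j1 then 1 else 0)" for b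
    using e[of i1 b] by (simp add: sum_split c1 S_nth)
  have r2: "g $ j2 $ b = (if b = j2 then 1 else 0)" if "b \<noteq> j1" for b
    using e[of i2 b] that by (simp add: sum_split c2 r1 S_nth)
  have "(g - mat 1) $ a $ b = 0" if "\<not> lv b < lv a" for a b
    using that by (cases a rule: index_cases; cases b rule: index_cases) (auto simp: mat_def c1 c2 cf r1 r2)
  then show ?thesis using F iso unfolding NS_def upper_def by blast
qed

text \<open>The commutator subgroup \<open>D\<close> of \<open>NS\<close> is the image of \<open>dl\<close>, the exponential map in closed form. Only the
  coordinates in \<open>Ix\<close> matter: over the reals those of \<open>P0\<close> and \<open>i2\<close>; over the complex numbers \<open>i1\<close>, \<open>i2\<close>
  carry the real and imaginary parts of \<open>dtau\<close>, and \<open>j2\<close> carries \<open>dsig\<close>.\<close>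

definition dtau :: "real^'m \<Rightarrow> complex" where
  "dtau x = (if rl then of_real (x $ i2) else Complex (x $ i1) (x $ i2))"

definition dsig :: "real^'m \<Rightarrow> real" where
  "dsig x = (if rl then 0 else x $ j2)"

definition drad :: "real^'m \<Rightarrow> real" where
  "drad x = (\<Sum>f\<in>P0. (x $ f)\<^sup>2) / 2"

definition dl :: "real^'m \<Rightarrow> complex^'m^'m" where
  "dl x = (\<chi> i j.
     if i = j then 1
     else if i = i1 \<and> j \<in> P0 then of_real (x $ j)
     else if i \<in> P0 \<and> j = j1 then - of_real (x $ i)
     else if i = i1 \<and> j = j2 then dtau x
     else if i = i2 \<and> j = j1 then - cnj (dtau x)
     else if i = i1 \<and> j = j1 then Complex (- drad x) (dsig x)
     else 0)"

definition D :: "(complex^'m^'m) set" where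
  "D = {g\<in>NS. g $ i1 $ i2 = 0 \<and> g $ i2 $ j2 = 0 \<and> (\<forall>f\<in>P0. g $ i2 $ f = 0)}"

definition Ix :: "'m set" where
  "Ix = (if rl then insert i2 P0 else {i1, i2, j2})"

lemma dtau_add: "dtau (x + y) = dtau x + dtau y"
  by (simp add: dtau_def complex_eq_iff)

lemma dsig_add: "dsig (x + y) = dsig x + dsig y"
  by (simp add: dsig_def)

lemma drad_add: "drad (x + y) = drad x + drad y + (\<Sum>f\<in>P0. x $ f * y $ f)"
  by (simp add: drad_def power2_sum sum.distrib add_divide_distrib sum_divide_distrib)

text \<open>The cross term in \<open>drad_add\<close> is exactly what the entries in
  \<open>P0\<close> contribute to row \<open>i1\<close> times column \<open>j1\<close>; all other
  entries are additive.\<close>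

lemma dl_add: "dl x ** dl y = dl (x + y)"
proof -
  have "(\<Sum>k\<in>UNIV. dl x $ i $ k * dl y $ k $ j) = dl (x + y) $ i $ j" for i j
  proof (cases i rule: index_cases)
    case i1
    show ?thesis
      by (cases j rule: index_cases)
        (simp_all add: i1 sum_split dl_def dtau_add dsig_add drad_add complex_eq_iff sum_negf if_distrib[of "\<lambda>a. _ * a"] cong: if_cong)
  next
    case P0
    then show ?thesis
      by (cases j rule: index_cases)
        (simp_all add: sum_split dl_def dtau_add dsig_add drad_add complex_eq_iff if_distrib[of "\<lambda>a. a * _"] cong: if_cong)
  qed (cases j rule: index_cases; simp add: sum_split dl_def dtau_add dsig_add drad_add complex_eq_iff)+
  then show ?thesis by (simp add: vec_eq_iff matrix_matrix_mult_def)
qed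

lemma dl_0: "dl 0 = mat 1"
  by (auto simp: vec_eq_iff dl_def mat_def dtau_def dsig_def drad_def complex_eq_iff)

lemma dl_D: "dl x \<in> D"
proof -
  have up: "upper (dl x - mat 1)"
    unfolding upper_def
  proof (intro allI impI)
    fix i j assume "(dl x - mat 1) $ i $ j \<noteq> 0"
    then show "lv j < lv i"
      by (cases i rule: index_cases; cases j rule: index_cases) (auto simp: dl_def mat_def split: if_splits)
  qed
  have F: "dl x $ i $ j \<in> F" for i j
    by (auto simp: dl_def dtau_def dsig_def F_iff)
  have "(\<Sum>k\<in>UNIV. cnj (dl x $ k $ a) * dl x $ sw k $ b) = S $ a $ b" for a b
  proof (cases a rule: index_cases)
    case j1
    show ?thesis
      by (cases b rule: index_cases)
        (simp_all add: j1 sum_split dl_def S_nth drad_def complex_eq_iff sum_negf power2_eq_square if_distrib[of "\<lambda>a. _ * a"] cong: if_cong)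
  next
    case P0
    then show ?thesis
      by (cases b rule: index_cases)
        (auto simp add: sum_split dl_def S_nth complex_eq_iff if_distrib[of "\<lambda>a. a * _"] if_distrib[of "cnj"] cong: if_cong)
  qed (cases b rule: index_cases; simp add: sum_split dl_def S_nth complex_eq_iff)+
  then have "ctranspose (dl x) ** S ** dl x = S"
    unfolding vec_eq_iff isometry_nth by blast
  then have "dl x \<in> NS" using up F by (simp add: NS_def)
  then show ?thesis by (simp add: D_def dl_def)
qed

text \<open>Once the defining entries vanish, the isometry relations express all other rows through
  row \<open>i1\<close>, and the real part of its corner entry through its entries in
  \<open>P0\<close>. Coordinates outside \<open>Ix\<close> do not enter \<open>dl\<close>, so they
  may be set to 0.\<close>

lemma D_range:
  assumes g: "g \<in> D"
  obtains x where "g = dl x" "\<And>k. k \<notin> Ix \<Longrightarrow> x $ k = 0"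
proof -
  have up: "upper (g - mat 1)" and F: "\<And>i j. g $ i $ j \<in> F"
    and iso: "\<And>a b. (\<Sum>k\<in>UNIV. cnj (g $ k $ a) * g $ sw k $ b) = S $ a $ b"
    and z: "g $ i1 $ i2 = 0" "g $ i2 $ j2 = 0" "\<And>f. f \<in> P0 \<Longrightarrow> g $ i2 $ f = 0"
    using g unfolding D_def NS_def isometry_nth[symmetric] by auto
  note u = unit_entry[OF up]
  have rj2: "g $ j2 $ b = (if b = j2 then 1 else 0)" for b
    using iso[of i2 b] by (simp add: sum_split u z S_nth)
  have rf: "g $ f $ b = (if f = b then 1 else 0) - cnj (g $ i1 $ f) * g $ j1 $ b" if "f \<in> P0" for f b
  proof -
    have "(\<Sum>k\<in>P0. cnj (g $ k $ f) * g $ sw k $ b) = (\<Sum>k\<in>P0. if k = f then g $ f $ b else 0)"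
      by (rule sum.cong) (use that in \<open>auto simp: u\<close>)
    then show ?thesis using iso[of f b] that by (auto simp add: sum_split u z S_nth algebra_simps)
  qed
  have j1: "g $ j1 $ b = (if b = j1 then 1 else 0)" for b
    by (cases b rule: index_cases) (simp_all add: u)
  have ri2: "g $ i2 $ b = (if b = i2 then 1 else 0) - cnj (g $ i1 $ j2) * g $ j1 $ b" for b
  proof -
    have "(\<Sum>k\<in>P0. cnj (g $ k $ j2) * g $ sw k $ b) = 0"
      by (rule sum.neutral) (auto simp: rf j1)
    then show ?thesis using iso[of j2 b] by (auto simp add: sum_split u z S_nth algebra_simps)
  qed
  have c: "2 * Re (g $ i1 $ j1) = - (\<Sum>f\<in>P0. (cmod (g $ i1 $ f))\<^sup>2)"
  proof -
    have "(\<Sum>k\<in>P0. cnj (g $ k $ j1) * g $ sw k $ j1) = of_real (\<Sum>f\<in>P0. (cmod (g $ i1 $ f))\<^sup>2)"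
      unfolding of_real_sum by (rule sum.cong) (auto simp: rf j1 complex_norm_square[symmetric] mult.commute simp flip: of_real_power)
    moreover have "(\<Sum>k\<in>UNIV. cnj (g $ k $ j1) * g $ sw k $ j1) = 0" using iso[of j1 j1] by (simp add: S_nth)
    ultimately have "cnj (g $ i1 $ j1) + g $ i1 $ j1 + of_real (\<Sum>f\<in>P0. (cmod (g $ i1 $ f))\<^sup>2) = 0"
      by (simp add: sum_split u z j1 rj2 algebra_simps)
    then have "Re (cnj (g $ i1 $ j1) + g $ i1 $ j1 + of_real (\<Sum>f\<in>P0. (cmod (g $ i1 $ f))\<^sup>2)) = 0" by simp
    then show ?thesis by simp
  qed
  define x :: "real^'m" where "x = (\<chi> k. if k \<in> P0 then Re (g $ i1 $ k)
     else if rl then (if k = i2 then Re (g $ i1 $ j2) else 0)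
     else if k = i1 then Re (g $ i1 $ j2) else if k = i2 then Im (g $ i1 $ j2)
     else if k = j2 then Im (g $ i1 $ j1) else 0)"
  have xf: "g $ i1 $ f = of_real (x $ f)" if "f \<in> P0" for f
    using that F[of i1 f] rl_iff by (auto simp: x_def complex_eq_iff F_iff)
  have tau: "dtau x = g $ i1 $ j2"
    using F[of i1 j2] rl_iff by (auto simp: dtau_def x_def complex_eq_iff F_iff)
  have sig: "dsig x = Im (g $ i1 $ j1)"
    using F[of i1 j1] rl_iff by (auto simp: dsig_def x_def F_iff)
  have rad: "- drad x = Re (g $ i1 $ j1)"
    using c by (simp add: drad_def xf)
  have i11: "g $ i1 $ j1 = Complex (- drad x) (dsig x)"
    by (simp add: complex_eq_iff sig rad)
  have "g $ i $ j = dl x $ i $ j" for i j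
    by (cases i rule: index_cases; cases j rule: index_cases)
      (auto simp: dl_def u z rj2 ri2 j1 rf xf tau i11)
  then have "g = dl x" by (simp add: vec_eq_iff)
  moreover have "x $ k = 0" if "k \<notin> Ix" for k
    using that rl_iff by (auto simp: x_def Ix_def split: if_splits)
  ultimately show ?thesis using that by blast
qed

end

section \<open>The Lie algebra of the unipotent group\<close>

lemma matrix_add_rdistrib:
  fixes A :: "'a::ring_1^'m^'n"
  shows "(A + B) ** C = A ** C + B ** C"
  by (simp add: vec_eq_iff matrix_matrix_mult_def distrib_right sum.distrib)

lemma linear_conj:
  fixes b c :: "complex^'m^'m"
  shows "linear (\<lambda>X. b ** X ** c)"
  using linear_compose[OF linear_matrix_mul_right[of b] linear_matrix_mul_left[of c]] by (simp add: o_def)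

lemma scaleR_matrix_mult:
  fixes X Y :: "complex^'m^'m"
  shows "(r *\<^sub>R X) ** Y = r *\<^sub>R (X ** Y)" "X ** (r *\<^sub>R Y) = r *\<^sub>R (X ** Y)"
  using linear_cmul[OF linear_matrix_mul_left[of Y]] linear_cmul[OF linear_matrix_mul_right[of X]] by auto

lemma ctranspose_add: "ctranspose (X + Y) = ctranspose X + ctranspose Y"
  by (simp add: vec_eq_iff)

lemma ctranspose_diff: "ctranspose (X - Y) = ctranspose X - ctranspose Y"
  by (simp add: vec_eq_iff)

lemma lie_algebra_conj:
  assumes b: "invertible (b :: complex^'m^'m)"
  shows "lie_algebra ((\<lambda>g. b ** g ** matrix_inv b) ` H) = (\<lambda>g. b ** g ** matrix_inv b) ` lie_algebra H"
proof -
  have sub: "(\<lambda>g. c ** g ** matrix_inv c) ` lie_algebra H \<subseteq> lie_algebra ((\<lambda>g. c ** g ** matrix_inv c) ` H)"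
    if c: "invertible c" for c :: "complex^'m^'m" and H
  proof
    fix Y assume "Y \<in> (\<lambda>g. c ** g ** matrix_inv c) ` lie_algebra H"
    then obtain X \<gamma> where X: "Y = c ** X ** matrix_inv c" and \<gamma>: "\<gamma> 0 = mat 1" "range \<gamma> \<subseteq> H"
      "(\<gamma> has_vector_derivative X) (at (0::real))" unfolding lie_algebra_def by auto
    have "((\<lambda>t. c ** \<gamma> t ** matrix_inv c) has_vector_derivative Y) (at 0)"
      unfolding X by (rule bounded_linear.has_vector_derivative[OF linear_conv_bounded_linear[THEN iffD1, OF linear_conj] \<gamma>(3)])
    moreover have "c ** \<gamma> 0 ** matrix_inv c = mat 1" using c by (simp add: \<gamma> matrix_inv_mult)
    ultimately show "Y \<in> lie_algebra ((\<lambda>g. c ** g ** matrix_inv c) ` H)"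
      unfolding lie_algebra_def using \<gamma>(2) by (auto intro!: exI[of _ "\<lambda>t. c ** \<gamma> t ** matrix_inv c"])
  qed
  let ?c = "matrix_inv b"
  have c: "invertible ?c" using b by (rule invertible_imp_matrix_inv)
  have ic: "matrix_inv ?c = b" using matrix_inv_eqI(2)[OF matrix_inv_mult(1)[OF b]] .
  have cancel: "?c ** (b ** g ** ?c) ** b = g" "b ** (?c ** g ** b) ** ?c = g" for g
    using matrix_inv_mult[OF b] by (metis matrix_mul_assoc matrix_mul_lid matrix_mul_rid)+
  have "lie_algebra ((\<lambda>g. b ** g ** ?c) ` H) \<subseteq> (\<lambda>g. b ** g ** ?c) ` lie_algebra H"
  proof
    fix Y assume "Y \<in> lie_algebra ((\<lambda>g. b ** g ** ?c) ` H)"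
    then have "?c ** Y ** b \<in> lie_algebra ((\<lambda>g. ?c ** g ** b) ` (\<lambda>g. b ** g ** ?c) ` H)"
      using sub[OF c, of "(\<lambda>g. b ** g ** ?c) ` H"] unfolding ic by blast
    also have "(\<lambda>g. ?c ** g ** b) ` (\<lambda>g. b ** g ** ?c) ` H = H"
      unfolding image_image cancel by simp
    finally show "Y \<in> (\<lambda>g. b ** g ** ?c) ` lie_algebra H" using cancel(2) by (metis image_eqI)
  qed
  then show ?thesis using sub[OF b] by blast
qed

lemma dual_family_basis:
  fixes d :: "'i \<Rightarrow> 'a::euclidean_space"
  assumes D: "finite D" and lin: "\<And>k. k \<in> D \<Longrightarrow> linear (\<phi> k)"
    and dual: "\<And>k l. k \<in> D \<Longrightarrow> l \<in> D \<Longrightarrow> \<phi> k (d l) = (if k = l then 1 else (0::real))"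
    and dV: "d ` D \<subseteq> V" and V: "subspace V" and span: "\<And>x. x \<in> V \<Longrightarrow> x = (\<Sum>k\<in>D. \<phi> k x *\<^sub>R d k)"
  shows "inj_on d D" "independent (d ` D)" "span (d ` D) = V"
proof -
  show inj: "inj_on d D" by (rule inj_onI) (metis dual zero_neq_one)
  show "independent (d ` D)"
  proof
    assume "dependent (d ` D)"
    then obtain u where u: "(\<Sum>v\<in>d ` D. u v *\<^sub>R v) = 0" "\<exists>v\<in>d ` D. u v \<noteq> 0"
      using dependent_finite[of "d ` D"] D by auto
    then obtain k where k: "k \<in> D" "u (d k) \<noteq> 0" by auto
    have "0 = \<phi> k (\<Sum>l\<in>D. u (d l) *\<^sub>R d l)"
      using u(1) linear_0[OF lin[OF k(1)]] by (simp add: sum.reindex[OF inj])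
    also have "\<dots> = (\<Sum>l\<in>D. u (d l) * \<phi> k (d l))"
      by (simp add: linear_sum[OF lin[OF k(1)]] linear_cmul[OF lin[OF k(1)]])
    also have "\<dots> = (\<Sum>l\<in>D. if l = k then u (d k) else 0)"
      by (rule sum.cong) (auto simp: dual k)
    also have "\<dots> = u (d k)" using D k by simp
    finally show False using k by simp
  qed
  show "span (d ` D) = V"
  proof
    show "span (d ` D) \<subseteq> V" by (rule span_minimal[OF dV V])
    show "V \<subseteq> span (d ` D)"
    proof
      fix x assume "x \<in> V"
      from span[OF this] show "x \<in> span (d ` D)"
        by (metis (mono_tags, lifting) span_sum span_scale span_base imageI)
    qed
  qed
qed

lemma constant_has_vector_derivative_zero:
  assumes "(f has_vector_derivative d) (at (x::real))" "\<And>t. f t = c"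
  shows "d = 0"
proof -
  have "f = (\<lambda>_. c)" using assms(2) by blast
  then have "(f has_vector_derivative 0) (at x)" by simp
  with assms(1) show ?thesis by (rule vector_derivative_unique_at)
qed

context split_frame
begin

definition skew :: "complex^'m^'m \<Rightarrow> bool" where
  "skew X \<longleftrightarrow> (\<forall>i j. X $ i $ j = - cnj (X $ sw j $ sw i))"

definition nS :: "(complex^'m^'m) set" where
  "nS = {X. (\<forall>i j. X $ i $ j \<in> F) \<and> upper X \<and> skew X}"

lemma nS_skew_nth: "X \<in> nS \<Longrightarrow> X $ i $ j = - cnj (X $ sw j $ sw i)"
  unfolding nS_def skew_def by blast

lemma nS_skew: "X \<in> nS \<Longrightarrow> ctranspose X ** S = - (S ** X)"
proof -
  assume "X \<in> nS"
  note X = nS_skew_nth[OF this]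
  have "cnj (X $ sw j $ i) = - (X $ sw i $ j)" for i j using X[of "sw i" j] by simp
  then show ?thesis by (simp add: vec_eq_iff)
qed

lemma subspace_nS: "subspace nS"
proof (rule subspaceI)
  show "0 \<in> nS" by (simp add: nS_def skew_def)
next
  fix X Y assume X: "X \<in> nS" and Y: "Y \<in> nS"
  have "(X + Y) $ i $ j = - cnj ((X + Y) $ sw j $ sw i)" for i j
    using nS_skew_nth[OF X, of i j] nS_skew_nth[OF Y, of i j] by simp
  then have "skew (X + Y)" unfolding skew_def by blast
  then show "X + Y \<in> nS" using X Y by (simp add: nS_def upper_add)
next
  fix r :: real and X assume X: "X \<in> nS"
  have "(r *\<^sub>R X) $ i $ j = - cnj ((r *\<^sub>R X) $ sw j $ sw i)" for i j
    using nS_skew_nth[OF X, of i j] by (simp add: scaleR_minus_right)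
  then have "skew (r *\<^sub>R X)" unfolding skew_def by blast
  then show "r *\<^sub>R X \<in> nS" using X
    by (simp add: nS_def upper_scaleR scaleR_complex)
qed

lemma upper_pow5:
  assumes "upper X"
  shows "X ** (X ** (X ** (X ** X))) = 0"
  using upper_nilpotent[OF assms] by (simp add: eval_nat_numeral)

text \<open>The truncated series is the Cayley transform of \<open>X / 2\<close>, since \<open>X\<close> is nilpotent of order five.\<close>

lemma cayley:
  assumes X: "X \<in> nS"
  shows "mat 1 + X + (1/2) *\<^sub>R (X ** X) + (1/4) *\<^sub>R (X ** X ** X) + (1/8) *\<^sub>R (X ** X ** X ** X) \<in> NS" (is "?g \<in> NS")
proof -
  have up: "upper X" and XF: "\<And>i j. X $ i $ j \<in> F" using X by (auto simp: nS_def)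
  define Y where "Y = (1/2) *\<^sub>R X"
  have YnS: "Y \<in> nS" unfolding Y_def using subspace_nS X by (rule subspace_scale)
  have upY: "upper Y" using YnS by (simp add: nS_def)
  \<comment> \<open>The terminating geometric series for (1 - Y)^-1. Thus \<open>?g\<close> is (1 +
    Y) (1 - Y)^-1, and it is an isometry because the adjoint with respect to \<open>S\<close> swaps
    1 + Y and 1 - Y.\<close>
  define Z where "Z = mat 1 + Y + Y ** Y + Y ** (Y ** Y) + Y ** (Y ** (Y ** Y))"
  note Y5 = upper_pow5[OF upY]
  have Z1: "(mat 1 - Y) ** Z = mat 1"
    by (simp add: Z_def matrix_diff_rdistrib matrix_add_ldistrib Y5)
  then have Z2: "Z ** (mat 1 - Y) = mat 1" by (simp add: matrix_left_right_inverse)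
  have g1: "?g = (mat 1 + Y) ** Z"
    by (simp add: Z_def Y_def matrix_add_ldistrib matrix_add_rdistrib scaleR_matrix_mult matrix_mul_assoc[symmetric] upper_pow5[OF up])
       (simp add: vec_eq_iff scaleR_complex field_simps)
  have g2: "(mat 1 + Y) ** Z = Z ** (mat 1 + Y)"
  proof -
    have c: "(mat 1 + Y) ** (mat 1 - Y) = (mat 1 - Y) ** (mat 1 + Y)"
      by (simp add: matrix_add_ldistrib matrix_add_rdistrib matrix_diff_ldistrib matrix_diff_rdistrib)
    have "(mat 1 + Y) ** Z = Z ** ((mat 1 - Y) ** (mat 1 + Y)) ** Z" by (simp add: matrix_mul_assoc Z2)
    also have "\<dots> = Z ** (mat 1 + Y) ** ((mat 1 - Y) ** Z)" by (simp only: c[symmetric] matrix_mul_assoc)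
    finally show ?thesis by (simp add: Z1)
  qed
  have sk: "ctranspose Y ** S = - (S ** Y)" by (rule nS_skew[OF YnS])
  have a1: "ctranspose (mat 1 + Y) ** S = S ** (mat 1 - Y)"
    by (simp add: ctranspose_add matrix_add_rdistrib matrix_diff_ldistrib sk)
  have a2: "ctranspose (mat 1 - Y) ** S = S ** (mat 1 + Y)"
    by (simp add: ctranspose_diff matrix_diff_rdistrib matrix_add_ldistrib sk)
  have zz: "ctranspose Z ** ctranspose (mat 1 - Y) = mat 1"
    by (simp add: ctranspose_mult[symmetric] Z1)
  have "ctranspose ?g ** S ** ?g = ctranspose Z ** (ctranspose (mat 1 + Y) ** S) ** (Z ** (mat 1 + Y))"
    unfolding g1 by (simp only: ctranspose_mult g2[symmetric] matrix_mul_assoc)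
  also have "\<dots> = ctranspose Z ** S ** ((mat 1 - Y) ** Z) ** (mat 1 + Y)"
    by (simp only: a1 matrix_mul_assoc)
  also have "\<dots> = ctranspose Z ** (S ** (mat 1 + Y))" by (simp add: Z1 matrix_mul_assoc)
  also have "\<dots> = S" by (simp only: a2[symmetric] matrix_mul_assoc zz matrix_mul_lid)
  finally have iso: "ctranspose ?g ** S ** ?g = S" .
  have "?g - mat 1 = X + (1/2) *\<^sub>R (X ** X) + (1/4) *\<^sub>R (X ** X ** X) + (1/8) *\<^sub>R (X ** X ** X ** X)" by simp
  then have upg: "upper (?g - mat 1)" using up by (simp only:) (intro upper_add upper_scaleR upper_mult)
  have sF: "r *\<^sub>R a \<in> F" if "a \<in> F" for r a using that by (simp add: scaleR_complex)
  have oneF: "(mat 1 :: complex^'m^'m) $ i $ j \<in> F" for i j by (simp add: mat_def)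
  have gF: "?g $ i $ j \<in> F" for i j
    unfolding vector_add_component vector_scaleR_component by (intro F_closed(3) sF matrix_mult_F XF oneF)
  show ?thesis using upg iso gF unfolding NS_def by blast
qed

lemma cayley_sq0:
  assumes "X \<in> nS" "X ** X = 0"
  shows "mat 1 + X \<in> NS"
  using cayley[OF assms(1)] assms(2) by simp

text \<open>The matrix with the single entry \<open>c\<close> at (i, j), minus its adjoint with
  respect to \<open>S\<close>. At j = sw i the two positions coincide and the entry is c - cnj
  c.\<close>

definition Er :: "'m \<Rightarrow> 'm \<Rightarrow> complex \<Rightarrow> complex^'m^'m" where
  "Er i j c = (\<chi> a b. (if a = i \<and> b = j then c else 0) - (if a = sw j \<and> b = sw i then cnj c else 0))"

lemma Er_nS: "lv j < lv i \<Longrightarrow> c \<in> F \<Longrightarrow> Er i j c \<in> nS"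
proof -
  assume lv: "lv j < lv i" and c: "c \<in> F"
  have sw: "(sw b = i \<and> sw a = j) \<longleftrightarrow> (a = sw j \<and> b = sw i)"
    "(sw b = sw j \<and> sw a = sw i) \<longleftrightarrow> (a = i \<and> b = j)" for a b by (metis sw_sw)+
  have gen: "(if P then c else 0) - (if Q then cnj c else 0) = - cnj ((if Q then c else 0) - (if P then cnj c else 0))" for P Q
    by simp
  have "Er i j c $ a $ b = - cnj (Er i j c $ sw b $ sw a)" for a b
    unfolding Er_def vec_lambda_beta sw by (rule gen)
  then have "skew (Er i j c)" unfolding skew_def by blast
  moreover have "upper (Er i j c)" using lv unfolding upper_def by (auto simp: Er_def split: if_splits)
  moreover have "Er i j c $ a $ b \<in> F" for a b using c by (simp add: Er_def)
  ultimately show "Er i j c \<in> nS" by (simp add: nS_def)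
qed

text \<open>Differentiating the equations of \<open>NS\<close> along a curve gives one inclusion.
  For the other, the truncated Cayley series of t X is a curve in \<open>NS\<close> with velocity
  \<open>X\<close> at 0.\<close>

lemma lie_algebra_NS: "lie_algebra NS = nS"
proof
  show "lie_algebra NS \<subseteq> nS"
  proof
    fix X assume "X \<in> lie_algebra NS"
    then obtain \<gamma> where \<gamma>: "\<gamma> 0 = mat 1" "\<And>t. \<gamma> t \<in> NS" "(\<gamma> has_vector_derivative X) (at (0::real))"
      unfolding lie_algebra_def by auto
    have d: "((\<lambda>t. \<gamma> t $ i $ j) has_vector_derivative X $ i $ j) (at 0)" for i j
      by (intro bounded_linear.has_vector_derivative[OF bounded_linear_vec_nth] \<gamma>(3))
    have up: "X $ i $ j = 0" if "\<not> lv j < lv i" for i j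
    proof -
      have "\<gamma> t $ i $ j = (if i = j then 1 else 0)" for t
        using unit_entry[of "\<gamma> t" i j] \<gamma>(2)[of t] that by (simp add: NS_def not_less)
      then show ?thesis by (rule constant_has_vector_derivative_zero[OF d])
    qed
    have F: "X $ i $ j \<in> F" for i j
    proof (cases rl)
      case True
      have "Im (\<gamma> t $ i $ j) = 0" for t using \<gamma>(2)[of t] True by (simp add: NS_def F_iff)
      then have "Im (X $ i $ j) = 0"
        by (rule constant_has_vector_derivative_zero[OF bounded_linear.has_vector_derivative[OF bounded_linear_Im d]])
      then show ?thesis by (simp add: F_iff)
    qed (simp add: F_iff)
    have iso: "ctranspose (\<gamma> t) ** S ** \<gamma> t = S" for t using \<gamma>(2)[of t] by (simp add: NS_def)
    have sk: "X $ i $ j = - cnj (X $ sw j $ sw i)" for i j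
    proof -
      let ?a = "sw i"
      have d2: "((\<lambda>t. \<Sum>k\<in>UNIV. cnj (\<gamma> t $ k $ ?a) * \<gamma> t $ sw k $ j) has_vector_derivative
         (\<Sum>k\<in>UNIV. cnj (\<gamma> 0 $ k $ ?a) * X $ sw k $ j + cnj (X $ k $ ?a) * \<gamma> 0 $ sw k $ j)) (at 0)"
        by (intro has_vector_derivative_sum has_vector_derivative_mult d
            bounded_linear.has_vector_derivative[OF bounded_linear_cnj])
      have "(\<Sum>k\<in>UNIV. cnj (\<gamma> t $ k $ ?a) * \<gamma> t $ sw k $ j) = S $ ?a $ j" for t
        unfolding isometry_nth[symmetric] iso ..
      then have "(\<Sum>k\<in>UNIV. cnj (\<gamma> 0 $ k $ ?a) * X $ sw k $ j + cnj (X $ k $ ?a) * \<gamma> 0 $ sw k $ j) = 0"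
        by (rule constant_has_vector_derivative_zero[OF d2])
      moreover have "(\<Sum>k\<in>UNIV. cnj (\<gamma> 0 $ k $ ?a) * X $ sw k $ j) = X $ i $ j"
      proof -
        have "(\<Sum>k\<in>UNIV. cnj (\<gamma> 0 $ k $ ?a) * X $ sw k $ j) = (\<Sum>k\<in>UNIV. if k = ?a then X $ i $ j else 0)"
          by (rule sum.cong) (auto simp: \<gamma>(1) mat_def)
        then show ?thesis by simp
      qed
      moreover have "(\<Sum>k\<in>UNIV. cnj (X $ k $ ?a) * \<gamma> 0 $ sw k $ j) = cnj (X $ sw j $ ?a)"
      proof -
        have "(\<Sum>k\<in>UNIV. cnj (X $ k $ ?a) * \<gamma> 0 $ sw k $ j) = (\<Sum>k\<in>UNIV. if k = sw j then cnj (X $ sw j $ ?a) else 0)"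
          by (rule sum.cong) (auto simp: \<gamma>(1) mat_def sw_eq)
        then show ?thesis by simp
      qed
      ultimately show ?thesis by (simp add: sum.distrib eq_neg_iff_add_eq_0)
    qed
    show "X \<in> nS" unfolding nS_def upper_def skew_def using up F sk by blast
  qed
  show "nS \<subseteq> lie_algebra NS"
  proof
    fix X assume X: "X \<in> nS"
    define \<gamma> where "\<gamma> t = mat 1 + t *\<^sub>R X + (1/2) *\<^sub>R ((t *\<^sub>R X) ** (t *\<^sub>R X)) + (1/4) *\<^sub>R ((t *\<^sub>R X) ** (t *\<^sub>R X) ** (t *\<^sub>R X))
        + (1/8) *\<^sub>R ((t *\<^sub>R X) ** (t *\<^sub>R X) ** (t *\<^sub>R X) ** (t *\<^sub>R X))" for t :: real
    have "\<gamma> t \<in> NS" for t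
      unfolding \<gamma>_def by (rule cayley) (simp add: subspace_scale[OF subspace_nS X])
    moreover have "\<gamma> 0 = mat 1" by (simp add: \<gamma>_def)
    moreover have "(\<gamma> has_vector_derivative X) (at 0)"
    proof -
      have eq: "\<gamma> = (\<lambda>t. mat 1 + t *\<^sub>R X + (t^2/2) *\<^sub>R (X ** X) + (t^3/4) *\<^sub>R (X ** X ** X) + (t^4/8) *\<^sub>R (X ** X ** X ** X))"
        by (simp add: fun_eq_iff \<gamma>_def scaleR_matrix_mult power_numeral_reduce)
      show ?thesis unfolding eq
        by (auto intro!: derivative_eq_intros simp: has_vector_derivative_def)
    qed
    ultimately show "X \<in> lie_algebra NS" unfolding lie_algebra_def by blast
  qed
qed

section \<open>The split torus and its weights on the Lie algebra\<close>

definition wt :: "real \<Rightarrow> real \<Rightarrow> 'm \<Rightarrow> real" where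
  "wt p q k = (if k = i1 then p else if k = i2 then q else if k = j2 then 1 / q else if k = j1 then 1 / p else 1)"

definition dg :: "real \<Rightarrow> real \<Rightarrow> complex^'m^'m" where
  "dg p q = diagm (\<lambda>i. of_real (wt p q i))"

lemma wt_simps [simp]:
  "wt p q i1 = p" "wt p q i2 = q" "wt p q j2 = 1 / q" "wt p q j1 = 1 / p" "k \<in> P0 \<Longrightarrow> wt p q k = 1"
  by (auto simp: wt_def)

lemma wt_sw: "wt p q (sw k) = 1 / wt p q k"
  by (cases k rule: index_cases) simp_all

lemma dg_mult_nth: "(dg p q ** X) $ i $ j = of_real (wt p q i) * X $ i $ j"
  by (simp add: dg_def diagm_mult_nth)

lemma mult_dg_nth: "(X ** dg p q) $ i $ j = of_real (wt p q j) * X $ i $ j"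
  by (simp add: dg_def mult_diagm_nth)

lemma dg_inverse:
  assumes "p > 0" "q > 0"
  shows "dg p q ** dg (1/p) (1/q) = mat 1" "invertible (dg p q)" "matrix_inv (dg p q) = dg (1/p) (1/q)"
proof -
  show 1: "dg p q ** dg (1/p) (1/q) = mat 1"
  proof -
    have "wt p q i * wt (1/p) (1/q) i = 1" for i
      using assms by (cases i rule: index_cases) simp_all
    then show ?thesis by (auto simp: vec_eq_iff dg_mult_nth mat_def) (auto simp: dg_def diagm_def simp flip: of_real_mult)
  qed
  then show "invertible (dg p q)" "matrix_inv (dg p q) = dg (1/p) (1/q)" by (auto intro: invertibleI matrix_inv_eqI)
qed

lemma wt_inverse: "wt (1/p) (1/q) k = 1 / wt p q k"
  by (cases k rule: index_cases) simp_all

lemma Ad_dg_Er: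
  assumes "p > 0" "q > 0"
  shows "dg p q ** Er i j c ** matrix_inv (dg p q) = (wt p q i / wt p q j) *\<^sub>R Er i j c"
  by (auto simp: vec_eq_iff dg_inverse[OF assms] dg_mult_nth mult_dg_nth wt_inverse Er_def wt_sw scaleR_complex)

text \<open>The real root vectors \<open>Er i j c\<close>, \<open>(i, j, c) \<in> DI\<close>, form a basis of the Lie algebra \<open>nS\<close>.\<close>

definition DI :: "('m \<times> 'm \<times> complex) set" where
  "DI = (if rl then {(i1, i2, 1), (i1, j2, 1)} \<union> (\<lambda>f. (i1, f, 1)) ` P0 \<union> (\<lambda>f. (i2, f, 1)) ` P0
    else {(i1, i2, 1), (i1, j2, 1), (i1, i2, \<i>), (i1, j2, \<i>), (i1, j1, \<i>), (i2, j2, \<i>)})"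

definition dEr :: "'m \<times> 'm \<times> complex \<Rightarrow> complex^'m^'m" where
  "dEr = (\<lambda>(i, j, c). Er i j c)"

text \<open>The coordinate functionals of the basis \<open>dEr\<close>; the divisor 2 compensates c
  - cnj c = 2 c for imaginary \<open>c\<close> at the positions (i, sw i).\<close>

definition phi :: "'m \<times> 'm \<times> complex \<Rightarrow> complex^'m^'m \<Rightarrow> real" where
  "phi = (\<lambda>(i, j, c) X. Re (cnj c * X $ i $ j) / (if j = sw i then 2 else 1))"

lemma finite_DI: "finite DI" by (simp add: DI_def)

lemma sum_DI:
  fixes h :: "'m \<times> 'm \<times> complex \<Rightarrow> 'b::comm_monoid_add"
  shows "rl \<Longrightarrow> sum h DI = h (i1, i2, 1) + h (i1, j2, 1) + (\<Sum>f\<in>P0. h (i1, f, 1)) + (\<Sum>f\<in>P0. h (i2, f, 1))"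
    "\<not> rl \<Longrightarrow> sum h DI = h (i1, i2, 1) + h (i1, j2, 1) + h (i1, i2, \<i>) + h (i1, j2, \<i>) + h (i1, j1, \<i>) + h (i2, j2, \<i>)"
proof -
  assume rl
  then have "sum h DI = sum h {(i1, i2, 1), (i1, j2, 1)} + sum h ((\<lambda>f. (i1, f, 1)) ` P0) + sum h ((\<lambda>f. (i2, f, 1)) ` P0)"
    unfolding DI_def if_P[OF \<open>rl\<close>] by (subst sum.union_disjoint, simp, simp, force)+ simp
  then show "sum h DI = h (i1, i2, 1) + h (i1, j2, 1) + (\<Sum>f\<in>P0. h (i1, f, 1)) + (\<Sum>f\<in>P0. h (i2, f, 1))"
    by (simp add: sum.reindex inj_on_def)
next
  have "\<i> \<noteq> 1" "1 \<noteq> \<i>" by (auto simp: complex_eq_iff)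
  moreover assume "\<not> rl"
  ultimately show "sum h DI = h (i1, i2, 1) + h (i1, j2, 1) + h (i1, i2, \<i>) + h (i1, j2, \<i>) + h (i1, j1, \<i>) + h (i2, j2, \<i>)"
    by (simp add: DI_def add_ac)
qed

lemma DI_cases:
  assumes "k \<in> DI"
  obtains "rl" "k = (i1, i2, 1)" | "rl" "k = (i1, j2, 1)" | f where "rl" "f \<in> P0" "k = (i1, f, 1)" | f where "rl" "f \<in> P0" "k = (i2, f, 1)"
   | "\<not> rl" "k = (i1, i2, 1)" | "\<not> rl" "k = (i1, j2, 1)" | "\<not> rl" "k = (i1, i2, \<i>)" | "\<not> rl" "k = (i1, j2, \<i>)" | "\<not> rl" "k = (i1, j1, \<i>)" | "\<not> rl" "k = (i2, j2, \<i>)"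
  using assms unfolding DI_def by (cases rl) auto

lemma phi_dual:
  assumes "k \<in> DI" "l \<in> DI"
  shows "phi k (dEr l) = (if k = l then 1 else 0)"
  using assms(1)
  by (cases rule: DI_cases; use assms(2) in \<open>cases rule: DI_cases\<close>)
    (auto simp: phi_def dEr_def Er_def complex_eq_iff)

lemma DI_nS: "dEr ` DI \<subseteq> nS"
proof
  fix X assume "X \<in> dEr ` DI"
  then obtain k where k: "k \<in> DI" "X = dEr k" by auto
  from k(1) show "X \<in> nS"
    by (cases rule: DI_cases) (auto simp: k(2) dEr_def F_iff intro!: Er_nS)
qed

lemma linear_phi: "linear (phi k)"
  by (cases k, rule linearI) (auto simp: phi_def algebra_simps add_divide_distrib)

text \<open>Skewness pairs the position (i, j) with (sw j, sw i), so one position of each pair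
  suffices. At (i, sw i) the entry is purely imaginary, which leaves nothing over the reals.\<close>

lemma nS_expand:
  assumes X: "X \<in> nS"
  shows "X = (\<Sum>k\<in>DI. phi k X *\<^sub>R dEr k)"
proof -
  have up: "X $ i $ j = 0" if "lv i \<le> lv j" for i j using X that by (force simp: nS_def upper_def)
  note sk = nS_skew_nth[OF X]
  have F: "X $ i $ j \<in> F" for i j using X by (simp add: nS_def)
  have fix0: "Re (X $ i $ sw i) = 0" for i using sk[of i "sw i"] by (simp add: complex_eq_iff)
  have "X $ i $ j = (\<Sum>k\<in>DI. phi k X *\<^sub>R dEr k $ i $ j)" for i j
  proof (cases rl)
    case True
    have Im0: "Im (X $ i $ j) = 0" for i j using F[of i j] True by (simp add: F_iff)
    have fix1: "X $ i1 $ j1 = 0" "X $ i2 $ j2 = 0" using fix0[of i1] fix0[of i2] by (auto simp: complex_eq_iff Im0)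
    have sum1: "(\<Sum>f\<in>P0. r f *\<^sub>R (Er a f 1 $ i $ j)) = (if i = a \<and> j \<in> P0 then of_real (r j) else 0) - (if i \<in> P0 \<and> j = sw a then of_real (r i) else 0)"
      for r a i j
    proof -
      have "(\<Sum>f\<in>P0. r f *\<^sub>R (Er a f 1 $ i $ j)) = (\<Sum>f\<in>P0. if f = j then (if i = a then of_real (r j) else 0) else 0) - (\<Sum>f\<in>P0. if f = i then (if j = sw a then of_real (r i) else 0) else 0)"
        unfolding sum_subtractf[symmetric] by (rule sum.cong) (auto simp: Er_def scaleR_complex)
      then show ?thesis by simp
    qed
    have ph: "phi (i, j, 1) X = Re (X $ i $ j)" if "j \<noteq> sw i" for i j using that by (simp add: phi_def)
    have Re_eq: "complex_of_real (Re (X $ i $ j)) = X $ i $ j" for i j using Im0 by (simp add: complex_eq_iff)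
    have ph2: "phi (i1, f, 1) X = Re (X $ i1 $ f)" "phi (i2, f, 1) X = Re (X $ i2 $ f)" if "f \<in> P0" for f
      using that by (auto intro!: ph)
    have sks1: "X $ j2 $ j1 = - cnj (X $ i1 $ i2)" "X $ i2 $ j1 = - cnj (X $ i1 $ j2)"
      using sk[of j2 j1] sk[of i2 j1] by simp_all
    have sks2: "X $ f $ j1 = - cnj (X $ i1 $ f)" "X $ f $ j2 = - cnj (X $ i2 $ f)" if "f \<in> P0" for f
      using sk[of f j1] sk[of f j2] that by simp_all
    have cRe: "cnj (X $ i $ j) = X $ i $ j" for i j using Im0 by (simp add: complex_eq_iff)
    show ?thesis unfolding sum_DI(1)[OF True] dEr_def prod.case
      by (simp add: ph2 sum1 cong: sum.cong)
        (cases i rule: index_cases; cases j rule: index_cases;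
         simp add: ph up fix1 Er_def scaleR_complex Re_eq sks1 sks2 cRe)
  next
    case False
    then have P0: "P0 = {}" using rl_iff by simp
    show ?thesis unfolding sum_DI(2)[OF False] dEr_def prod.case
      by (cases i rule: index_cases; cases j rule: index_cases)
        (use fix0[of i1] fix0[of i2] sk[of j2 j1] sk[of i2 j1] in \<open>simp_all add: P0 up phi_def Er_def complex_eq_iff\<close>)
  qed
  then show ?thesis by (simp add: vec_eq_iff)
qed

text \<open>The square root of the product of the root weights, which is
  \<open>p\<^sup>2 * (p * q) ^ card P0\<close> over the reals and the square of
  \<open>p\<^sup>2 * (p * q)\<close> over the complex numbers. It is grouped into \<open>p\<close>
  and \<open>p * q\<close> because row norms determine these two.\<close>

definition rho :: "real \<Rightarrow> real \<Rightarrow> real" where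
  "rho p q = (if rl then sqrt (p\<^sup>2 * (p * q) ^ card P0) else p\<^sup>2 * (p * q))"

lemma prod_weights:
  assumes "p > 0" "q > 0"
  shows "sqrt (\<Prod>(i, j, c)\<in>DI. wt p q i / wt p q j) = rho p q"
proof (cases rl)
  case True
  have "(\<Prod>(i, j, c)\<in>DI. wt p q i / wt p q j) = (\<Prod>(i, j, c)\<in>{(i1, i2, 1::complex), (i1, j2, 1)}. wt p q i / wt p q j) *
     (\<Prod>(i, j, c)\<in>(\<lambda>f. (i1, f, 1::complex)) ` P0. wt p q i / wt p q j) * (\<Prod>(i, j, c)\<in>(\<lambda>f. (i2, f, 1::complex)) ` P0. wt p q i / wt p q j)"
    unfolding DI_def if_P[OF True] by (subst prod.union_disjoint, simp, simp, force)+ simp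
  also have "\<dots> = p\<^sup>2 * (p * q) ^ card P0"
    using assms by (simp add: prod.reindex inj_on_def power_mult_distrib power2_eq_square)
  finally show ?thesis using True by (simp add: rho_def)
next
  case False
  have "\<i> \<noteq> 1" "1 \<noteq> \<i>" by (auto simp: complex_eq_iff)
  then have "(\<Prod>(i, j, c)\<in>DI. wt p q i / wt p q j) = (p\<^sup>2 * (p * q))\<^sup>2"
    using False assms by (simp add: DI_def field_simps power2_eq_square)
  then show ?thesis using False assms by (simp add: rho_def real_sqrt_abs)
qed

lemma a_rho_conj:
  assumes b: "invertible (b :: complex^'m^'m)" and pq: "p > 0" "q > 0"
  shows "a_rho ((\<lambda>g. b ** g ** matrix_inv b) ` NS) (b ** dg p q ** matrix_inv b) = rho p q"
proof -
  let ?c = "\<lambda>X. b ** X ** matrix_inv b"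
  have lie: "lie_algebra (?c ` NS) = ?c ` nS" by (simp add: lie_algebra_conj[OF b] lie_algebra_NS)
  have bb: "matrix_inv b ** b = mat 1" "b ** matrix_inv b = mat 1" using matrix_inv_mult[OF b] by auto
  have cm: "?c X ** ?c Y = ?c (X ** Y)" for X Y by (metis bb(1) matrix_mul_assoc matrix_mul_rid)
  have inv: "matrix_inv (?c (dg p q)) = ?c (matrix_inv (dg p q))"
    by (rule matrix_inv_eqI) (simp add: cm matrix_inv_mult dg_inverse[OF pq] bb)
  have injc: "inj ?c"
  proof (rule injI)
    fix X Y assume "?c X = ?c Y"
    then have "matrix_inv b ** ?c X ** b = matrix_inv b ** ?c Y ** b" by simp
    then show "X = Y" by (metis bb(1) matrix_mul_assoc matrix_mul_lid matrix_mul_rid)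
  qed
  note basis = dual_family_basis[OF finite_DI linear_phi phi_dual DI_nS subspace_nS nS_expand]
  have img: "(?c \<circ> dEr) ` DI = ?c ` (dEr ` DI)" by (simp add: image_comp)
  have "det_on (?c ` nS) (\<lambda>X. ?c (dg p q) ** X ** matrix_inv (?c (dg p q))) = (\<Prod>k\<in>DI. case k of (i, j, c) \<Rightarrow> wt p q i / wt p q j)"
  proof (rule det_on_eigenbasis[where d = "?c \<circ> dEr"])
    show "subspace (?c ` nS)" by (rule linear_subspace_image[OF linear_conj subspace_nS])
    show "linear (\<lambda>X. ?c (dg p q) ** X ** matrix_inv (?c (dg p q)))" by (rule linear_conj)
    show "finite DI" by (rule finite_DI)
    show "inj_on (?c \<circ> dEr) DI" by (rule comp_inj_on[OF basis(1)]) (use injc inj_on_subset in blast)+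
    show "independent ((?c \<circ> dEr) ` DI)" unfolding img
      by (rule linear_independent_injective_image[OF linear_conj basis(2)]) (use injc inj_on_subset in blast)+
    show "span ((?c \<circ> dEr) ` DI) = ?c ` nS" unfolding img
      by (simp only: linear_span_image[OF linear_conj] basis(3))
    fix k assume "k \<in> DI"
    obtain i j c where k: "k = (i, j, c)" by (cases k)
    show "?c (dg p q) ** (?c \<circ> dEr) k ** matrix_inv (?c (dg p q)) = (case k of (i, j, c) \<Rightarrow> wt p q i / wt p q j) *\<^sub>R (?c \<circ> dEr) k"
      by (simp add: k dEr_def inv cm Ad_dg_Er[OF pq] scaleR_matrix_mult)
  qed
  then show ?thesis unfolding a_rho_def lie using prod_weights[OF pq] by simp
qed

end

section \<open>Integrability over a lattice cover\<close>

text \<open>With u = \<delta> / d, the inequality 1 + y \<le> exp y gives 1 + u ln x \<le> x powr u;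
  the constant absorbs the factor 1 / u before the power \<open>d\<close> is taken.\<close>

lemma log_power_bound:
  fixes \<delta> d :: real
  assumes "\<delta> > 0" "d > 0"
  shows "\<exists>K>0. \<forall>x\<ge>1. (1 + ln x) powr d \<le> K * x powr \<delta>"
proof (intro exI conjI allI impI)
  define u where "u = \<delta> / d"
  define K where "K = max 1 (1 / u)"
  have u: "u > 0" using assms by (simp add: u_def)
  have K: "K \<ge> 1" "K * u \<ge> 1" using u by (auto simp: K_def max_def field_simps)
  show "K powr d > 0" using K by simp
  fix x :: real assume x: "x \<ge> 1"
  then have lx: "ln x \<ge> 0" by simp
  have "1 + ln x \<le> K * (1 + u * ln x)"
    using mult_right_mono[OF K(2) lx] K(1) by (simp add: distrib_left mult.assoc)
  also have "\<dots> \<le> K * x powr u"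
    using exp_ge_add_one_self[of "u * ln x"] x K(1) by (intro mult_left_mono) (auto simp: powr_def)
  finally have "(1 + ln x) powr d \<le> (K * x powr u) powr d"
    using lx assms by (intro powr_mono2) auto
  also have "\<dots> = K powr d * x powr \<delta>"
    using K x assms by (simp add: powr_mult powr_powr u_def)
  finally show "(1 + ln x) powr d \<le> K powr d * x powr \<delta>" .
qed

text \<open>A substitute for the absolute value that is at least 1, has square at most 1 + x^2 / 2,
  and on the interval from k to k + 1 stays above half the absolute value of k.\<close>

definition mag :: "real \<Rightarrow> real" where "mag x = max 1 ((1 + \<bar>x\<bar>) / 2)"

lemma mag_ge_1: "mag x \<ge> 1" by (simp add: mag_def)

text \<open>For the second argument of \<open>max\<close> the difference of the two sides is ((1 -
  \<bar>x\<bar>)^2 + 2) / 4.\<close>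

lemma mag_square_le: "(mag x)\<^sup>2 \<le> 1 + x\<^sup>2 / 2"
proof -
  have "((1 + \<bar>x\<bar>) / 2)\<^sup>2 \<le> 1 + x\<^sup>2 / 2"
    using sum_squares_ge_zero[of "1 - \<bar>x\<bar>" 0] by (simp add: power2_eq_square field_simps)
  then show ?thesis by (auto simp: mag_def max_def)
qed

text \<open>With \<open>R = 1 + r\<close> and \<open>T = sqrt (1 + t\<^sup>2)\<close> the two factors dominate \<open>R powr (3/4) * T powr (1/4)\<close>
  and \<open>R powr ((n - 1) / 2) * T\<close>, which leaves room above the exponents \<open>n / 2\<close> and \<open>1\<close>.\<close>

lemma rho_lower_bound:
  fixes y :: "'i \<Rightarrow> real" and t r :: real
  assumes I: "finite I" "card I \<ge> 1" and r: "(\<Sum>i\<in>I. (y i)\<^sup>2) / 2 \<le> r"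
  shows "((\<Prod>i\<in>I. mag (y i)) * mag t) powr (1 + 1 / (4 * real (card I))) \<le>
    sqrt ((1 + r)\<^sup>2 + t\<^sup>2) * (1 + r + t\<^sup>2) powr (real (card I) / 2)"
proof -
  define n where "n = card I"
  define R where "R = 1 + r"
  define T where "T = sqrt (1 + t\<^sup>2)"
  define P where "P = sqrt (R\<^sup>2 + t\<^sup>2)"
  define Q where "Q = R + t\<^sup>2"
  have n1: "n \<ge> 1" using I by (simp add: n_def)
  have r0: "r \<ge> 0" using r sum_nonneg[of I "\<lambda>i. (y i)\<^sup>2"] by simp
  have R1: "R \<ge> 1" using r0 by (simp add: R_def)
  have T1: "T \<ge> 1" by (simp add: T_def)
  have T2: "T\<^sup>2 = 1 + t\<^sup>2" by (simp add: T_def)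
  have PR: "P \<ge> R" using R1 by (simp add: P_def real_le_rsqrt)
  have PT: "P \<ge> T" using R1 by (simp add: P_def T_def)
  have QR: "Q \<ge> R" by (simp add: Q_def)
  have QT: "Q \<ge> T\<^sup>2" using R1 by (simp add: Q_def T2)
  have my: "mag (y i) \<le> R powr (1/2)" if "i \<in> I" for i
  proof -
    have "(y i)\<^sup>2 \<le> (\<Sum>i\<in>I. (y i)\<^sup>2)" using that I by (intro member_le_sum) auto
    then have "(mag (y i))\<^sup>2 \<le> R" using mag_square_le[of "y i"] r by (simp add: R_def)
    then show ?thesis using R1 by (simp add: powr_half_sqrt real_le_rsqrt)
  qed
  have "(\<Prod>i\<in>I. mag (y i)) \<le> (\<Prod>i\<in>I. R powr (1/2))"
    by (intro prod_mono) (use my mag_ge_1 in \<open>auto intro: order_trans[OF zero_le_one]\<close>)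
  also have "\<dots> = R powr (n / 2)" using R1 by (simp add: n_def powr_powr flip: powr_realpow)
  finally have 1: "(\<Prod>i\<in>I. mag (y i)) \<le> R powr (n / 2)" .
  have 2: "mag t \<le> T"
    using mag_square_le[of t] zero_le_power2[of t] unfolding T_def by (intro real_le_rsqrt) linarith
  have p1: "(\<Prod>i\<in>I. mag (y i)) \<ge> 1" by (intro prod_ge_1) (simp add: mag_ge_1)
  have "((\<Prod>i\<in>I. mag (y i)) * mag t) powr (1 + 1 / (4 * real n)) \<le> (R powr (n / 2) * T) powr (1 + 1 / (4 * real n))"
    using 1 2 p1 mag_ge_1[of t] by (intro powr_mono2 mult_mono) auto
  also have "\<dots> = R powr (n / 2 + 1 / 8) * T powr (1 + 1 / (4 * real n))"
  proof -
    have "real n / 2 * (1 + 1 / (4 * real n)) = real n / 2 + 1 / 8" using n1 by (simp add: field_simps)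
    then show ?thesis using R1 T1 by (simp only: powr_mult powr_powr)
  qed
  \<comment> \<open>Both exponents are rounded up so that they split as 3/4 + (n - 1)/2 and 1/4 + 1;
    the second rounding is sharp for n = 1.\<close>
  also have "\<dots> \<le> R powr (n / 2 + 1 / 4) * T powr (5 / 4)"
    using R1 T1 n1 by (intro mult_mono powr_mono) (auto simp: field_simps)
  also have "\<dots> = (R powr (3/4) * T powr (1/4)) * (R powr ((real n - 1) / 2) * T)"
  proof -
    have "R powr (n / 2 + 1 / 4) = R powr (3/4) * R powr ((real n - 1) / 2)"
      by (simp add: powr_add[symmetric] field_simps)
    moreover have "T powr (5 / 4) = T powr (1/4) * T powr 1"
      unfolding powr_add[symmetric] by (rule arg_cong[of _ _ "(powr) T"]) simp
    ultimately show ?thesis using T1 by simp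
  qed
  \<comment> \<open>The first bracket uses that \<open>R\<close> and \<open>T\<close> are at most
    \<open>P\<close>, the second that \<open>R\<close> and the square of \<open>T\<close> are at
    most \<open>Q\<close>.\<close>
  also have "\<dots> \<le> (P powr (3/4) * P powr (1/4)) * (Q powr ((real n - 1) / 2) * Q powr (1/2))"
  proof (intro mult_mono powr_mono2)
    show "T \<le> Q powr (1/2)" using QT T1 R1 QR by (simp add: powr_half_sqrt real_le_rsqrt)
  qed (use R1 T1 n1 PR PT QR in auto)
  also have "\<dots> = P * Q powr (n / 2)"
    using R1 PR QR by (simp add: powr_add[symmetric] field_simps)
  finally show ?thesis by (simp add: P_def Q_def R_def n_def add.assoc)
qed

lemma int_powr_summable:
  fixes s :: real
  assumes "s > 1"
  shows "Infinite_Set_Sum.abs_summable_on (\<lambda>k::int. (max 1 (\<bar>real_of_int k\<bar> / 2)) powr - s) UNIV" (is "Infinite_Set_Sum.abs_summable_on ?f _")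
proof -
  have nat: "Infinite_Set_Sum.abs_summable_on (\<lambda>n::nat. (max 1 (real n / 2)) powr - s) UNIV"
  proof -
    have "summable (\<lambda>n. 2 powr s * (real n powr - s))"
      using assms by (intro summable_mult) (simp add: summable_real_powr_iff)
    then have "summable (\<lambda>n. norm ((max 1 (real n / 2)) powr - s))"
    proof (rule summable_comparison_test_ev[rotated], intro eventually_sequentiallyI[of 1])
      fix n :: nat assume n: "n \<ge> 1"
      have "(max 1 (real n / 2)) powr - s \<le> (real n / 2) powr - s"
        using n assms by (intro powr_mono2') auto
      also have "\<dots> = 2 powr s * (real n powr - s)"
        using n by (simp add: powr_divide powr_minus field_simps)
      finally show "norm (norm ((max 1 (real n / 2)) powr - s)) \<le> 2 powr s * (real n powr - s)" by simp
    qed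
    then show ?thesis by (simp add: abs_summable_on_nat_iff')
  qed
  have U: "(UNIV::int set) = range int \<union> range (\<lambda>n. - int n)"
  proof -
    have "k \<in> range int \<union> range (\<lambda>n. - int n)" for k
      by (cases k rule: int_cases2) auto
    then show ?thesis by auto
  qed
  have "Infinite_Set_Sum.abs_summable_on ?f (range int)"
    by (subst abs_summable_on_reindex_iff[symmetric]) (use nat in auto)
  moreover have "Infinite_Set_Sum.abs_summable_on ?f (range (\<lambda>n. - int n))"
    by (subst abs_summable_on_reindex_iff[symmetric]) (use nat in \<open>auto simp: inj_on_def\<close>)
  ultimately show ?thesis unfolding U by (rule abs_summable_on_union)
qed

lemma mag_shift:
  assumes "0 \<le> y" "y \<le> 1"
  shows "max 1 (\<bar>real_of_int k\<bar> / 2) \<le> mag (of_int k + y)"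
  using assms unfolding mag_def by (auto simp: max_def)

text \<open>Overlapping cells do no harm: at each point the integrand is at most the sum of the
  bounds of all cells containing it. Sum and integral are interchanged by Tonelli, and the sum over
  \<open>PiE I\<close> of a product is controlled by a series in one variable.\<close>

lemma integrable_lattice_cover:
  fixes f :: "'b \<Rightarrow> real" and E :: "('i \<Rightarrow> int) \<Rightarrow> 'b set" and c :: "int \<Rightarrow> real"
  assumes I: "finite I"
    and E: "\<And>k. k \<in> PiE I (\<lambda>_. UNIV) \<Longrightarrow> E k \<in> sets M"
    and EB: "\<And>k. k \<in> PiE I (\<lambda>_. UNIV) \<Longrightarrow> emeasure M (E k) \<le> B" and B: "B < \<infinity>"
    and cover: "\<And>x. x \<in> space M \<Longrightarrow> \<exists>k\<in>PiE I (\<lambda>_. UNIV). x \<in> E k"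
    and f: "f \<in> borel_measurable M" and f0: "\<And>x. x \<in> space M \<Longrightarrow> 0 \<le> f x"
    and fE: "\<And>k x. k \<in> PiE I (\<lambda>_. UNIV) \<Longrightarrow> x \<in> E k \<Longrightarrow> f x \<le> C * (\<Prod>i\<in>I. c (k i))" and C: "C \<ge> 0"
    and c: "Infinite_Set_Sum.abs_summable_on c UNIV" and c0: "\<And>j. c j \<ge> 0"
  shows "integrable M f"
proof (rule integrableI_bounded)
  let ?K = "PiE I (\<lambda>_. UNIV :: int set)"
  have cK: "countable ?K" using I by (intro countable_PiE) auto
  have "Infinite_Set_Sum.abs_summable_on (\<lambda>k. \<Prod>i\<in>I. c (k i)) ?K"
    by (intro abs_summable_on_prod_PiE I c) auto
  then have "integrable (count_space ?K) (\<lambda>k. \<Prod>i\<in>I. c (k i))" by (simp add: abs_summable_on_def)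
  then have fin: "(\<integral>\<^sup>+k. ennreal (\<Prod>i\<in>I. c (k i)) \<partial>count_space ?K) < \<infinity>"
    by (subst (asm) integrable_iff_bounded) (simp add: prod_nonneg c0)
  have "(\<integral>\<^sup>+x. ennreal (norm (f x)) \<partial>M) \<le>
      (\<integral>\<^sup>+x. \<integral>\<^sup>+k. ennreal (C * (\<Prod>i\<in>I. c (k i))) * indicator (E k) x \<partial>count_space ?K \<partial>M)"
  proof (rule nn_integral_mono)
    fix x assume x: "x \<in> space M"
    then obtain k where k: "k \<in> ?K" "x \<in> E k" using cover by blast
    have "ennreal (norm (f x)) \<le> ennreal (C * (\<Prod>i\<in>I. c (k i))) * indicator (E k) x"
      using fE[OF k] f0[OF x] k by (simp add: ennreal_leI)
    also have "\<dots> \<le> (\<integral>\<^sup>+k. ennreal (C * (\<Prod>i\<in>I. c (k i))) * indicator (E k) x \<partial>count_space ?K)"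
      using k(1) by (rule nn_integral_ge_point)
    finally show "ennreal (norm (f x)) \<le> (\<integral>\<^sup>+k. ennreal (C * (\<Prod>i\<in>I. c (k i))) * indicator (E k) x \<partial>count_space ?K)" .
  qed
  also have "\<dots> = (\<integral>\<^sup>+k. \<integral>\<^sup>+x. ennreal (C * (\<Prod>i\<in>I. c (k i))) * indicator (E k) x \<partial>M \<partial>count_space ?K)"
    by (rule nn_integral_count_space_nn_integral[OF cK]) (use E in auto)
  also have "\<dots> = (\<integral>\<^sup>+k. ennreal (C * (\<Prod>i\<in>I. c (k i))) * emeasure M (E k) \<partial>count_space ?K)"
    by (intro nn_integral_cong) (simp add: nn_integral_cmult_indicator E)
  also have "\<dots> \<le> (\<integral>\<^sup>+k. (ennreal C * B) * ennreal (\<Prod>i\<in>I. c (k i)) \<partial>count_space ?K)"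
  proof (rule nn_integral_mono)
    fix k assume "k \<in> space (count_space ?K)"
    then have "emeasure M (E k) \<le> B" using EB by simp
    then have "ennreal C * ennreal (\<Prod>i\<in>I. c (k i)) * emeasure M (E k) \<le> ennreal C * ennreal (\<Prod>i\<in>I. c (k i)) * B"
      by (rule mult_left_mono) simp
    then show "ennreal (C * (\<Prod>i\<in>I. c (k i))) * emeasure M (E k) \<le> (ennreal C * B) * ennreal (\<Prod>i\<in>I. c (k i))"
      using C by (simp add: ennreal_mult prod_nonneg c0 mult_ac)
  qed
  also have "\<dots> = (ennreal C * B) * (\<integral>\<^sup>+k. ennreal (\<Prod>i\<in>I. c (k i)) \<partial>count_space ?K)"
    by (rule nn_integral_cmult) simp
  also have "\<dots> < \<infinity>" using fin B by (simp add: ennreal_mult_less_top)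
  finally show "(\<integral>\<^sup>+x. ennreal (norm (f x)) \<partial>M) < \<infinity>" .
qed (rule f)

context split_frame
begin

section \<open>The commutator subgroup of \<open>NS\<close>\<close>

lemma NSD:
  assumes "g \<in> NS"
  shows "upper (g - mat 1)" "g $ i $ j \<in> F" "ctranspose g ** S ** g = S"
    "lv i \<le> lv j \<Longrightarrow> g $ i $ j = (if i = j then 1 else 0)"
    "(\<Sum>k\<in>UNIV. cnj (g $ k $ a) * g $ sw k $ b) = S $ a $ b"
  using assms unit_entry[of g i j] unfolding NS_def isometry_nth[symmetric] by auto

lemma parameter_exists:
  assumes "\<tau> \<in> F"
  obtains x where "\<And>f. f \<in> P0 \<Longrightarrow> x $ f = y f" "dtau x = \<tau>" "\<not> rl \<Longrightarrow> dsig x = \<sigma>"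
proof
  define x :: "real^'m" where "x = (\<chi> k. if k \<in> P0 then y k else if rl then Re \<tau>
     else if k = i1 then Re \<tau> else if k = i2 then Im \<tau> else \<sigma>)"
  show "x $ f = y f" if "f \<in> P0" for f using that by (simp add: x_def)
  show "dtau x = \<tau>" using assms by (auto simp: dtau_def x_def F_iff complex_eq_iff)
  show "dsig x = \<sigma>" if "\<not> rl" using that by (simp add: dsig_def x_def)
qed

lemma dl_cong:
  assumes "\<And>f. f \<in> P0 \<Longrightarrow> x $ f = x' $ f" "dtau x = dtau x'" "dsig x = dsig x'"
  shows "dl x = dl x'"
proof -
  have "drad x = drad x'" using assms(1) by (simp add: drad_def)
  then show ?thesis using assms by (simp add: dl_def vec_eq_iff)
qed

lemma dl_inverse: "matrix_inv (dl x) = dl (- x)" "invertible (dl x)"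
proof -
  have "dl x ** dl (- x) = mat 1" by (simp add: dl_add dl_0)
  then show "matrix_inv (dl x) = dl (- x)" "invertible (dl x)" by (auto intro: matrix_inv_eqI invertibleI)
qed

lemma D_eq: "D = range dl"
  using dl_D D_range by blast

lemma subgroup_D: "subgroup D GL"
  by (rule group.subgroupI[OF group_GL]) (auto simp: D_eq inv_GL dl_inverse dl_add)

text \<open>These are the positions of the simple roots and their mirror images under
  \<open>sw\<close>: no index has a level strictly in between, so the entries simply add. The
  position (i2, j2) is of this kind only when \<open>P0\<close> is empty.\<close>

lemma NS_additive:
  assumes g: "g \<in> NS" and h: "h \<in> NS"
  shows "(g ** h) $ i1 $ i2 = g $ i1 $ i2 + h $ i1 $ i2"
    "f \<in> P0 \<Longrightarrow> (g ** h) $ i2 $ f = g $ i2 $ f + h $ i2 $ f"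
    "f \<in> P0 \<Longrightarrow> (g ** h) $ f $ j2 = g $ f $ j2 + h $ f $ j2"
    "(g ** h) $ j2 $ j1 = g $ j2 $ j1 + h $ j2 $ j1"
    "\<not> rl \<Longrightarrow> (g ** h) $ i2 $ j2 = g $ i2 $ j2 + h $ i2 $ j2"
proof -
  note ug = NSD(4)[OF g] and uh = NSD(4)[OF h]
  show "(g ** h) $ i1 $ i2 = g $ i1 $ i2 + h $ i1 $ i2" "(g ** h) $ j2 $ j1 = g $ j2 $ j1 + h $ j2 $ j1"
    by (simp_all add: matrix_matrix_mult_def sum_split ug uh)
  show "(g ** h) $ i2 $ f = g $ i2 $ f + h $ i2 $ f" if "f \<in> P0"
  proof -
    have "(\<Sum>k\<in>P0. g $ i2 $ k * h $ k $ f) = (\<Sum>k\<in>P0. if k = f then g $ i2 $ f else 0)"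
      by (rule sum.cong) (use that in \<open>auto simp: uh\<close>)
    then show ?thesis using that by (simp add: matrix_matrix_mult_def sum_split ug uh)
  qed
  show "(g ** h) $ f $ j2 = g $ f $ j2 + h $ f $ j2" if "f \<in> P0"
  proof -
    have "(\<Sum>k\<in>P0. g $ f $ k * h $ k $ j2) = (\<Sum>k\<in>P0. if k = f then h $ f $ j2 else 0)"
      by (rule sum.cong) (use that in \<open>auto simp: ug\<close>)
    then show ?thesis using that by (simp add: matrix_matrix_mult_def sum_split ug uh)
  qed
  show "(g ** h) $ i2 $ j2 = g $ i2 $ j2 + h $ i2 $ j2" if "\<not> rl"
    using that rl_iff by (simp add: matrix_matrix_mult_def sum_split ug uh)
qed

text \<open>Over the reals the levels of \<open>i2\<close> and \<open>j2\<close> are separated by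
  \<open>P0\<close>, so this entry is not additive. Once the entries of row \<open>i2\<close> in
  \<open>P0\<close> vanish, the isometry relation makes it purely imaginary, hence zero.\<close>

lemma NS_real_i2j2:
  assumes rl and g: "g \<in> NS" and z: "\<And>f. f \<in> P0 \<Longrightarrow> g $ i2 $ f = 0"
  shows "g $ i2 $ j2 = 0"
proof -
  note u = NSD(4)[OF g] and iso = NSD(5)[OF g]
  have f: "g $ f $ j2 = 0" if "f \<in> P0" for f
  proof -
    have "(\<Sum>k\<in>P0. cnj (g $ k $ f) * g $ sw k $ j2) = (\<Sum>k\<in>P0. if k = f then g $ f $ j2 else 0)"
      by (rule sum.cong) (use that in \<open>auto simp: u\<close>)
    then show ?thesis using iso[of f j2] that by (simp add: sum_split u z S_nth)
  qed
  have "cnj (g $ i2 $ j2) + g $ i2 $ j2 = 0"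
    using iso[of j2 j2] by (simp add: sum_split u z f S_nth)
  then have "Re (g $ i2 $ j2) = 0" by (simp add: complex_eq_iff)
  moreover have "Im (g $ i2 $ j2) = 0" using NSD(2)[OF g] \<open>rl\<close> by (simp add: F_iff)
  ultimately show ?thesis by (simp add: complex_eq_iff)
qed

lemma commutator_D:
  assumes g: "g \<in> NS" and h: "h \<in> NS"
  shows "g ** h ** matrix_inv g ** matrix_inv h \<in> D"
proof -
  let ?K = "g ** h ** matrix_inv g ** matrix_inv h"
  have ig: "matrix_inv g \<in> NS" "g ** matrix_inv g = mat 1" and ih: "matrix_inv h \<in> NS" "h ** matrix_inv h = mat 1"
    using NS_inverse(3)[OF g] NS_inverse(3)[OF h] matrix_inv_mult(1)[OF NS_inverse(1)[OF g]] matrix_inv_mult(1)[OF NS_inverse(1)[OF h]] by blast+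
  have gh: "g ** h \<in> NS" "g ** h ** matrix_inv g \<in> NS" using g h ig NS_mult by auto
  have K: "?K \<in> NS" using gh ih NS_mult by auto
  have hom: "?K $ i $ j = 0" if "i \<noteq> j" and add: "\<And>a b. a \<in> NS \<Longrightarrow> b \<in> NS \<Longrightarrow> (a ** b) $ i $ j = a $ i $ j + b $ i $ j" for i j
  proof -
    have "g $ i $ j + matrix_inv g $ i $ j = 0" "h $ i $ j + matrix_inv h $ i $ j = 0"
      using add[OF g ig(1)] add[OF h ih(1)] that(1) unfolding ig(2) ih(2) by (auto simp: mat_def)
    moreover have "?K $ i $ j = (g $ i $ j + matrix_inv g $ i $ j) + (h $ i $ j + matrix_inv h $ i $ j)"
      unfolding add[OF gh(2) ih(1)] add[OF gh(1) ig(1)] add[OF g h] by simp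
    ultimately show ?thesis by simp
  qed
  have "?K $ i1 $ i2 = 0" by (rule hom) (auto intro: NS_additive)
  moreover have f: "?K $ i2 $ f = 0" if "f \<in> P0" for f
    by (rule hom) (use that in \<open>auto intro: NS_additive\<close>)
  moreover have "?K $ i2 $ j2 = 0"
  proof (cases rl)
    case True
    then show ?thesis using NS_real_i2j2 K f by blast
  next
    case False
    then show ?thesis by (intro hom) (auto intro: NS_additive)
  qed
  ultimately show ?thesis using K by (simp add: D_def)
qed

text \<open>The commutator equation is compared entrywise in the form dl x (h g) = g h, where no
  inverses appear.\<close>

lemma commutator_entries:
  assumes g: "g \<in> NS" and h: "h \<in> NS" and K: "g ** h ** matrix_inv g ** matrix_inv h = dl x"
  shows "f \<in> P0 \<Longrightarrow> of_real (x $ f) = g $ i1 $ i2 * h $ i2 $ f - h $ i1 $ i2 * g $ i2 $ f"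
    "dtau x = (g ** h) $ i1 $ j2 - (h ** g) $ i1 $ j2 - (\<Sum>f\<in>P0. of_real (x $ f) * (h $ f $ j2 + g $ f $ j2))"
    "\<not> rl \<Longrightarrow> dtau x = 0 \<Longrightarrow> \<i> * of_real (dsig x) = (g ** h) $ i1 $ j1 - (h ** g) $ i1 $ j1"
proof -
  have hg: "h ** g \<in> NS" using g h NS_mult by auto
  note u = NSD(4)[OF hg] and ug = NSD(4)[OF g] and uh = NSD(4)[OF h]
  have inv: "matrix_inv g ** g = mat 1" "matrix_inv h ** h = mat 1"
    using matrix_inv_mult(2)[OF NS_inverse(1)[OF g]] matrix_inv_mult(2)[OF NS_inverse(1)[OF h]] by blast+
  have "dl x ** (h ** g) = g ** h ** matrix_inv g ** (matrix_inv h ** h) ** g"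
    by (simp add: K[symmetric] matrix_mul_assoc)
  also have "\<dots> = g ** h ** (matrix_inv g ** g)" by (simp add: inv matrix_mul_assoc[symmetric])
  finally have "dl x ** (h ** g) = g ** h" by (simp add: inv)
  then have e: "(g ** h) $ i $ j = (\<Sum>k\<in>UNIV. dl x $ i $ k * (h ** g) $ k $ j)" for i j
    by (metis (no_types, lifting) matrix_matrix_mult_def vec_lambda_beta sum.cong)
  show "of_real (x $ f) = g $ i1 $ i2 * h $ i2 $ f - h $ i1 $ i2 * g $ i2 $ f" if f: "f \<in> P0"
  proof -
    have s: "(\<Sum>k\<in>P0. dl x $ i1 $ k * (h ** g) $ k $ f) = of_real (x $ f)"
    proof -
      have "(\<Sum>k\<in>P0. dl x $ i1 $ k * (h ** g) $ k $ f) = (\<Sum>k\<in>P0. if k = f then of_real (x $ f) else 0)"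
        by (rule sum.cong) (use f in \<open>auto simp: u dl_def\<close>)
      then show ?thesis using f by simp
    qed
    have "(g ** h) $ i1 $ f = (h ** g) $ i1 $ f + of_real (x $ f)"
      unfolding e[of i1 f] sum_split s using f by (simp add: u) (simp add: dl_def)
    moreover have p: "(a ** b) $ i1 $ f = b $ i1 $ f + a $ i1 $ i2 * b $ i2 $ f + a $ i1 $ f" if "a \<in> NS" "b \<in> NS" for a b
    proof -
      have "(\<Sum>k\<in>P0. a $ i1 $ k * b $ k $ f) = (\<Sum>k\<in>P0. if k = f then a $ i1 $ f else 0)"
        by (rule sum.cong) (use f NSD(4)[OF that(2)] in auto)
      then show ?thesis using f by (simp add: matrix_matrix_mult_def sum_split NSD(4)[OF that(1)] NSD(4)[OF that(2)])
    qed
    ultimately show ?thesis by (simp add: p g h)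
  qed
  show "dtau x = (g ** h) $ i1 $ j2 - (h ** g) $ i1 $ j2 - (\<Sum>f\<in>P0. of_real (x $ f) * (h $ f $ j2 + g $ f $ j2))"
  proof -
    have s: "(\<Sum>k\<in>P0. dl x $ i1 $ k * (h ** g) $ k $ j2) = (\<Sum>f\<in>P0. of_real (x $ f) * (h $ f $ j2 + g $ f $ j2))"
      by (rule sum.cong) (auto simp: dl_def NS_additive[OF h g])
    show ?thesis using e[of i1 j2] by (simp add: sum_split s u) (simp add: dl_def)
  qed
  show "\<i> * of_real (dsig x) = (g ** h) $ i1 $ j1 - (h ** g) $ i1 $ j1" if "\<not> rl" "dtau x = 0"
  proof -
    have P0: "P0 = {}" using that rl_iff by simp
    then have "drad x = 0" by (simp add: drad_def)
    then show ?thesis using e[of i1 j1] P0 that by (simp add: sum_split u) (simp add: dl_def Complex_eq)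
  qed
qed

lemma eta_NS:
  assumes "c \<in> F"
  shows "mat 1 + Er i1 i2 c \<in> NS"
proof (rule cayley_sq0)
  show "Er i1 i2 c \<in> nS" using assms by (intro Er_nS) simp
  show "Er i1 i2 c ** Er i1 i2 c = 0"
    by (auto simp: vec_eq_iff matrix_matrix_mult_def Er_def intro!: sum.neutral)
qed

text \<open>The factor 1/2 makes the entry c - cnj c at (i2, j2) equal to \<i>.\<close>

lemma omega_NS:
  assumes "\<not> rl"
  shows "mat 1 + Er i2 j2 (\<i> / 2) \<in> NS"
proof (rule cayley_sq0)
  show "Er i2 j2 (\<i> / 2) \<in> nS" using assms by (intro Er_nS) (simp_all add: F_iff)
  show "Er i2 j2 (\<i> / 2) ** Er i2 j2 (\<i> / 2) = 0"
    by (auto simp: vec_eq_iff matrix_matrix_mult_def Er_def intro!: sum.neutral)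
qed

lemma upper_mult_level:
  assumes "upper X" "upper Y" "lv i \<le> lv j + 1"
  shows "(X ** Y) $ i $ j = 0"
proof (rule ccontr)
  assume "(X ** Y) $ i $ j \<noteq> 0"
  then obtain k where "X $ i $ k \<noteq> 0" "Y $ k $ j \<noteq> 0" by (rule mult_nz)
  then have "lv k < lv i" "lv j < lv k" using assms unfolding upper_def by blast+
  then show False using assms(3) by simp
qed

text \<open>An element of the root groups attached to the positions (i2, f). The square of
  \<open>Z\<close> need not vanish, so a Cayley series is used; but products of upper matrices
  vanish at positions of level difference at most one, where the entries are therefore those of 1 +
  Z.\<close>

lemma zeta_exists:
  fixes y :: "'m \<Rightarrow> real"
  obtains h where "h \<in> NS" "h $ i1 $ i2 = 0" "h $ j2 $ j1 = 0" "\<And>f. f \<in> P0 \<Longrightarrow> h $ i2 $ f = of_real (y f)"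
    "\<And>f. f \<in> P0 \<Longrightarrow> h $ f $ j2 = - of_real (y f)"
proof -
  define Z :: "complex^'m^'m" where
    "Z = (\<chi> i j. if i = i2 \<and> j \<in> P0 then of_real (y j) else if i \<in> P0 \<and> j = j2 then - of_real (y i) else 0)"
  have "Z $ i $ j = - cnj (Z $ sw j $ sw i)" for i j
    by (cases i rule: index_cases; cases j rule: index_cases) (simp_all add: Z_def)
  then have "skew Z" unfolding skew_def by blast
  moreover have up: "upper Z" by (auto simp: upper_def Z_def)
  moreover have "Z $ i $ j \<in> F" for i j by (simp add: Z_def)
  ultimately have Z: "Z \<in> nS" by (simp add: nS_def)
  let ?h = "mat 1 + Z + (1/2) *\<^sub>R (Z ** Z) + (1/4) *\<^sub>R (Z ** Z ** Z) + (1/8) *\<^sub>R (Z ** Z ** Z ** Z)"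
  have h: "?h $ i $ j = mat 1 $ i $ j + Z $ i $ j" if "lv i \<le> lv j + 1" for i j
    using that up by (simp add: upper_mult_level upper_mult)
  show ?thesis
  proof (rule that[OF cayley[OF Z]])
    show "?h $ i1 $ i2 = 0" "?h $ j2 $ j1 = 0" by (subst h; simp add: mat_def Z_def)+
    show "?h $ i2 $ f = of_real (y f)" "?h $ f $ j2 = - of_real (y f)" if "f \<in> P0" for f
      using that by (subst h; simp add: mat_def Z_def)+
  qed
qed

text \<open>Each element of \<open>D\<close> is a product of two commutators. Over the reals the
  first one matches the coordinates in \<open>P0\<close> and the second the remaining
  \<open>dtau\<close>; over the complex numbers the first one matches \<open>dtau\<close> and the
  second the remaining \<open>dsig\<close>.\<close>

lemma D_subset_derived: "D \<subseteq> derived GL NS"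
proof
  fix g assume "g \<in> D"
  then obtain x where gx: "g = dl x" using D_range by blast
  let ?Dv = "derived GL NS"
  have Dv: "subgroup ?Dv GL" unfolding derived_def
    by (rule group.generate_is_subgroup[OF group_GL])
      (auto simp: inv_GL NS_inverse(1) intro!: invertible_mult invertible_imp_matrix_inv intro: NS_inverse(1))
  have mult: "a ** b \<in> ?Dv" if "a \<in> ?Dv" "b \<in> ?Dv" for a b
    using subgroup.m_closed[OF Dv that] by simp
  have comm: "a ** b ** matrix_inv a ** matrix_inv b \<in> ?Dv" if "a \<in> NS" "b \<in> NS" for a b
  proof -
    have "a ** b ** matrix_inv a ** matrix_inv b = a \<otimes>\<^bsub>GL\<^esub> b \<otimes>\<^bsub>GL\<^esub> inv\<^bsub>GL\<^esub> a \<otimes>\<^bsub>GL\<^esub> inv\<^bsub>GL\<^esub> b"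
      using NS_inverse that by (simp add: inv_GL)
    then show ?thesis unfolding derived_def by (intro generate.incl) (use that in blast)
  qed
  have comm_dl: "\<exists>w. a ** b ** matrix_inv a ** matrix_inv b = dl w" if "a \<in> NS" "b \<in> NS" for a b
    using commutator_D[OF that] D_range by blast
  show "g \<in> ?Dv"
  proof (cases rl)
    case True
    obtain f0 where f0: "f0 \<in> P0" using True rl_iff by auto
    have 1: "dl w \<in> ?Dv" if w0: "\<And>f. f \<in> P0 \<Longrightarrow> w $ f = 0" for w
    proof -
      have tw: "dtau w = of_real (w $ i2)" using True by (simp add: dtau_def)
      obtain v where v: "\<And>f. f \<in> P0 \<Longrightarrow> v $ f = (if f = f0 then - w $ i2 else 0)" "dtau v = 0"
        using parameter_exists[of 0 "\<lambda>f. if f = f0 then - w $ i2 else 0"] F_closed(1) by metis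
      obtain h where h: "h \<in> NS" "h $ i1 $ i2 = 0" "h $ j2 $ j1 = 0"
        "\<And>f. f \<in> P0 \<Longrightarrow> h $ i2 $ f = of_real (if f = f0 then 1 else 0)"
        "\<And>f. f \<in> P0 \<Longrightarrow> h $ f $ j2 = - of_real (if f = f0 then 1 else 0)"
        using zeta_exists[of "\<lambda>f. if f = f0 then 1 else 0"] by metis
      have gN: "dl v \<in> NS" using dl_D by (simp add: D_def)
      obtain u where u: "dl v ** h ** matrix_inv (dl v) ** matrix_inv h = dl u" using comm_dl[OF gN h(1)] by auto
      note ent = commutator_entries[OF gN h(1) u]
      have uf: "u $ f = 0" if "f \<in> P0" for f
        using ent(1)[OF that] that by (simp add: h dl_def)
      note uh = NSD(4)[OF h(1)]
      have a: "(dl v ** h) $ i1 $ j2 = h $ i1 $ j2 + of_real (w $ i2)"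
      proof -
        have "(\<Sum>k\<in>P0. dl v $ i1 $ k * h $ k $ j2) = (\<Sum>k\<in>P0. if k = f0 then of_real (w $ i2) else 0)"
          by (rule sum.cong) (auto simp: dl_def v h)
        then have "(\<Sum>k\<in>P0. dl v $ i1 $ k * h $ k $ j2) = of_real (w $ i2)" using f0 by simp
        then show ?thesis by (simp add: matrix_matrix_mult_def sum_split uh) (simp add: dl_def v)
      qed
      have b: "(h ** dl v) $ i1 $ j2 = h $ i1 $ j2"
      proof -
        have "(\<Sum>k\<in>P0. h $ i1 $ k * dl v $ k $ j2) = 0" by (rule sum.neutral) (auto simp: dl_def)
        then show ?thesis by (simp add: matrix_matrix_mult_def sum_split uh h) (simp add: dl_def v)
      qed
      have "dtau u = dtau w" using ent(2) by (simp add: a b uf tw)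
      moreover have "dsig u = dsig w" using True by (simp add: dsig_def)
      ultimately have "dl u = dl w" using uf w0 by (intro dl_cong) auto
      then show ?thesis using comm[OF gN h(1)] u by simp
    qed
    obtain h where h: "h \<in> NS" "h $ i1 $ i2 = 0" "h $ j2 $ j1 = 0"
        "\<And>f. f \<in> P0 \<Longrightarrow> h $ i2 $ f = of_real (x $ f)" "\<And>f. f \<in> P0 \<Longrightarrow> h $ f $ j2 = - of_real (x $ f)"
      using zeta_exists[of "\<lambda>f. x $ f"] by metis
    let ?e = "mat 1 + Er i1 i2 1"
    have eN: "?e \<in> NS" by (rule eta_NS) simp
    obtain u where u: "?e ** h ** matrix_inv ?e ** matrix_inv h = dl u" using comm_dl[OF eN h(1)] by auto
    have uf: "u $ f = x $ f" if "f \<in> P0" for f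
      using commutator_entries(1)[OF eN h(1) u that] that by (simp add: h Er_def mat_def)
    have "dl u ** dl (x - u) = dl x" by (simp add: dl_add)
    moreover have "dl u \<in> ?Dv" using comm[OF eN h(1)] u by simp
    moreover have "dl (x - u) \<in> ?Dv" by (rule 1) (simp add: uf)
    ultimately show ?thesis using mult gx by metis
  next
    case False
    then have P0: "P0 = {}" using rl_iff by simp
    have F: "c \<in> F" for c using False by (simp add: F_iff)
    have 1: "dl w \<in> ?Dv" if w0: "dtau w = 0" for w
    proof -
      \<comment> \<open>The commutator contributes dtau v - cnj (dtau v) to the entry (i1, j1), that
        is twice the imaginary part, hence the division by 2.\<close>
      obtain v where v: "dtau v = \<i> * of_real (dsig w) / 2" "dsig v = 0"
        using parameter_exists[OF F[of "\<i> * of_real (dsig w) / 2"], of "\<lambda>_. 0" 0] False by blast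
      have gN: "dl v \<in> NS" using dl_D by (simp add: D_def)
      let ?e = "mat 1 + Er i1 i2 1"
      have eN: "?e \<in> NS" by (rule eta_NS) simp
      obtain u where u: "?e ** dl v ** matrix_inv ?e ** matrix_inv (dl v) = dl u" using comm_dl[OF eN gN] by auto
      note ent = commutator_entries[OF eN gN u]
      have r0: "drad v = 0" by (simp add: drad_def P0)
      have "dtau u = 0" using ent(2)
        by (simp add: matrix_matrix_mult_def sum_split P0) (simp add: dl_def Er_def mat_def)
      moreover have "dsig u = dsig w"
      proof -
        have "\<i> * of_real (dsig u) = \<i> * of_real (dsig w)"
          unfolding ent(3)[OF False \<open>dtau u = 0\<close>]
          by (simp add: matrix_matrix_mult_def sum_split P0) (simp add: dl_def Er_def mat_def v r0)
        then show ?thesis by simp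
      qed
      ultimately have "dl u = dl w" using w0 P0 by (intro dl_cong) auto
      then show ?thesis using comm[OF eN gN] u by simp
    qed
    \<comment> \<open>In the commutator this entry is multiplied by the entry \<i> of
      \<open>?h\<close> at (i2, j2), which the factor - \<i> cancels.\<close>
    let ?e = "mat 1 + Er i1 i2 (- \<i> * dtau x)"
    let ?h = "mat 1 + Er i2 j2 (\<i> / 2)"
    have eN: "?e \<in> NS" by (rule eta_NS) (rule F)
    have hN: "?h \<in> NS" by (rule omega_NS) (rule False)
    obtain u where u: "?e ** ?h ** matrix_inv ?e ** matrix_inv ?h = dl u" using comm_dl[OF eN hN] by auto
    have "- (\<i> * z * \<i>) = z" for z by (simp add: complex_eq_iff)
    then have "dtau u = dtau x" using commutator_entries(2)[OF eN hN u]
      by (simp add: matrix_matrix_mult_def sum_split P0) (simp add: Er_def mat_def)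
    have "dl u ** dl (x - u) = dl x" by (simp add: dl_add)
    moreover have "dl u \<in> ?Dv" using comm[OF eN hN] u by simp
    moreover have "dl (x - u) \<in> ?Dv"
    proof (rule 1)
      have "dtau (x - u) + dtau u = dtau x" by (simp add: dtau_add[symmetric])
      then show "dtau (x - u) = 0" using \<open>dtau u = dtau x\<close> by simp
    qed
    ultimately show ?thesis using mult gx by metis
  qed
qed

lemma derived_NS: "derived GL NS = D"
proof
  show "derived GL NS \<subseteq> D"
    unfolding derived_def
  proof (rule group.generate_subgroup_incl[OF group_GL _ subgroup_D])
    show "derived_set GL NS \<subseteq> D" using commutator_D NS_inverse by (auto simp: inv_GL)
  qed
qed (rule D_subset_derived)

section \<open>The Iwasawa component read off the first two rows\<close>

definition nrm :: "complex^'m^'m \<Rightarrow> real" where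
  "nrm g = (\<Sum>k\<in>UNIV. (cmod (g $ i1 $ k))\<^sup>2)"

text \<open>The Gram determinant of the rows \<open>i1\<close> and \<open>i2\<close>, by Lagrange's
  identity the squared norm of their exterior product.\<close>

definition gram :: "complex^'m^'m \<Rightarrow> real" where
  "gram g = nrm g * (\<Sum>k\<in>UNIV. (cmod (g $ i2 $ k))\<^sup>2) - (cmod (\<Sum>k\<in>UNIV. g $ i1 $ k * cnj (g $ i2 $ k)))\<^sup>2"

text \<open>Right multiplication by the unitary \<open>k\<close> preserves inner products of rows.
  Conjugation by \<open>S\<close> turns \<open>u\<close> into an opposite unipotent, so before
  multiplying by \<open>k\<close> the first row is \<open>p\<close> times a basis vector and the
  second is \<open>q\<close> times another one plus a multiple of the first row.\<close>

lemma iwasawa_rows: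
  assumes u: "u \<in> NS" and k: "k ** ctranspose k = mat 1"
    and g: "g = (S ** u ** S) ** dg p q ** k"
  shows "nrm g = p\<^sup>2" "gram g = (p * q)\<^sup>2"
proof -
  let ?v = "S ** u ** S"
  have G: "g ** ctranspose g = ?v ** dg p q ** ctranspose (?v ** dg p q)"
  proof -
    have "g ** ctranspose g = ?v ** dg p q ** (k ** ctranspose k) ** ctranspose (?v ** dg p q)"
      unfolding g ctranspose_mult[of "?v ** dg p q" k] by (simp only: matrix_mul_assoc)
    then show ?thesis by (simp add: k)
  qed
  have e: "(\<Sum>l\<in>UNIV. g $ i $ l * cnj (g $ j $ l)) =
     (\<Sum>l\<in>UNIV. (of_real (wt p q l) * u $ sw i $ sw l) * cnj (of_real (wt p q l) * u $ sw j $ sw l))" for i j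
  proof -
    have "(g ** ctranspose g) $ i $ j = (?v ** dg p q ** ctranspose (?v ** dg p q)) $ i $ j" by (simp only: G)
    then show ?thesis by (simp add: matrix_matrix_mult_def[of g] matrix_matrix_mult_def[of "?v ** dg p q"] mult_dg_nth)
  qed
  note un = NSD(4)[OF u]
  let ?c = "u $ j2 $ j1"
  have 11: "(\<Sum>l\<in>UNIV. g $ i1 $ l * cnj (g $ i1 $ l)) = of_real (p\<^sup>2)"
    unfolding e by (simp add: sum_split un power2_eq_square)
  have 22: "(\<Sum>l\<in>UNIV. g $ i2 $ l * cnj (g $ i2 $ l)) = of_real (q\<^sup>2 + p\<^sup>2 * (cmod ?c)\<^sup>2)"
  proof -
    have "(\<Sum>l\<in>UNIV. g $ i2 $ l * cnj (g $ i2 $ l)) = of_real (q\<^sup>2) + of_real (p\<^sup>2) * (?c * cnj ?c)"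
      unfolding e by (simp add: sum_split un power2_eq_square mult_ac)
    then show ?thesis by (simp only: of_real_add of_real_mult complex_norm_square)
  qed
  have 12: "(\<Sum>l\<in>UNIV. g $ i1 $ l * cnj (g $ i2 $ l)) = of_real (p\<^sup>2) * cnj ?c"
    unfolding e by (simp add: sum_split un power2_eq_square mult_ac)
  have sq: "complex_of_real (\<Sum>l\<in>UNIV. (cmod (g $ i $ l))\<^sup>2) = (\<Sum>l\<in>UNIV. g $ i $ l * cnj (g $ i $ l))" for i
    by (simp only: of_real_sum complex_norm_square)
  have n1: "(\<Sum>l\<in>UNIV. (cmod (g $ i1 $ l))\<^sup>2) = p\<^sup>2" using sq[of i1] unfolding 11 by (simp only: of_real_eq_iff)
  have n2: "(\<Sum>l\<in>UNIV. (cmod (g $ i2 $ l))\<^sup>2) = q\<^sup>2 + p\<^sup>2 * (cmod ?c)\<^sup>2" using sq[of i2] unfolding 22 by (simp only: of_real_eq_iff)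
  show n: "nrm g = p\<^sup>2" unfolding nrm_def by (rule n1)
  have cm: "cmod (of_real (p\<^sup>2) * cnj ?c) = p\<^sup>2 * cmod ?c" by (simp only: norm_mult norm_of_real complex_mod_cnj abs_power2)
  show "gram g = (p * q)\<^sup>2"
    unfolding gram_def n n2 12 cm by (simp only: power2_eq_square) (simp add: algebra_simps)
qed

lemma dl_rows:
  shows "nrm (dl x) = (1 + drad x)\<^sup>2 + (cmod (dtau x))\<^sup>2 + (dsig x)\<^sup>2"
    "gram (dl x) = (1 + drad x + (cmod (dtau x))\<^sup>2)\<^sup>2 + (dsig x)\<^sup>2"
proof -
  have cC: "(cmod (Complex a b))\<^sup>2 = a\<^sup>2 + b\<^sup>2" for a b by (simp add: cmod_power2)
  have s: "(\<Sum>k\<in>P0. (cmod (dl x $ i1 $ k))\<^sup>2) = 2 * drad x"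
  proof -
    have "(\<Sum>k\<in>P0. (cmod (dl x $ i1 $ k))\<^sup>2) = (\<Sum>k\<in>P0. (x $ k)\<^sup>2)"
      by (rule sum.cong) (auto simp: dl_def)
    then show ?thesis by (simp add: drad_def)
  qed
  have "nrm (dl x) = 1 + (cmod (dtau x))\<^sup>2 + ((drad x)\<^sup>2 + (dsig x)\<^sup>2) + 2 * drad x"
    unfolding nrm_def sum_split s by (simp add: dl_def cC)
  then show n: "nrm (dl x) = (1 + drad x)\<^sup>2 + (cmod (dtau x))\<^sup>2 + (dsig x)\<^sup>2"
    by (simp add: power2_eq_square algebra_simps)
  have 2: "(\<Sum>k\<in>UNIV. (cmod (dl x $ i2 $ k))\<^sup>2) = 1 + (cmod (dtau x))\<^sup>2"
  proof -
    have "(\<Sum>k\<in>P0. (cmod (dl x $ i2 $ k))\<^sup>2) = 0" by (rule sum.neutral) (auto simp: dl_def)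
    then show ?thesis unfolding sum_split by (simp add: dl_def)
  qed
  have 3: "(\<Sum>k\<in>UNIV. dl x $ i1 $ k * cnj (dl x $ i2 $ k)) = - Complex (- drad x) (dsig x) * dtau x"
  proof -
    have "(\<Sum>k\<in>P0. dl x $ i1 $ k * cnj (dl x $ i2 $ k)) = 0" by (rule sum.neutral) (auto simp: dl_def)
    then show ?thesis unfolding sum_split by (simp add: dl_def)
  qed
  have 4: "(cmod (- Complex (- drad x) (dsig x) * dtau x))\<^sup>2 = ((drad x)\<^sup>2 + (dsig x)\<^sup>2) * (cmod (dtau x))\<^sup>2"
    by (simp only: norm_mult norm_minus_cancel power_mult_distrib cC power2_minus)
  show "gram (dl x) = (1 + drad x + (cmod (dtau x))\<^sup>2)\<^sup>2 + (dsig x)\<^sup>2"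
    unfolding gram_def n 2 3 4 by (simp add: power2_eq_square algebra_simps)
qed

text \<open>An element normalising \<open>NS\<close> preserves the line of \<open>NS\<close>-fixed vectors and then the plane of
  vectors fixed modulo that line; being Hermitian it preserves their orthogonal complements too.\<close>

lemma normalizer_entries:
  assumes herm: "ctranspose a = a" and iso: "ctranspose a ** S ** a = S"
    and norm: "\<And>n. n \<in> NS \<Longrightarrow> \<exists>n'\<in>NS. n ** a = a ** n'"
  shows "i \<noteq> i1 \<Longrightarrow> a $ i $ i1 = 0" "i \<noteq> i1 \<Longrightarrow> a $ i1 $ i = 0"
    "i \<noteq> i2 \<Longrightarrow> a $ i $ i2 = 0" "i \<noteq> i2 \<Longrightarrow> a $ i2 $ i = 0"
    "a $ j1 $ b = (if b = j1 then 1 / a $ i1 $ i1 else 0)" "a $ j2 $ b = (if b = j2 then 1 / a $ i2 $ i2 else 0)"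
    "a $ b $ j1 = (if b = j1 then 1 / a $ i1 $ i1 else 0)" "a $ b $ j2 = (if b = j2 then 1 / a $ i2 $ i2 else 0)"
    "a $ i1 $ i1 \<noteq> 0" "a $ i2 $ i2 \<noteq> 0" "Im (a $ k $ k) = 0"
    "f \<in> P0 \<Longrightarrow> f' \<in> P0 \<Longrightarrow> (\<Sum>k\<in>P0. a $ f $ k * a $ k $ f') = (if f = f' then 1 else 0)"
proof -
  have h: "a $ i $ j = cnj (a $ j $ i)" for i j
    using herm by (metis ctranspose_nth)
  show Im: "Im (a $ k $ k) = 0" for k using h[of k k] by (simp add: complex_eq_iff)
  have c1: "(n ** a) $ i $ i1 = a $ i $ i1" if nN: "n \<in> NS" for n i
  proof -
    obtain n' where n': "n' \<in> NS" "n ** a = a ** n'" using norm[OF nN] by blast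
    have "(\<Sum>l\<in>UNIV. a $ i $ l * n' $ l $ i1) = (\<Sum>l\<in>UNIV. if l = i1 then a $ i $ i1 else 0)"
    proof (rule sum.cong)
      fix l
      have "lv l \<le> lv i1" by (cases l rule: index_cases) auto
      then show "a $ i $ l * n' $ l $ i1 = (if l = i1 then a $ i $ i1 else 0)" using NSD(4)[OF n'(1)] by simp
    qed simp
    then show ?thesis by (simp add: n'(2)) (simp add: matrix_matrix_mult_def)
  qed
  obtain x where x: "\<And>f. f \<in> P0 \<Longrightarrow> x $ f = (\<lambda>_. 0) f" "dtau x = 1" "\<not> rl \<Longrightarrow> dsig x = 0"
    using parameter_exists[of 1 "\<lambda>_. 0" 0] F_closed(2) by metis
  have dN: "dl x \<in> NS" for x using dl_D by (simp add: D_def)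
  have z1: "a $ j1 $ i1 = 0"
    using c1[OF dN[of x], of i2] by (simp add: matrix_matrix_mult_def sum_split) (simp add: dl_def x)
  have z2: "a $ j2 $ i1 = 0"
    using c1[OF dN[of x], of i1] by (simp add: matrix_matrix_mult_def sum_split z1) (simp add: dl_def x)
  have z3: "a $ f $ i1 = 0" if "f \<in> P0" for f
  proof -
    obtain y where y: "\<And>g. g \<in> P0 \<Longrightarrow> y $ g = (\<lambda>g. if g = f then 1 else 0) g" "dtau y = 0"
      using parameter_exists[of 0 "\<lambda>g. if g = f then 1 else 0" 0] F_closed(1) by metis
    have "(\<Sum>k\<in>P0. dl y $ i1 $ k * a $ k $ i1) = (\<Sum>k\<in>P0. if k = f then a $ f $ i1 else 0)"
      by (rule sum.cong) (auto simp: dl_def y)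
    then show ?thesis using that c1[OF dN[of y], of i1]
      by (simp add: matrix_matrix_mult_def sum_split z1 z2) (simp add: dl_def)
  qed
  have z4: "a $ i2 $ i1 = 0"
  proof -
    have "mat 1 + Er i1 i2 1 \<in> NS" by (rule eta_NS) simp
    from c1[OF this, of i1] show ?thesis
      by (simp add: matrix_matrix_mult_def sum_split z1 z2 z3) (simp add: Er_def mat_def)
  qed
  show col1: "a $ i $ i1 = 0" if "i \<noteq> i1" for i
    using that z1 z2 z3 z4 by (cases i rule: index_cases) auto
  show row1: "a $ i1 $ i = 0" if "i \<noteq> i1" for i using h[of i1 i] col1[OF that] by simp
  have c2: "(n ** a) $ i $ i2 = a $ i $ i2" if nN: "n \<in> NS" and ii: "i \<noteq> i1" for n i
  proof -
    obtain n' where n': "n' \<in> NS" "n ** a = a ** n'" using norm[OF nN] by blast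
    have "(\<Sum>l\<in>UNIV. a $ i $ l * n' $ l $ i2) = (\<Sum>l\<in>UNIV. if l = i2 then a $ i $ i2 else 0)"
    proof (rule sum.cong)
      fix l
      show "a $ i $ l * n' $ l $ i2 = (if l = i2 then a $ i $ i2 else 0)"
        using NSD(4)[OF n'(1), of l i2] col1[OF ii] by (cases l rule: index_cases) auto
    qed simp
    then show ?thesis by (simp add: n'(2)) (simp add: matrix_matrix_mult_def)
  qed
  have y1: "a $ j1 $ i2 = 0"
    using c2[OF dN[of x], of i2] by (simp add: matrix_matrix_mult_def sum_split) (simp add: dl_def x)
  \<comment> \<open>An element of \<open>NS\<close> is needed that moves the basis vector
    \<open>j2\<close> modulo the first one. It comes from the root groups of \<open>P0\<close> over
    the reals, and from the long root (i2, j2) over the complex numbers.\<close>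
  have y2: "a $ j2 $ i2 = 0"
  proof (cases rl)
    case True
    then obtain f0 where f0: "f0 \<in> P0" using rl_iff by auto
    obtain n where n: "n \<in> NS" "\<And>f. f \<in> P0 \<Longrightarrow> n $ f $ j2 = - of_real ((\<lambda>_. 1) f)"
      using zeta_exists[of "\<lambda>_. 1"] by metis
    have "(\<Sum>k\<in>P0. n $ f0 $ k * a $ k $ i2) = (\<Sum>k\<in>P0. if k = f0 then a $ f0 $ i2 else 0)"
      by (rule sum.cong) (use NSD(4)[OF n(1)] f0 in auto)
    then show ?thesis using c2[OF n(1), of f0] f0
      by (simp add: matrix_matrix_mult_def sum_split y1 n(2) NSD(4)[OF n(1)])
  next
    case False
    then have "P0 = {}" using rl_iff by simp
    then show ?thesis using c2[OF omega_NS[OF False], of i2]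
      by (simp add: matrix_matrix_mult_def sum_split y1) (simp add: Er_def mat_def)
  qed
  have y3: "a $ f $ i2 = 0" if "f \<in> P0" for f
  proof -
    obtain n where n: "n \<in> NS" "\<And>g. g \<in> P0 \<Longrightarrow> n $ i2 $ g = of_real ((\<lambda>g. if g = f then 1 else 0) g)"
      using zeta_exists[of "\<lambda>g. if g = f then 1 else 0"] by metis
    have "(\<Sum>k\<in>P0. n $ i2 $ k * a $ k $ i2) = (\<Sum>k\<in>P0. if k = f then a $ f $ i2 else 0)"
      by (rule sum.cong) (auto simp: n(2))
    then show ?thesis using c2[OF n(1), of i2] that
      by (simp add: matrix_matrix_mult_def sum_split y1 y2 NSD(4)[OF n(1)])
  qed
  have y4: "a $ i1 $ i2 = 0" by (rule row1) simp
  show col2: "a $ i $ i2 = 0" if "i \<noteq> i2" for i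
    using that y1 y2 y3 y4 by (cases i rule: index_cases) auto
  show row2: "a $ i2 $ i = 0" if "i \<noteq> i2" for i using h[of i2 i] col2[OF that] by simp
  have e: "(\<Sum>k\<in>UNIV. cnj (a $ k $ i) * a $ sw k $ j) = S $ i $ j" for i j
    using iso by (simp add: isometry_nth[symmetric])
  have cc: "cnj (a $ k $ k) = a $ k $ k" for k using Im[of k] by (simp add: complex_eq_iff)
  have e1: "a $ i1 $ i1 * a $ j1 $ j = (if j = j1 then 1 else 0)" for j
    using e[of i1 j] by (simp add: sum_split col1 cc S_nth)
  have e2: "a $ i2 $ i2 * a $ j2 $ j = (if j = j2 then 1 else 0)" for j
    using e[of i2 j] by (simp add: sum_split col2 cc S_nth)
  show nz: "a $ i1 $ i1 \<noteq> 0" "a $ i2 $ i2 \<noteq> 0" using e1[of j1] e2[of j2] by auto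
  show r: "a $ j1 $ b = (if b = j1 then 1 / a $ i1 $ i1 else 0)" "a $ j2 $ b = (if b = j2 then 1 / a $ i2 $ i2 else 0)" for b
    using e1[of b] e2[of b] nz by (auto simp: field_simps split: if_splits)
  show c: "a $ b $ j1 = (if b = j1 then 1 / a $ i1 $ i1 else 0)" "a $ b $ j2 = (if b = j2 then 1 / a $ i2 $ i2 else 0)" for b
    using h[of b j1] h[of b j2] by (simp_all add: r cc)
  show "(\<Sum>k\<in>P0. a $ f $ k * a $ k $ f') = (if f = f' then 1 else 0)" if "f \<in> P0" "f' \<in> P0" for f f'
  proof -
    have "(\<Sum>k\<in>P0. cnj (a $ k $ f) * a $ sw k $ f') = (\<Sum>k\<in>P0. a $ f $ k * a $ k $ f')"
      by (rule sum.cong) (auto simp: h[of f])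
    then show ?thesis using e[of f f'] that by (auto simp add: sum_split row1 row2 r S_nth)
  qed
qed

text \<open>If \<open>a\<^sup>2 = 1\<close> then \<open>X = a - 1\<close> satisfies \<open>X\<^sup>2 = - 2 X\<close>: the identity is isolated among involutions.\<close>

lemma involution_isolated:
  fixes X :: "'m \<Rightarrow> 'm \<Rightarrow> complex"
  assumes sq: "\<And>i j. i \<in> P0 \<Longrightarrow> j \<in> P0 \<Longrightarrow> (\<Sum>k\<in>P0. X i k * X k j) = - 2 * X i j"
    and small: "\<And>i j. i \<in> P0 \<Longrightarrow> j \<in> P0 \<Longrightarrow> cmod (X i j) < 1 / real (card P0 + 1)"
    and ij: "i \<in> P0" "j \<in> P0"
  shows "X i j = 0"
proof -
  let ?n = "real (card P0)"
  define M where "M = Max ((\<lambda>(i, j). cmod (X i j)) ` (P0 \<times> P0))"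
  have fin: "finite ((\<lambda>(i, j). cmod (X i j)) ` (P0 \<times> P0))" by simp
  have ne: "(\<lambda>(i, j). cmod (X i j)) ` (P0 \<times> P0) \<noteq> {}" using ij by auto
  have le: "cmod (X a b) \<le> M" if "a \<in> P0" "b \<in> P0" for a b
    unfolding M_def using fin that by (intro Max_ge) auto
  have "M \<in> (\<lambda>(i, j). cmod (X i j)) ` (P0 \<times> P0)" unfolding M_def by (rule Max_in[OF fin ne])
  then obtain a b where ab: "a \<in> P0" "b \<in> P0" "M = cmod (X a b)" by auto
  have M0: "M \<ge> 0" using ab by simp
  \<comment> \<open>At the largest entry this yields 2 M \<le> n M^2 \<le> M, since the smallness
    bound gives n M \<le> 1.\<close>
  have "2 * M = cmod (\<Sum>k\<in>P0. X a k * X k b)" using ab sq by (simp add: norm_mult)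
  also have "\<dots> \<le> (\<Sum>k\<in>P0. M * M)"
    by (rule order_trans[OF norm_sum sum_mono]) (auto simp: norm_mult intro!: mult_mono le ab M0)
  also have "\<dots> = ?n * M * M" by simp
  also have "\<dots> \<le> 1 * M"
  proof (rule mult_right_mono[OF _ M0])
    have "M < 1 / (?n + 1)" using small[OF ab(1,2)] ab(3) by (simp add: add.commute)
    then have "M * (?n + 1) < 1" by (simp add: field_simps)
    then show "?n * M \<le> 1" using M0 by (simp add: algebra_simps)
  qed
  finally have "M = 0" using M0 by simp
  then show ?thesis using le[OF ij] by simp
qed

lemma connected_positive:
  fixes \<phi> :: "'a::topological_space \<Rightarrow> real"
  assumes "connected A" "continuous_on A \<phi>" "\<And>a. a \<in> A \<Longrightarrow> \<phi> a \<noteq> 0" "a0 \<in> A" "\<phi> a0 > 0" "a \<in> A"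
  shows "\<phi> a > 0"
proof (rule ccontr)
  assume "\<not> \<phi> a > 0"
  then have "\<phi> a \<le> 0" by simp
  moreover have "connected (\<phi> ` A)" using assms by (intro connected_continuous_image)
  ultimately have "0 \<in> \<phi> ` A" using assms connectedD_interval[of "\<phi> ` A" "\<phi> a" "\<phi> a0" 0] by auto
  then show False using assms(3) by auto
qed

text \<open>On the \<open>P0\<close> block an element of \<open>A\<close> is an involution. The
  elements whose block is the identity form a closed subset, open by
  \<open>involution_isolated\<close>, hence all of the connected set \<open>A\<close>. Connectedness
  also fixes the signs of the entries at \<open>i1\<close> and \<open>i2\<close>.\<close>

lemma connected_normalizer_diagonal:
  assumes conn: "connected A" and one: "mat 1 \<in> A"
    and herm: "\<And>a. a \<in> A \<Longrightarrow> ctranspose a = a" and iso: "\<And>a. a \<in> A \<Longrightarrow> ctranspose a ** S ** a = S"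
    and norm: "\<And>a n. a \<in> A \<Longrightarrow> n \<in> NS \<Longrightarrow> \<exists>n'\<in>NS. n ** a = a ** n'"
    and a: "a \<in> A"
  obtains p q where "p > 0" "q > 0" "a = dg p q"
proof -
  note ent = normalizer_entries[OF herm iso norm]
  have cont: "continuous_on B (\<lambda>a :: complex^'m^'m. a $ i $ j)" for B i j
    by (intro continuous_on_component continuous_on_id)
  let ?p = "\<lambda>a :: complex^'m^'m. Re (a $ i1 $ i1)" and ?q = "\<lambda>a :: complex^'m^'m. Re (a $ i2 $ i2)"
  have nz: "?p a \<noteq> 0" "?q a \<noteq> 0" if "a \<in> A" for a
    using ent(9,10)[OF that that that] ent(11)[OF that that that, of i1] ent(11)[OF that that that, of i2]
    by (auto simp: complex_eq_iff)
  have pos1: "?p (mat 1) > 0" "?q (mat 1) > 0" by (simp_all add: mat_def)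
  have contR: "continuous_on A ?p" "continuous_on A ?q" by (intro continuous_on_Re cont)+
  have p: "?p a > 0" by (rule connected_positive[OF conn contR(1) nz(1) one pos1(1) a])
  have q: "?q a > 0" by (rule connected_positive[OF conn contR(2) nz(2) one pos1(2) a])
  let ?\<delta> = "1 / real (card P0 + 1)"
  let ?X = "\<lambda>a i j. a $ i $ j - (if i = j then 1 else (0::complex))"
  define U where "U = {a\<in>A. \<forall>i\<in>P0. \<forall>j\<in>P0. ?X a i j = 0}"
  have U2: "U = {a\<in>A. \<forall>i\<in>P0. \<forall>j\<in>P0. cmod (?X a i j) < ?\<delta>}"
  proof -
    have "?X a i j = 0" if aA: "a \<in> A" and small: "\<forall>i\<in>P0. \<forall>j\<in>P0. cmod (?X a i j) < ?\<delta>" and ij: "i \<in> P0" "j \<in> P0" for a i j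
    proof (rule involution_isolated[where X = "?X a"])
      fix i j assume ij: "i \<in> P0" "j \<in> P0"
      have "(\<Sum>k\<in>P0. ?X a i k * ?X a k j) = (\<Sum>k\<in>P0. a $ i $ k * a $ k $ j - (if k = j then a $ i $ j else 0) - (if k = i then a $ i $ j else 0) + (if k = i then (if i = j then 1 else 0) else 0))"
        by (rule sum.cong) (auto simp: algebra_simps)
      also have "\<dots> = - 2 * ?X a i j"
        using ij by (simp add: sum.distrib sum_subtractf ent(12)[OF aA aA aA])
      finally show "(\<Sum>k\<in>P0. ?X a i k * ?X a k j) = - 2 * ?X a i j" .
    qed (use small ij in auto)
    then have "a \<in> A \<and> (\<forall>i\<in>P0. \<forall>j\<in>P0. ?X a i j = 0) \<longleftrightarrow> a \<in> A \<and> (\<forall>i\<in>P0. \<forall>j\<in>P0. cmod (?X a i j) < ?\<delta>)" for a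
      by (metis norm_zero divide_pos_pos of_nat_0_less_iff zero_less_one add_gr_0)
    then show ?thesis unfolding U_def by blast
  qed
  have "openin (top_of_set A) U"
  proof -
    have "open {a :: complex^'m^'m. \<forall>i\<in>P0. \<forall>j\<in>P0. cmod (?X a i j) < ?\<delta>}"
    proof -
      have "{a :: complex^'m^'m. \<forall>i\<in>P0. \<forall>j\<in>P0. cmod (?X a i j) < ?\<delta>} = (\<Inter>i\<in>P0. \<Inter>j\<in>P0. {a. cmod (?X a i j) < ?\<delta>})" by blast
      moreover have "open {a :: complex^'m^'m. cmod (?X a i j) < ?\<delta>}" for i j
        by (intro open_Collect_less continuous_intros cont)
      ultimately show ?thesis by (simp add: open_INT)
    qed
    moreover have "U = A \<inter> {a. \<forall>i\<in>P0. \<forall>j\<in>P0. cmod (?X a i j) < ?\<delta>}" unfolding U2 by blast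
    ultimately show ?thesis using openin_open by blast
  qed
  moreover have "closedin (top_of_set A) U"
  proof -
    have "closed {a :: complex^'m^'m. \<forall>i\<in>P0. \<forall>j\<in>P0. ?X a i j = 0}"
    proof -
      have "{a :: complex^'m^'m. \<forall>i\<in>P0. \<forall>j\<in>P0. ?X a i j = 0} = (\<Inter>i\<in>P0. \<Inter>j\<in>P0. {a. ?X a i j = 0})" by auto
      moreover have "closed {a :: complex^'m^'m. ?X a i j = 0}" for i j
        by (intro closed_Collect_eq continuous_intros cont)
      ultimately show ?thesis by (simp add: closed_INT)
    qed
    moreover have "U = A \<inter> {a. \<forall>i\<in>P0. \<forall>j\<in>P0. ?X a i j = 0}" unfolding U_def by auto
    ultimately show ?thesis using closedin_closed by blast
  qed
  moreover have "mat 1 \<in> U" using one by (auto simp: U_def mat_def)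
  ultimately have "U = A" using conn unfolding connected_clopen by blast
  with a have "a \<in> U" by simp
  then have P0: "a $ i $ j = (if i = j then 1 else 0)" if "i \<in> P0" "j \<in> P0" for i j
    using that unfolding U_def by simp
  note ent = ent[OF a a a]
  define r where "r = ?p a"
  define s where "s = ?q a"
  have re: "a $ i1 $ i1 = of_real r" "a $ i2 $ i2 = of_real s" using ent(11) by (simp_all add: complex_eq_iff r_def s_def)
  have "a $ i $ j = dg r s $ i $ j" for i j
    by (cases i rule: index_cases; cases j rule: index_cases)
      (simp_all add: ent(1-8) P0 dg_def diagm_def re)
  then have "a = dg r s" by (simp add: vec_eq_iff)
  with p q show ?thesis using that unfolding r_def s_def by blast
qed

text \<open>The value of \<open>rho\<close> as a function of the group element instead of its
  Iwasawa component, hence visibly continuous and therefore measurable.\<close>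

definition rhog :: "complex^'m^'m \<Rightarrow> real" where
  "rhog g = (if rl then sqrt (nrm g * sqrt (gram g) ^ card P0) else nrm g * sqrt (gram g))"

lemma rho_rhog:
  assumes "p > 0" "q > 0" "nrm g = p\<^sup>2" "gram g = (p * q)\<^sup>2"
  shows "rho p q = rhog g"
  using assms by (simp add: rho_def rhog_def)

text \<open>Both cases reduce to \<open>rho_lower_bound\<close> with the roles of \<open>nrm\<close>
  and \<open>gram\<close> exchanged. Over the reals r is \<open>drad\<close> and t is
  \<open>dtau\<close>; over the complex numbers r is the squared modulus of \<open>dtau\<close>, so
  n = 2, and t is \<open>dsig\<close>.\<close>

lemma rhog_lower:
  "\<exists>\<epsilon>>0. \<forall>x. (\<Prod>i\<in>Ix. mag (x $ i)) powr (1 + \<epsilon>) \<le> rhog (dl x)"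
proof (cases rl)
  case True
  then have c: "card P0 \<ge> 1" using rl_iff by (simp add: Suc_le_eq card_gt_0_iff)
  show ?thesis
  proof (intro exI[of _ "1 / (4 * real (card P0))"] conjI allI)
    fix x :: "real^'m"
    define r where "r = drad x"
    define t where "t = x $ i2"
    have r0: "r \<ge> 0" by (simp add: r_def drad_def sum_nonneg)
    have tau: "(cmod (dtau x))\<^sup>2 = t\<^sup>2" using True by (simp add: dtau_def t_def)
    have sig: "dsig x = 0" using True by (simp add: dsig_def)
    have "(\<Prod>i\<in>Ix. mag (x $ i)) = (\<Prod>i\<in>P0. mag (x $ i)) * mag t"
      using True by (simp add: Ix_def t_def)
    moreover have "((\<Prod>i\<in>P0. mag (x $ i)) * mag t) powr (1 + 1 / (4 * real (card P0))) \<le>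
        sqrt ((1 + r)\<^sup>2 + t\<^sup>2) * (1 + r + t\<^sup>2) powr (real (card P0) / 2)"
      by (rule rho_lower_bound) (use c in \<open>simp_all add: r_def drad_def\<close>)
    moreover have "rhog (dl x) = sqrt ((1 + r)\<^sup>2 + t\<^sup>2) * (1 + r + t\<^sup>2) powr (real (card P0) / 2)"
    proof -
      have pos: "1 + r + t\<^sup>2 > 0" using r0 by (simp add: add_pos_nonneg)
      have "sqrt ((1 + r + t\<^sup>2) ^ card P0) = (1 + r + t\<^sup>2) powr (real (card P0) / 2)"
        using pos by (simp add: powr_half_sqrt[symmetric] powr_powr flip: powr_realpow)
      then show ?thesis using True pos
        by (simp add: rhog_def dl_rows tau sig r_def[symmetric] real_sqrt_mult)
    qed
    ultimately show "(\<Prod>i\<in>Ix. mag (x $ i)) powr (1 + 1 / (4 * real (card P0))) \<le> rhog (dl x)" by simp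
  qed (use c in simp)
next
  case False
  then have P0: "P0 = {}" using rl_iff by simp
  show ?thesis
  proof (intro exI[of _ "1 / (4 * real (card {i1, i2}))"] conjI allI)
    fix x :: "real^'m"
    define r where "r = (x $ i1)\<^sup>2 + (x $ i2)\<^sup>2"
    define t where "t = x $ j2"
    have r0: "r \<ge> 0" by (simp add: r_def)
    have tau: "(cmod (dtau x))\<^sup>2 = r" using False by (simp add: dtau_def r_def cmod_power2)
    have sig: "dsig x = t" using False by (simp add: dsig_def t_def)
    have rad: "drad x = 0" by (simp add: drad_def P0)
    have "(\<Prod>i\<in>Ix. mag (x $ i)) = (\<Prod>i\<in>{i1, i2}. mag (x $ i)) * mag t"
      using False by (simp add: Ix_def t_def)
    moreover have "((\<Prod>i\<in>{i1, i2}. mag (x $ i)) * mag t) powr (1 + 1 / (4 * real (card {i1, i2}))) \<le>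
        sqrt ((1 + r)\<^sup>2 + t\<^sup>2) * (1 + r + t\<^sup>2) powr (real (card {i1, i2}) / 2)"
      by (rule rho_lower_bound) (simp_all add: r_def)
    moreover have "rhog (dl x) = sqrt ((1 + r)\<^sup>2 + t\<^sup>2) * (1 + r + t\<^sup>2) powr (real (card {i1, i2}) / 2)"
    proof -
      have "1 + r + t\<^sup>2 > 0" using r0 by (simp add: add_pos_nonneg)
      then show ?thesis using False by (simp add: rhog_def dl_rows tau sig rad)
    qed
    ultimately show "(\<Prod>i\<in>Ix. mag (x $ i)) powr (1 + 1 / (4 * real (card {i1, i2}))) \<le> rhog (dl x)" by simp
  qed simp
qed

section \<open>Integration over the commutator subgroup\<close>

lemma continuous_dl: "continuous_on A dl"
proof -
  have "continuous_on A (\<lambda>x. dl x $ i $ j)" for i j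
  proof (cases "i = j")
    case True
    then show ?thesis by (simp add: dl_def)
  next
    case False
    have tau: "continuous_on A dtau"
      by (cases rl) (auto simp: dtau_def[abs_def] Complex_eq intro!: continuous_intros)
    have sig: "continuous_on A (\<lambda>x. Complex (- drad x) (dsig x))"
      by (cases rl) (auto simp: dsig_def drad_def Complex_eq intro!: continuous_intros)
    show ?thesis using False
      by (cases i rule: index_cases; cases j rule: index_cases)
        (auto simp: dl_def intro!: continuous_intros tau sig)
  qed
  then have "continuous_on A (\<lambda>x. \<chi> i j. dl x $ i $ j)" by (intro continuous_on_vec_lambda)
  then show ?thesis by simp
qed

lemma continuous_rhog: "continuous_on A rhog"
proof -
  have c: "continuous_on A (\<lambda>a :: complex^'m^'m. a $ i $ j)" for i j
    by (intro continuous_on_component continuous_on_id)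
  have n: "continuous_on A nrm" unfolding nrm_def[abs_def] by (intro continuous_intros c)
  have g: "continuous_on A gram" unfolding gram_def[abs_def] by (intro continuous_intros c n)
  show ?thesis unfolding rhog_def[abs_def] by (cases rl) (auto intro!: continuous_intros n g)
qed

lemma haar_integrable:
  assumes b: "invertible (b :: complex^'m^'m)" and M: "haar_measure ((\<lambda>g. b ** g ** matrix_inv b) ` D) M" and d: "d > 0"
    and f: "\<And>g. g \<in> D \<Longrightarrow> f (b ** g ** matrix_inv b) = inverse (rhog g) * (1 + ln (rhog g)) powr d"
  shows "integrable M f"
proof -
  let ?c = "\<lambda>g. b ** g ** matrix_inv b"
  let ?H = "?c ` D"
  have bb: "matrix_inv b ** b = mat 1" "b ** matrix_inv b = mat 1" using matrix_inv_mult[OF b] by auto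
  have cm: "?c X ** ?c Y = ?c (X ** Y)" for X Y by (metis bb(1) matrix_mul_assoc matrix_mul_rid)
  have setsM: "sets M = sets (restrict_space borel ?H)"
    and inv: "\<And>h B. h \<in> ?H \<Longrightarrow> B \<in> sets M \<Longrightarrow> emeasure M ((\<lambda>x. h ** x) ` B) = emeasure M B"
    and cpt: "\<And>C. compact C \<Longrightarrow> C \<subseteq> ?H \<Longrightarrow> emeasure M C < \<infinity>"
    using M unfolding haar_measure_def by auto
  have spM: "space M = ?H" using sets_eq_imp_space_eq[OF setsM] by (simp add: space_restrict_space)
  obtain \<epsilon> where \<epsilon>: "\<epsilon> > 0" "\<And>x. (\<Prod>i\<in>Ix. mag (x $ i)) powr (1 + \<epsilon>) \<le> rhog (dl x)" using rhog_lower by blast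
  \<comment> \<open>Chosen so that every coordinate keeps the exponent 1 + \<epsilon> / 2 after the
    logarithm has cost a power \<delta> of the density.\<close>
  define \<delta> where "\<delta> = \<epsilon> / (2 * (1 + \<epsilon>))"
  have \<delta>: "\<delta> > 0" "\<delta> < 1" "(1 + \<epsilon>) * (1 - \<delta>) = 1 + \<epsilon> / 2" using \<epsilon>(1) by (auto simp: \<delta>_def field_simps)
  obtain K where K: "K > 0" "\<And>x. x \<ge> 1 \<Longrightarrow> (1 + ln x) powr d \<le> K * x powr \<delta>" using log_power_bound[OF \<delta>(1) d] by blast
  let ?s = "1 + \<epsilon> / 2"
  have prod1: "(\<Prod>i\<in>Ix. mag (x $ i)) \<ge> 1" for x :: "real^'m" by (intro prod_ge_1) (simp add: mag_ge_1)
  have rho1: "rhog (dl x) \<ge> 1" for x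
    using \<epsilon>(2)[of x] ge_one_powr_ge_zero[OF prod1[of x], of "1 + \<epsilon>"] \<epsilon>(1) by simp
  have fdl: "f (?c (dl x)) = inverse (rhog (dl x)) * (1 + ln (rhog (dl x))) powr d" for x by (rule f[OF dl_D])
  have f0: "0 \<le> f (?c (dl x))" for x unfolding fdl using rho1[of x] by simp
  have fb: "f (?c (dl x)) \<le> K * (\<Prod>i\<in>Ix. mag (x $ i) powr - ?s)" for x
  proof -
    let ?r = "rhog (dl x)"
    have "f (?c (dl x)) \<le> inverse ?r * (K * ?r powr \<delta>)"
      unfolding fdl using K(2)[OF rho1[of x]] rho1[of x] by (intro mult_left_mono) auto
    also have "\<dots> = K * ?r powr - (1 - \<delta>)"
      using rho1[of x] by (simp add: powr_diff powr_minus divide_inverse powr_one)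
    also have "\<dots> \<le> K * ((\<Prod>i\<in>Ix. mag (x $ i)) powr (1 + \<epsilon>)) powr - (1 - \<delta>)"
    proof -
      have "0 < (\<Prod>i\<in>Ix. mag (x $ i)) powr (1 + \<epsilon>)"
        unfolding powr_gt_zero using prod1[of x] by linarith
      then show ?thesis using \<epsilon>(2)[of x] K(1) \<delta> by (intro mult_left_mono powr_mono2') auto
    qed
    also have "\<dots> = K * (\<Prod>i\<in>Ix. mag (x $ i)) powr - ?s"
      unfolding powr_powr mult_minus_right \<delta>(3) ..
    also have "\<dots> = K * (\<Prod>i\<in>Ix. mag (x $ i) powr - ?s)"
      using mag_ge_1 by (subst prod_powr_distrib) (auto intro: order_trans[OF zero_le_one])
    finally show ?thesis .
  qed
  define vk :: "('m \<Rightarrow> int) \<Rightarrow> real^'m" where "vk k = (\<chi> i. if i \<in> Ix then of_int (k i) else 0)" for k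
  \<comment> \<open>The cube is degenerate in the coordinates outside \<open>Ix\<close>, matching
    the normalisation in \<open>D_range\<close>.\<close>
  define Q :: "(real^'m) set" where "Q = cbox 0 (\<chi> i. if i \<in> Ix then 1 else 0)"
  define E where "E k = (\<lambda>y. ?c (dl (vk k + y))) ` Q" for k
  let ?o = "\<lambda>_::'m. 0::int"
  have vk0: "vk ?o = 0" by (simp add: vk_def vec_eq_iff)
  have EH: "E k \<subseteq> ?H" for k unfolding E_def using dl_D by auto
  have Ecpt: "compact (E k)" for k
    unfolding E_def
  proof (rule compact_continuous_image)
    have "continuous_on UNIV ?c" using linear_conj linear_conv_bounded_linear by (metis linear_continuous_on)
    then show "continuous_on Q (\<lambda>y. ?c (dl (vk k + y)))"
      by (rule continuous_on_compose2[of UNIV ?c]) (auto intro!: continuous_on_compose2[OF continuous_dl] continuous_intros)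
    show "compact Q" by (simp add: Q_def)
  qed
  have Esets: "E k \<in> sets M" for k
  proof -
    have "E k \<in> sets borel" using Ecpt by (simp add: compact_imp_closed)
    then show ?thesis unfolding setsM sets_restrict_space using EH[of k] by (auto intro!: image_eqI[of _ _ "E k"])
  qed
  \<comment> \<open>As \<open>dl\<close> is a homomorphism, every cell is a left translate of the
    cell at 0, so invariance bounds all their measures by one finite number.\<close>
  have Eshift: "E k = (\<lambda>x. ?c (dl (vk k)) ** x) ` E ?o" for k
    unfolding E_def image_image cm dl_add vk0 by simp
  have EB: "emeasure M (E k) \<le> emeasure M (E ?o)" for k
    unfolding Eshift[of k] using inv[of "?c (dl (vk k))" "E ?o"] dl_D Esets by simp
  show ?thesis
  proof (rule integrable_lattice_cover[where I = Ix and E = E and B = "emeasure M (E ?o)" and C = K and c = "\<lambda>k. (max 1 (\<bar>real_of_int k\<bar> / 2)) powr - ?s"])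
    show "finite Ix" by simp
    show "emeasure M (E ?o) < \<infinity>" by (rule cpt[OF Ecpt EH])
    show "E k \<in> sets M" "emeasure M (E k) \<le> emeasure M (E ?o)" for k by (rule Esets, rule EB)
    show "Infinite_Set_Sum.abs_summable_on (\<lambda>k. (max 1 (\<bar>real_of_int k\<bar> / 2)) powr - ?s) UNIV"
      using \<epsilon>(1) by (intro int_powr_summable) simp
    show "0 \<le> K" using K by simp
    show "0 \<le> (max 1 (\<bar>real_of_int k\<bar> / 2)) powr - ?s" for k by simp
    show "0 \<le> f x" if "x \<in> space M" for x
      using that f0 unfolding spM D_eq by auto
    show "\<exists>k\<in>PiE Ix (\<lambda>_. UNIV). x \<in> E k" if "x \<in> space M" for x
    proof -
      from that obtain g where g: "g \<in> D" "x = ?c g" unfolding spM by auto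
      obtain w where w: "g = dl w" "\<And>k. k \<notin> Ix \<Longrightarrow> w $ k = 0" using D_range[OF g(1)] by blast
      let ?k = "restrict (\<lambda>i. \<lfloor>w $ i\<rfloor>) Ix"
      have "w - vk ?k \<in> Q"
        unfolding Q_def mem_box_cart by (auto simp: vk_def w(2) floor_le_iff) linarith
      moreover have "x = ?c (dl (vk ?k + (w - vk ?k)))" by (simp add: g w)
      ultimately have "x \<in> E ?k" unfolding E_def by blast
      then show ?thesis by (intro bexI[of _ ?k]) auto
    qed
    show "f x \<le> K * (\<Prod>i\<in>Ix. (max 1 (\<bar>real_of_int (k i)\<bar> / 2)) powr - ?s)"
      if "x \<in> E k" for k x
    proof -
      from that obtain y where y: "y \<in> Q" "x = ?c (dl (vk k + y))" unfolding E_def by auto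
      have y01: "0 \<le> y $ i" "y $ i \<le> 1" if "i \<in> Ix" for i
        using y(1) that unfolding Q_def mem_box_cart by (auto dest!: spec[of _ i])
      have "f x \<le> K * (\<Prod>i\<in>Ix. mag ((vk k + y) $ i) powr - ?s)" unfolding y(2) by (rule fb)
      also have "\<dots> \<le> K * (\<Prod>i\<in>Ix. (max 1 (\<bar>real_of_int (k i)\<bar> / 2)) powr - ?s)"
      proof (intro mult_left_mono prod_mono conjI)
        fix i assume i: "i \<in> Ix"
        have "max 1 (\<bar>real_of_int (k i)\<bar> / 2) \<le> mag ((vk k + y) $ i)"
          using mag_shift[OF y01[OF i]] i by (simp add: vk_def)
        then show "mag ((vk k + y) $ i) powr - ?s \<le> (max 1 (\<bar>real_of_int (k i)\<bar> / 2)) powr - ?s"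
          using \<epsilon>(1) by (intro powr_mono2') auto
      qed (use K in auto)
      finally show ?thesis .
    qed
    \<comment> \<open>On the group, \<open>f\<close> agrees with a Borel function defined on all
      matrices.\<close>
    show "f \<in> borel_measurable M"
    proof -
      let ?u = "\<lambda>x. matrix_inv b ** x ** b"
      have cu: "continuous_on UNIV ?u" using linear_conj linear_conv_bounded_linear by (metis linear_continuous_on)
      have "continuous_on UNIV (\<lambda>x. rhog (?u x))"
        by (rule continuous_on_compose2[OF continuous_rhog cu]) auto
      then have r: "(\<lambda>x. rhog (?u x)) \<in> borel_measurable borel" by (rule borel_measurable_continuous_onI)
      have "(\<lambda>x. inverse (rhog (?u x)) * (1 + ln (rhog (?u x))) powr d) \<in> borel_measurable borel"
        using r by measurable
      then have "(\<lambda>x. inverse (rhog (?u x)) * (1 + ln (rhog (?u x))) powr d) \<in> borel_measurable M"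
        unfolding measurable_cong_sets[OF setsM refl] by (rule measurable_restrict_space1)
      moreover have "f x = inverse (rhog (?u x)) * (1 + ln (rhog (?u x))) powr d" if "x \<in> space M" for x
      proof -
        from that obtain g where g: "g \<in> D" "x = ?c g" unfolding spM by auto
        have "?u x = g" unfolding g(2) by (metis bb(1) matrix_mul_assoc matrix_mul_lid matrix_mul_rid)
        then show ?thesis using f[OF g(1)] g(2) by simp
      qed
      ultimately show ?thesis by (simp cong: measurable_cong)
    qed
  qed
qed

end

section \<open>Indefinite special orthogonal and unitary groups\<close>

text \<open>The form will be negative exactly at \<open>q1\<close> and \<open>q2\<close>. The bound
  5 in the real case is n \<ge> 1 for SO(n+2,2); it makes the block \<open>P0\<close> of
  \<open>split_frame\<close> nonempty.\<close>

locale sig_form =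
  fixes q1 q2 :: "'m::finite" and F :: "complex set"
  assumes q12: "q1 \<noteq> q2" and F_cases: "F = \<real> \<and> CARD('m) \<ge> 5 \<or> F = UNIV \<and> CARD('m) = 4"

sublocale sig_form \<subseteq> real_or_complex F
  by unfold_locales (use F_cases in auto)

context sig_form
begin

definition sg :: "'m \<Rightarrow> real" where "sg k = (if k = q1 \<or> k = q2 then - 1 else 1)"

definition I :: "complex^'m^'m" where "I = diagm (\<lambda>i. of_real (sg i))"

definition G :: "(complex^'m^'m) set" where
  "G = {g. (\<forall>i j. g $ i $ j \<in> F) \<and> ctranspose g ** I ** g = I \<and> det g = 1}"

definition hf :: "complex^'m \<Rightarrow> complex^'m \<Rightarrow> complex" where
  "hf x y = (\<Sum>k\<in>UNIV. cnj (x $ k) * (of_real (sg k) * y $ k))"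

definition VF :: "(complex^'m) set" where "VF = {v. \<forall>k. v $ k \<in> F}"

lemma card4: "CARD('m) \<ge> 4" using F_cases by auto

lemma sg_sq [simp]: "sg k * sg k = 1" by (simp add: sg_def)

lemma I_mult_nth [simp]: "(I ** g) $ i $ j = of_real (sg i) * g $ i $ j"
  by (simp add: I_def diagm_mult_nth)

lemma mult_I_nth [simp]: "(g ** I) $ i $ j = of_real (sg j) * g $ i $ j"
  by (simp add: I_def mult_diagm_nth)

lemma I_vec_nth [simp]: "(I *v x) $ i = of_real (sg i) * x $ i"
  by (simp add: I_def diagm_def matrix_vector_mult_def if_distrib[of "\<lambda>a. a * _"] cong: if_cong)

lemma I_I: "I ** I = mat 1"
  by (simp add: vec_eq_iff) (simp add: I_def diagm_def mat_def flip: of_real_mult)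

lemma I_I_cancel: "I ** (I ** g) = g" "g ** I ** I = g"
  by (simp add: matrix_mul_assoc I_I) (simp add: matrix_mul_assoc[symmetric] I_I)

lemma ctranspose_I: "ctranspose I = I"
  by (auto simp: vec_eq_iff I_def diagm_def)

lemma ctranspose_vec: "(\<Sum>k\<in>UNIV. cnj ((g *v x) $ k) * y $ k) = (\<Sum>k\<in>UNIV. cnj (x $ k) * (ctranspose g *v y) $ k)"
  for x y :: "complex^'m"
proof -
  have "(\<Sum>k\<in>UNIV. cnj ((g *v x) $ k) * y $ k) = (\<Sum>k\<in>UNIV. \<Sum>l\<in>UNIV. cnj (g $ k $ l) * cnj (x $ l) * y $ k)"
    by (simp add: matrix_vector_mult_def sum_distrib_right)
  also have "\<dots> = (\<Sum>l\<in>UNIV. \<Sum>k\<in>UNIV. cnj (g $ k $ l) * cnj (x $ l) * y $ k)" by (rule sum.swap)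
  finally show ?thesis by (simp add: matrix_vector_mult_def sum_distrib_left mult_ac)
qed

lemma hf_I: "hf x y = (\<Sum>k\<in>UNIV. cnj (x $ k) * (I *v y) $ k)"
  by (simp add: hf_def)

lemma G_I: "g \<in> G \<Longrightarrow> ctranspose g ** I ** g = I" by (simp add: G_def)

lemma G_inverse:
  assumes "g \<in> G"
  shows "(I ** ctranspose g ** I) ** g = mat 1" "g ** (I ** ctranspose g ** I) = mat 1"
    "invertible g" "matrix_inv g = I ** ctranspose g ** I" "matrix_inv g \<in> G"
proof -
  have "(I ** ctranspose g ** I) ** g = I ** (ctranspose g ** I ** g)" by (simp add: matrix_mul_assoc)
  then show 1: "(I ** ctranspose g ** I) ** g = mat 1" by (simp add: G_I[OF assms] I_I)
  then show 2: "g ** (I ** ctranspose g ** I) = mat 1" by (simp add: matrix_left_right_inverse)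
  show "invertible g" using 1 2 invertible_def by blast
  show eq: "matrix_inv g = I ** ctranspose g ** I" by (rule matrix_inv_eqI(1)[OF 2])
  have "ctranspose (matrix_inv g) ** I ** matrix_inv g = I ** (g ** (I ** ctranspose g ** I))"
    by (simp add: eq ctranspose_mult ctranspose_I matrix_mul_assoc I_I_cancel)
  then have "ctranspose (matrix_inv g) ** I ** matrix_inv g = I" by (simp add: 2)
  moreover have "det (matrix_inv g) = 1"
  proof -
    have "det (matrix_inv g) * det g = 1" using 1 by (simp add: eq det_mul[symmetric])
    then show ?thesis using assms by (simp add: G_def)
  qed
  moreover have "matrix_inv g $ i $ j \<in> F" for i j using assms by (simp add: eq G_def)
  ultimately show "matrix_inv g \<in> G" by (simp add: G_def)
qed

lemma G_mult: "g \<in> G \<Longrightarrow> h \<in> G \<Longrightarrow> g ** h \<in> G"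
proof -
  assume g: "g \<in> G" and h: "h \<in> G"
  have "ctranspose (g ** h) ** I ** (g ** h) = ctranspose h ** (ctranspose g ** I ** g) ** h"
    by (simp add: ctranspose_mult matrix_mul_assoc)
  moreover have "(g ** h) $ i $ j \<in> F" for i j
    using g h by (intro matrix_mult_F) (auto simp: G_def)
  ultimately show ?thesis using g h by (simp add: G_def det_mul)
qed

lemma one_G: "mat 1 \<in> G"
proof -
  have "(mat 1 :: complex^'m^'m) $ i $ j \<in> F" for i j by (simp add: mat_def)
  then show ?thesis by (simp add: G_def)
qed

lemma subgroup_G: "subgroup G GL"
  by (rule group.subgroupI[OF group_GL]) (use one_G G_inverse(3,5) G_mult in \<open>auto simp: inv_GL\<close>)

lemma hf_G: "g \<in> G \<Longrightarrow> hf (g *v x) (g *v y) = hf x y"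
  unfolding hf_I ctranspose_vec matrix_vector_mul_assoc by (simp add: G_I matrix_mul_assoc)

lemma hf_sesq:
  "hf (x + y) z = hf x z + hf y z" "hf x (y + z) = hf x y + hf x z"
  "hf (x - y) z = hf x z - hf y z" "hf x (y - z) = hf x y - hf x z"
  "hf (c *s x) y = cnj c * hf x y" "hf x (c *s y) = c * hf x y"
  "hf (r *\<^sub>R x) y = of_real r * hf x y" "hf x (r *\<^sub>R y) = of_real r * hf x y" "hf 0 y = 0" "hf x 0 = 0"
  by (simp_all add: hf_def algebra_simps sum.distrib sum_subtractf sum_distrib_left scaleR_complex)

lemma hf_cnj: "cnj (hf x y) = hf y x"
  by (simp add: hf_def mult_ac)

lemma Re_hf_sym: "Re (hf x y) = Re (hf y x)"
  by (subst hf_cnj[symmetric]) simp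

lemma hf_real: "hf x x = of_real (Re (hf x x))"
  using hf_cnj[of x x] by (simp add: complex_eq_iff)

lemma hf_F: "x \<in> VF \<Longrightarrow> y \<in> VF \<Longrightarrow> hf x y \<in> F"
  unfolding hf_def VF_def by (auto intro!: F_sum)

lemma VF_closed [intro]:
  "x \<in> VF \<Longrightarrow> y \<in> VF \<Longrightarrow> x + y \<in> VF" "x \<in> VF \<Longrightarrow> y \<in> VF \<Longrightarrow> x - y \<in> VF" "c \<in> F \<Longrightarrow> x \<in> VF \<Longrightarrow> c *s x \<in> VF"
  "x \<in> VF \<Longrightarrow> r *\<^sub>R x \<in> VF" "0 \<in> VF"
  by (auto simp: VF_def scaleR_complex)

lemma matrix_VF: "(\<And>i j. g $ i $ j \<in> F) \<Longrightarrow> x \<in> VF \<Longrightarrow> g *v x \<in> VF"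
  unfolding VF_def matrix_vector_mult_def by (auto intro!: F_sum)

lemma G_VF: "g \<in> G \<Longrightarrow> x \<in> VF \<Longrightarrow> g *v x \<in> VF"
  by (rule matrix_VF) (auto simp: G_def)

lemma subspace_VF: "subspace VF"
  by (rule subspaceI) auto

lemma Re_hf_inner: "Re (hf x y) = x \<bullet> (I *v y)"
  by (simp add: hf_I inner_vec_def inner_complex_def)

lemma axis_VF: "axis k 1 \<in> VF"
  by (auto simp: VF_def axis_def)

text \<open>Kolchin's theorem inside the real-orthogonal complement of the fixed vectors \<open>W\<close>: if no isotropic
  vector outside \<open>A\<close> is fixed modulo \<open>A\<close>, this complement must be \<open>A\<close>, so everything is fixed modulo \<open>A\<close>.\<close>

lemma isotropic_fixed_mod:
  assumes NG: "N \<subseteq> G" and mult: "\<And>u w. u \<in> N \<Longrightarrow> w \<in> N \<Longrightarrow> u ** w \<in> N" and inv: "\<And>u. u \<in> N \<Longrightarrow> matrix_inv u \<in> N"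
    and uni: "\<And>u. u \<in> N \<Longrightarrow> unipotent u"
    and A: "subspace A" "A \<subseteq> VF" and iso: "\<And>a b. a \<in> A \<Longrightarrow> b \<in> A \<Longrightarrow> Re (hf a b) = 0"
    and NA: "\<And>u x. u \<in> N \<Longrightarrow> x \<in> A \<Longrightarrow> u *v x \<in> A"
  defines "P \<equiv> {y\<in>VF. \<forall>a\<in>A. Re (hf a y) = 0}"
  shows "(\<exists>w\<in>P - A. hf w w = 0 \<and> (\<forall>u\<in>N. u *v w - w \<in> A)) \<or> (\<forall>w\<in>P. \<forall>u\<in>N. u *v w - w \<in> A)"
proof (rule disjCI)
  assume "\<not> (\<forall>w\<in>P. \<forall>u\<in>N. u *v w - w \<in> A)"
  then obtain x where x: "x \<in> P" "\<not> (\<forall>u\<in>N. u *v x - x \<in> A)" by blast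
  define W where "W = {w\<in>P. \<forall>u\<in>N. u *v w - w \<in> A}"
  have sP: "subspace P" unfolding P_def by (rule subspaceI) (auto simp: hf_sesq)
  have isoN: "Re (hf (u *v x) y) = Re (hf x (matrix_inv u *v y))" if "u \<in> N" for u x y
  proof -
    have "u *v (matrix_inv u *v y) = y"
      using G_inverse(2,4)[of u] that NG by (simp add: matrix_vector_mul_assoc subset_iff)
    then show ?thesis using hf_G[of u x "matrix_inv u *v y"] that NG by auto
  qed
  have NP: "u *v y \<in> P" if "u \<in> N" "y \<in> P" for u y
  proof -
    have "Re (hf a (u *v y)) = 0" if "a \<in> A" for a
    proof -
      have "Re (hf a (u *v y)) = Re (hf (u *v y) a)" by (rule Re_hf_sym)
      also have "\<dots> = Re (hf (matrix_inv u *v a) y)" unfolding isoN[OF \<open>u \<in> N\<close>] by (rule Re_hf_sym)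
      finally show ?thesis using NA[OF inv[OF \<open>u \<in> N\<close>] that] \<open>y \<in> P\<close> by (simp add: P_def)
    qed
    then show ?thesis using that NG G_VF by (auto simp: P_def)
  qed
  have AP: "A \<subseteq> P" using A(2) iso by (auto simp: P_def)
  have AW: "A \<subseteq> W" using AP NA A(1) by (auto simp: W_def subspace_diff)
  have sW: "subspace W"
  proof (rule subspaceI)
    show "0 \<in> W" using sP A(1) by (simp add: W_def subspace_0)
    fix x y assume xy: "x \<in> W" "y \<in> W"
    have "u *v (x + y) - (x + y) \<in> A" if "u \<in> N" for u
    proof -
      have "u *v (x + y) - (x + y) = (u *v x - x) + (u *v y - y)" by (simp add: matrix_vector_right_distrib)
      moreover have "u *v x - x \<in> A" "u *v y - y \<in> A" using xy that by (auto simp: W_def)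
      ultimately show ?thesis using subspace_add[OF A(1)] by metis
    qed
    then show "x + y \<in> W" using xy sP by (simp add: W_def subspace_add)
  next
    fix r :: real and x assume x: "x \<in> W"
    have "u *v (r *\<^sub>R x) - r *\<^sub>R x \<in> A" if "u \<in> N" for u
    proof -
      have "u *v (r *\<^sub>R x) - r *\<^sub>R x = r *\<^sub>R (u *v x - x)"
        by (simp add: linear_cmul[OF linear_matrix_vector_right] scaleR_diff_right)
      moreover have "u *v x - x \<in> A" using x that by (auto simp: W_def)
      ultimately show ?thesis using subspace_scale[OF A(1)] by metis
    qed
    then show "r *\<^sub>R x \<in> W" using x sP by (simp add: W_def subspace_scale)
  qed
  have NW: "u *v w \<in> W" if "u \<in> N" "w \<in> W" for u w
  proof -
    have "(u *v w - w) + w \<in> W" using that AW sW by (intro subspace_add) (auto simp: W_def)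
    then show ?thesis by simp
  qed
  define B where "B = {y\<in>P. \<forall>w\<in>W. Re (hf w y) = 0}"
  have sB: "subspace B" unfolding B_def using sP
    by (intro subspaceI) (auto simp: hf_sesq subspace_0 subspace_add subspace_scale)
  have AB: "A \<subseteq> B"
  proof
    fix a assume a: "a \<in> A"
    have "Re (hf w a) = 0" if "w \<in> W" for w
      using that a Re_hf_sym[of w a] unfolding W_def P_def by simp
    then show "a \<in> B" using a AP by (auto simp: B_def)
  qed
  have NB: "u *v y \<in> B" if "u \<in> N" "y \<in> B" for u y
  proof -
    have "Re (hf w (u *v y)) = 0" if "w \<in> W" for w
    proof -
      have "Re (hf w (u *v y)) = Re (hf (u *v y) w)" by (rule Re_hf_sym)
      also have "\<dots> = Re (hf (matrix_inv u *v w) y)" unfolding isoN[OF \<open>u \<in> N\<close>] by (rule Re_hf_sym)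
      finally show ?thesis using NW[OF inv[OF \<open>u \<in> N\<close>] that] \<open>y \<in> B\<close> by (simp add: B_def)
    qed
    then show ?thesis using that NP by (auto simp: B_def)
  qed
  have "B \<noteq> A"
  proof
    assume BA: "B = A"
    have "x \<notin> W" using x by (auto simp: W_def)
    \<comment> \<open>Split \<open>x\<close> by the Euclidean inner product. Then I y is orthogonal
      to \<open>W\<close> for the form, so it lies in B = A and is orthogonal to \<open>x\<close>
      for the form. This makes \<open>y\<close> Euclidean orthogonal to \<open>x\<close>, which
      forces y = 0.\<close>
    obtain w0 y where w0: "w0 \<in> span W" "\<And>w. w \<in> span W \<Longrightarrow> orthogonal y w" "x = w0 + y"
      using orthogonal_subspace_decomp_exists[of W x] by metis
    have spW: "span W = W" using sW by (rule span_eq_iff[THEN iffD2])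
    have "y \<noteq> 0" using w0 \<open>x \<notin> W\<close> spW by auto
    have WV: "W \<subseteq> VF" by (auto simp: W_def P_def)
    have yV: "y \<in> VF"
    proof -
      have "y = x - w0" using w0 by simp
      then show ?thesis using x w0(1) spW WV by (auto simp: P_def)
    qed
    let ?z = "I *v y"
    have II: "I *v (I *v y) = y" by (simp add: matrix_vector_mul_assoc I_I)
    have zV: "?z \<in> VF" using yV by (auto simp: VF_def)
    have wz: "Re (hf w ?z) = 0" if "w \<in> W" for w
      using w0(2)[of w] that spW by (simp add: Re_hf_inner II orthogonal_def inner_commute)
    have "?z \<in> P" using zV wz AW by (auto simp: P_def)
    then have "?z \<in> B" using wz by (auto simp: B_def)
    then have "?z \<in> A" using BA by simp
    then have "Re (hf ?z x) = 0" using x(1) by (simp add: P_def)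
    then have "Re (hf x ?z) = 0" using Re_hf_sym[of x ?z] by simp
    then have "x \<bullet> y = 0" by (simp add: Re_hf_inner II)
    moreover have "w0 \<bullet> y = 0" using w0(2)[OF w0(1)] by (simp add: orthogonal_def inner_commute)
    ultimately show False using w0(3) \<open>y \<noteq> 0\<close> by (simp add: inner_add_left)
  qed
  then have "A \<subset> B" using AB by blast
  from kolchin[OF mult uni A(1) sB this NA NB] obtain w where w: "w \<in> B - A" "\<forall>u\<in>N. u *v w - w \<in> A" by blast
  \<comment> \<open>A vector of \<open>B\<close> fixed modulo \<open>A\<close> lies in
    \<open>W\<close>. As \<open>B\<close> is orthogonal to \<open>W\<close>, it is orthogonal to
    itself.\<close>
  then have "w \<in> W" by (auto simp: W_def B_def)
  then have "Re (hf w w) = 0" using w by (auto simp: B_def)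
  then have "hf w w = 0" using hf_real[of w] by simp
  then show "\<exists>w\<in>P - A. hf w w = 0 \<and> (\<forall>u\<in>N. u *v w - w \<in> A)" using w by (auto simp: B_def)
qed

text \<open>Two equations in three unknowns, solved by the cross product of the coefficient rows, or
  directly when the rows are proportional. The resulting combination lies where the form is
  positive.\<close>

lemma three_vectors_combination:
  assumes "\<And>i. i \<in> {1, 2, 3::nat} \<Longrightarrow> x i \<in> VF"
  obtains c where "\<And>i. i \<in> {1, 2, 3::nat} \<Longrightarrow> c i \<in> F" "\<exists>i\<in>{1, 2, 3}. c i \<noteq> 0"
    "\<And>k. k = q1 \<or> k = q2 \<Longrightarrow> c 1 * x 1 $ k + c 2 * x 2 $ k + c 3 * x 3 $ k = 0"
proof -
  have F: "x i $ k \<in> F" if "i \<in> {1, 2, 3}" for i k using assms[OF that] by (auto simp: VF_def)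
  have kernel: "\<exists>a b c. a \<in> F \<and> b \<in> F \<and> c \<in> F \<and> (a \<noteq> 0 \<or> b \<noteq> 0 \<or> c \<noteq> 0) \<and>
      a * s1 + b * s2 + c * s3 = 0 \<and> a * t1 + b * t2 + c * t3 = 0"
    if s: "s1 \<in> F" "s2 \<in> F" "s3 \<in> F" and t: "t1 \<in> F" "t2 \<in> F" "t3 \<in> F" for s1 s2 s3 t1 t2 t3 :: complex
  proof (cases "s2 * t3 - s3 * t2 = 0 \<and> s3 * t1 - s1 * t3 = 0 \<and> s1 * t2 - s2 * t1 = 0")
    case False
    show ?thesis
      by (rule exI[of _ "s2 * t3 - s3 * t2"], rule exI[of _ "s3 * t1 - s1 * t3"], rule exI[of _ "s1 * t2 - s2 * t1"])
        (use False s t in \<open>auto simp: algebra_simps\<close>)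
  next
    case True
    have dep: "\<exists>a b c. a \<in> F \<and> b \<in> F \<and> c \<in> F \<and> (a \<noteq> 0 \<or> b \<noteq> 0 \<or> c \<noteq> 0) \<and>
      a * s1 + b * s2 + c * s3 = 0 \<and> a * t1 + b * t2 + c * t3 = 0"
      if r: "r1 \<in> F" "r2 \<in> F" "r3 \<in> F" and nz: "r1 \<noteq> 0 \<or> r2 \<noteq> 0 \<or> r3 \<noteq> 0"
        and e: "r2 * s3 = r3 * s2" "r3 * s1 = r1 * s3" "r1 * s2 = r2 * s1" "r2 * t3 = r3 * t2" "r3 * t1 = r1 * t3" "r1 * t2 = r2 * t1" for r1 r2 r3
    proof (cases "r1 = 0 \<and> r2 = 0")
      case True
      then have "r3 \<noteq> 0" using nz by auto
      then have "s1 = 0" "t1 = 0" using e True by auto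
      then show ?thesis by (intro exI[of _ 1] exI[of _ 0]) auto
    next
      case False
      then show ?thesis
        by (intro exI[of _ "- r2"] exI[of _ r1] exI[of _ 0]) (use r e in auto)
    qed
    show ?thesis
    proof (cases "s1 \<noteq> 0 \<or> s2 \<noteq> 0 \<or> s3 \<noteq> 0")
      case nz: True
      show ?thesis by (rule dep[OF s nz]) (use True in \<open>auto simp: mult_ac\<close>)
    next
      case s0: False
      show ?thesis
      proof (cases "t1 \<noteq> 0 \<or> t2 \<noteq> 0 \<or> t3 \<noteq> 0")
        case nz: True
        show ?thesis by (rule dep[OF t nz]) (use s0 in \<open>auto simp: mult_ac\<close>)
      next
        case False
        then show ?thesis using s0 by (intro exI[of _ 1]) auto
      qed
    qed
  qed
  obtain a b c where abc: "a \<in> F" "b \<in> F" "c \<in> F" "a \<noteq> 0 \<or> b \<noteq> 0 \<or> c \<noteq> 0"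
      "a * x 1 $ q1 + b * x 2 $ q1 + c * x 3 $ q1 = 0" "a * x 1 $ q2 + b * x 2 $ q2 + c * x 3 $ q2 = 0"
    using kernel[of "x 1 $ q1" "x 2 $ q1" "x 3 $ q1" "x 1 $ q2" "x 2 $ q2" "x 3 $ q2"] F by auto
  show ?thesis
    by (rule that[of "\<lambda>i. if i = 1 then a else if i = 2 then b else c"]) (use abc in auto)
qed

lemma positive_part:
  assumes "y $ q1 = 0" "y $ q2 = 0"
  shows "Re (hf y y) \<ge> 0" "Re (hf y y) = 0 \<Longrightarrow> y = 0"
proof -
  have e: "Re (hf y y) = (\<Sum>k\<in>UNIV. (cmod (y $ k))\<^sup>2)"
    unfolding hf_def Re_sum
  proof (rule sum.cong)
    fix k show "Re (cnj (y $ k) * (of_real (sg k) * y $ k)) = (cmod (y $ k))\<^sup>2"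
      unfolding cmod_power2 using assms by (auto simp: sg_def power2_eq_square)
  qed simp
  show "Re (hf y y) \<ge> 0" unfolding e by (simp add: sum_nonneg)
  show "y = 0" if "Re (hf y y) = 0"
    using that unfolding e by (auto simp: sum_nonneg_eq_0_iff vec_eq_iff)
qed

end

lemma unipotent_conj:
  assumes b: "invertible (b :: complex^'m^'m)" and u: "unipotent u"
  shows "unipotent (b ** u ** matrix_inv b)"
proof -
  have bb: "matrix_inv b ** b = mat 1" "b ** matrix_inv b = mat 1" using matrix_inv_mult[OF b] by auto
  obtain k where k: "(((**) (u - mat 1)) ^^ k) (mat 1) = 0" using u unfolding unipotent_def by blast
  have e: "b ** u ** matrix_inv b - mat 1 = b ** (u - mat 1) ** matrix_inv b"
    by (simp add: matrix_diff_ldistrib matrix_diff_rdistrib bb)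
  have "(((**) (b ** (u - mat 1) ** matrix_inv b)) ^^ n) (mat 1) = b ** (((**) (u - mat 1)) ^^ n) (mat 1) ** matrix_inv b" for n
  proof (induction n)
    case (Suc n)
    have "(((**) (b ** (u - mat 1) ** matrix_inv b)) ^^ Suc n) (mat 1) =
      b ** (u - mat 1) ** (matrix_inv b ** b) ** (((**) (u - mat 1)) ^^ n) (mat 1) ** matrix_inv b"
      by (simp add: Suc matrix_mul_assoc)
    then show ?case by (simp add: bb matrix_mul_assoc)
  qed (simp add: bb)
  from this[of k] show ?thesis unfolding unipotent_def e k by auto
qed

lemma matrix_mult_minus:
  fixes X Y :: "complex^'m^'m"
  shows "X ** (- Y) = - (X ** Y)" "(- X) ** Y = - (X ** Y)"
  by (simp_all add: vec_eq_iff matrix_matrix_mult_def sum_negf)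

context sig_form
begin

section \<open>Matrices commuting with the group are scalar\<close>

lemma sign_flip_G:
  assumes "i \<noteq> k"
  shows "diagm (\<lambda>a. if a = i \<or> a = k then - 1 else 1) \<in> G" (is "?g \<in> G")
proof -
  have "ctranspose ?g = ?g" by (auto simp: vec_eq_iff diagm_def)
  then have "ctranspose ?g ** I ** ?g = I"
    by (auto simp: vec_eq_iff mult_diagm_nth) (auto simp: diagm_def I_def)
  moreover have "det ?g = 1"
  proof -
    have "det ?g = (\<Prod>a\<in>UNIV. if a = i \<or> a = k then - 1 else 1)"
      by (subst det_diagonal) (auto simp: diagm_def)
    also have "\<dots> = (\<Prod>a\<in>{i, k}. - 1)" by (rule prod.mono_neutral_cong_right) auto
    finally show ?thesis using assms by simp
  qed
  moreover have "?g $ a $ b \<in> F" for a b by (simp add: diagm_def)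
  ultimately show ?thesis by (simp add: G_def)
qed

text \<open>\<open>R\<close> is the infinitesimal isometry built from an isotropic \<open>v\<close>
  and a vector \<open>w\<close> orthogonal to it. Its cube vanishes, so its exponential series stops
  at the square.\<close>

lemma transvection_G:
  fixes v w :: "'m \<Rightarrow> real"
  assumes vv: "(\<Sum>k\<in>UNIV. sg k * v k * v k) = 0" and vw: "(\<Sum>k\<in>UNIV. sg k * v k * w k) = 0"
  defines "R \<equiv> (\<chi> a b. of_real ((v a * w b - w a * v b) * sg b)) :: complex^'m^'m"
  shows "mat 1 + R + (1/2) *\<^sub>R (R ** R) \<in> G" "(R ** R) $ a $ b = - of_real ((\<Sum>k\<in>UNIV. sg k * w k * w k) * v a * v b * sg b)"
proof -
  let ?s = "\<Sum>k\<in>UNIV. sg k * w k * w k"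
  show RR: "(R ** R) $ a $ b = - of_real (?s * v a * v b * sg b)" for a b
  proof -
    have "(R ** R) $ a $ b = of_real (\<Sum>c\<in>UNIV. ((v a * w c - w a * v c) * sg c) * ((v c * w b - w c * v b) * sg b))"
      by (simp add: R_def matrix_matrix_mult_def)
    also have "(\<Sum>c\<in>UNIV. ((v a * w c - w a * v c) * sg c) * ((v c * w b - w c * v b) * sg b)) =
       v a * w b * sg b * (\<Sum>c\<in>UNIV. sg c * v c * w c) - v a * v b * sg b * ?s
       - w a * w b * sg b * (\<Sum>c\<in>UNIV. sg c * v c * v c) + w a * v b * sg b * (\<Sum>c\<in>UNIV. sg c * v c * w c)"
      by (simp add: sum_distrib_left sum.distrib[symmetric] sum_subtractf[symmetric] algebra_simps)
    finally show ?thesis by (simp add: vv vw)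
  qed
  have RRR: "R ** (R ** R) = 0"
  proof -
    have "(R ** (R ** R)) $ a $ b = 0" for a b
    proof -
      have "(R ** (R ** R)) $ a $ b = of_real (\<Sum>c\<in>UNIV. ((v a * w c - w a * v c) * sg c) * (- (?s * v c * v b * sg b)))"
        unfolding matrix_matrix_mult_def[of R "R ** R"] vec_lambda_beta RR by (simp add: R_def)
      also have "(\<Sum>c\<in>UNIV. ((v a * w c - w a * v c) * sg c) * (- (s * v c * v b * sg b))) =
        - (v a * s * v b * sg b * (\<Sum>c\<in>UNIV. sg c * v c * w c)) + w a * s * v b * sg b * (\<Sum>c\<in>UNIV. sg c * v c * v c)" for s
        by (simp only: sum_distrib_left sum.distrib[symmetric] sum_negf[symmetric]) (simp add: algebra_simps)
      finally show ?thesis by (simp add: vv vw)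
    qed
    then show ?thesis by (simp add: vec_eq_iff)
  qed
  then have RRR': "R ** R ** R = 0" by (simp add: matrix_mul_assoc)
  let ?g = "mat 1 + R + (1/2) *\<^sub>R (R ** R)"
  have RI: "ctranspose R ** I = - (I ** R)"
    by (simp add: vec_eq_iff) (simp add: R_def algebra_simps)
  have "ctranspose (R ** R) ** I = ctranspose R ** (ctranspose R ** I)" by (simp add: ctranspose_mult matrix_mul_assoc)
  also have "\<dots> = - ((ctranspose R ** I) ** R)"
    unfolding RI by (simp add: matrix_mult_minus) (simp add: matrix_mul_assoc RI matrix_mult_minus)
  also have "\<dots> = I ** R ** R" unfolding RI by (simp add: matrix_mult_minus)
  finally have RRI: "ctranspose (R ** R) ** I = I ** R ** R" .
  have "ctranspose ?g ** I = I ** (mat 1 - R + (1/2) *\<^sub>R (R ** R))"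
  proof -
    have "ctranspose ((1/2) *\<^sub>R (R ** R)) = (1/2) *\<^sub>R ctranspose (R ** R)" by (simp add: vec_eq_iff)
    then show ?thesis
      by (simp add: ctranspose_add matrix_add_rdistrib matrix_add_ldistrib matrix_diff_ldistrib RI RRI scaleR_matrix_mult matrix_mul_assoc)
  qed
  then have "ctranspose ?g ** I ** ?g = I ** ((mat 1 - R + (1/2) *\<^sub>R (R ** R)) ** ?g)" by (simp add: matrix_mul_assoc)
  also have "(mat 1 - R + (1/2) *\<^sub>R (R ** R)) ** ?g = mat 1"
    by (simp add: matrix_add_rdistrib matrix_add_ldistrib matrix_diff_rdistrib scaleR_matrix_mult matrix_mul_assoc[symmetric] RRR)
  finally have "ctranspose ?g ** I ** ?g = I" by simp
  moreover have "det ?g = 1"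
  proof -
    have "?g - mat 1 = R + (1/2) *\<^sub>R (R ** R)" by simp
    then have "(((**) (?g - mat 1)) ^^ 3) (mat 1) = 0"
      by (simp add: numeral_3_eq_3 matrix_add_rdistrib matrix_add_ldistrib scaleR_matrix_mult matrix_mul_assoc[symmetric] RRR)
    then have "unipotent ?g" unfolding unipotent_def by blast
    then show ?thesis by (rule unipotent_trace_det)
  qed
  moreover have "?g $ a $ b \<in> F" for a b
  proof -
    have "R $ a $ b \<in> F" unfolding R_def vec_lambda_beta by (rule F_closed(8))
    moreover have "(R ** R) $ a $ b \<in> F" unfolding RR by (intro F_closed(5,8))
    moreover have "(mat 1 :: complex^'m^'m) $ a $ b \<in> F" by (simp add: mat_def)
    ultimately show ?thesis
      unfolding vector_add_component vector_scaleR_component scaleR_complex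
      by (intro F_closed(3,4,8))
  qed
  ultimately show "?g \<in> G" by (simp add: G_def)
qed

lemma exists_other_index: "\<exists>k :: 'm. k \<noteq> i \<and> k \<noteq> j"
proof (rule ccontr)
  assume "\<not> ?thesis"
  then have "(UNIV :: 'm set) \<subseteq> {i, j}" by auto
  then have "CARD('m) \<le> card {i, j}" by (intro card_mono) auto
  also have "\<dots> \<le> 2" by (simp add: card_insert_if)
  finally show False using card4 by simp
qed

text \<open>Sign changes in two coordinates kill the off-diagonal entries. The transvection along
  the isotropic sum of a positive and a negative basis vector, with a third basis vector as
  \<open>w\<close>, has nonzero entries linking the three diagonal entries.\<close>

lemma commutant_scalar:
  assumes "\<And>g. g \<in> G \<Longrightarrow> C ** g = g ** C"
  shows "\<exists>c. C = mat c"
proof -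
  have off: "C $ i $ j = 0" if "i \<noteq> j" for i j
  proof -
    obtain k where k: "k \<noteq> i" "k \<noteq> j" using exists_other_index by blast
    have "(C ** diagm (\<lambda>a. if a = i \<or> a = k then - 1 else 1)) $ i $ j = (diagm (\<lambda>a. if a = i \<or> a = k then - 1 else 1) ** C) $ i $ j"
      using assms[OF sign_flip_G[of i k]] k by simp
    then have "C $ i $ j = - C $ i $ j" using that k by (simp add: mult_diagm_nth diagm_mult_nth)
    then show ?thesis by simp
  qed
  define d where "d i = C $ i $ i" for i
  have C: "C = diagm d" using off by (simp add: vec_eq_iff diagm_def d_def)
  have pq: "C $ i $ i = C $ k $ k \<and> C $ j $ j = C $ k $ k" if i: "i \<noteq> q1" "i \<noteq> q2" and j: "j = q1 \<or> j = q2" and k: "k \<noteq> i" "k \<noteq> j" for i j k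
  proof -
    define v where "v a = (if a = i \<or> a = j then 1 else 0 :: real)" for a
    define w where "w a = (if a = k then 1 else 0 :: real)" for a
    have ij: "i \<noteq> j" using i j by auto
    have "(\<Sum>a\<in>UNIV. sg a * v a * v a) = (\<Sum>a\<in>{i, j}. sg a)"
      by (rule sum.mono_neutral_cong_right) (auto simp: v_def)
    then have vv: "(\<Sum>a\<in>UNIV. sg a * v a * v a) = 0" using i j ij by (auto simp: sg_def)
    have vw: "(\<Sum>a\<in>UNIV. sg a * v a * w a) = 0" by (rule sum.neutral) (use k in \<open>auto simp: v_def w_def\<close>)
    define R where "R = (\<chi> a b. of_real ((v a * w b - w a * v b) * sg b) :: complex^'m^'m)"
    note tr = transvection_G[OF vv vw, folded R_def]
    let ?g = "mat 1 + R + (1/2) *\<^sub>R (R ** R)"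
    have vk: "v k = 0" using k by (simp add: v_def)
    have g: "?g $ i $ k = of_real (sg k)" "?g $ j $ k = of_real (sg k)"
      using k by (simp_all add: tr(2) vk mat_def) (simp_all add: R_def v_def w_def)
    have sk: "of_real (sg k) \<noteq> (0::complex)" by (simp add: sg_def)
    have comm: "(C ** ?g) $ a $ k = (?g ** C) $ a $ k" for a using assms[OF tr(1)] by simp
    have e: "C $ a $ a * ?g $ a $ k = C $ k $ k * ?g $ a $ k" for a
      using comm[of a] unfolding C diagm_mult_nth mult_diagm_nth by (simp add: diagm_def)
    show ?thesis using e[of i] e[of j] sk unfolding g by simp
  qed
  obtain p where p: "p \<noteq> q1" "p \<noteq> q2" using exists_other_index by blast
  have "C $ k $ k = C $ p $ p" for k
  proof -
    have q: "C $ p $ p = C $ q1 $ q1" "C $ p $ p = C $ q2 $ q2"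
      using pq[OF p, of q1 q2] pq[OF p, of q2 q1] p q12 by auto
    show ?thesis
    proof (cases "k = p \<or> k = q1 \<or> k = q2")
      case False
      then show ?thesis using pq[OF p, of q1 k] by auto
    qed (use q in auto)
  qed
  then have "C = mat (C $ p $ p)" using off by (simp add: vec_eq_iff mat_def)
  then show ?thesis by blast
qed

section \<open>The Cartan involution as conjugation by an involution \<open>J\<close>\<close>

definition cartanJ :: "complex^'m^'m \<Rightarrow> bool" where
  "cartanJ J \<longleftrightarrow> J ** J = mat 1 \<and> (\<forall>i j. J $ i $ j \<in> F) \<and> (\<forall>x y. hf (J *v x) y = hf x (J *v y)) \<and>
     (\<forall>x. x \<noteq> 0 \<longrightarrow> Re (hf x (J *v x)) > 0)"

lemma mat_mult_scalar: "mat c ** X = X ** mat c" "(mat c *v x) = c *s x" for X :: "complex^'m^'m"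
proof -
  have m: "mat c = diagm (\<lambda>_. c)" by (simp add: mat_def diagm_def)
  show "mat c ** X = X ** mat c" unfolding m by (simp add: vec_eq_iff mult_diagm_nth diagm_mult_nth)
  show "(mat c *v x) = c *s x" by (simp add: vec_eq_iff mat_def matrix_vector_mult_def if_distrib[of "\<lambda>a. a * _"] cong: if_cong)
qed

lemma cartan_involution_J:
  assumes "cartan_involution G \<theta>"
  obtains J where "cartanJ J" "\<And>g. g \<in> G \<Longrightarrow> \<theta> g = J ** g ** J" "\<And>g. g \<in> G \<Longrightarrow> \<theta> g \<in> G"
proof -
  from assms have tG: "\<And>g. g \<in> G \<Longrightarrow> \<theta> g \<in> G" unfolding cartan_involution_def by blast
  from assms obtain h :: "complex^'m^'m" where h: "invertible h" and th0: "\<And>g. g \<in> G \<Longrightarrow>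
     \<theta> g = matrix_inv h ** matrix_inv (ctranspose (h ** g ** matrix_inv h)) ** h"
    unfolding cartan_involution_def by blast
  define k where "k = matrix_inv h"
  have hk: "h ** k = mat 1" "k ** h = mat 1" using matrix_inv_mult[OF h] by (auto simp: k_def)
  have chk: "ctranspose h ** ctranspose k = mat 1" "ctranspose k ** ctranspose h = mat 1"
    using hk by (simp_all add: ctranspose_mult[symmetric])
  \<comment> \<open>Chosen so that hf x (J0 y) is the standard inner product of h x and h y. Hence
    \<open>J0\<close> is self-adjoint and positive for the form, and \<theta> is conjugation by
    it.\<close>
  define J0 where "J0 = I ** ctranspose h ** h"
  define Ji where "Ji = k ** ctranspose k ** I"
  have JJi: "J0 ** Ji = mat 1"
  proof -
    have "J0 ** Ji = I ** (ctranspose h ** (h ** k) ** ctranspose k) ** I" by (simp add: J0_def Ji_def matrix_mul_assoc)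
    then show ?thesis by (simp add: hk chk I_I)
  qed
  then have JiJ: "Ji ** J0 = mat 1" by (simp add: matrix_left_right_inverse)
  have th: "\<theta> g = Ji ** g ** J0" if "g \<in> G" for g
  proof -
    have "ctranspose (h ** g ** k) ** (ctranspose k ** (I ** g ** I) ** ctranspose h) =
       ctranspose k ** (ctranspose g ** (ctranspose h ** ctranspose k) ** I ** g) ** I ** ctranspose h"
      by (simp add: ctranspose_mult matrix_mul_assoc)
    also have "\<dots> = mat 1" by (simp add: chk G_I[OF that]) (simp add: matrix_mul_assoc[symmetric] I_I_cancel chk)
    finally have "matrix_inv (ctranspose (h ** g ** k)) = ctranspose k ** (I ** g ** I) ** ctranspose h"
      by (rule matrix_inv_eqI)
    then show ?thesis unfolding th0[OF that] k_def[symmetric] by (simp add: J0_def Ji_def matrix_mul_assoc)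
  qed
  have cJ0: "ctranspose J0 = I ** J0 ** I" by (simp add: J0_def ctranspose_mult ctranspose_I matrix_mul_assoc I_I)
  have cJi: "ctranspose Ji = I ** Ji ** I"
    unfolding Ji_def by (simp add: ctranspose_mult ctranspose_I matrix_mul_assoc[symmetric] I_I)
  \<comment> \<open>Writing out that \<theta> maps \<open>G\<close> to isometries of the form leads
    to this relation.\<close>
  have commi: "(Ji ** Ji) ** g = g ** (Ji ** Ji)" if g: "g \<in> G" for g
  proof -
    let ?gi = "I ** ctranspose g ** I"
    have "I = ctranspose (Ji ** g ** J0) ** I ** (Ji ** g ** J0)" using tG[OF g] th[OF g] G_I by metis
    also have "\<dots> = I ** (J0 ** ?gi ** Ji ** Ji ** g ** J0)"
      by (simp add: ctranspose_mult cJ0 cJi matrix_mul_assoc[symmetric] I_I_cancel)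
    finally have "I ** I = I ** (I ** (J0 ** ?gi ** Ji ** Ji ** g ** J0))" by simp
    then have "J0 ** (?gi ** Ji ** Ji ** g) ** J0 = mat 1" by (simp add: I_I I_I_cancel matrix_mul_assoc)
    moreover have "Ji ** (J0 ** (?gi ** Ji ** Ji ** g) ** J0) ** Ji = (Ji ** J0) ** (?gi ** Ji ** Ji ** g) ** (J0 ** Ji)"
      by (simp only: matrix_mul_assoc)
    ultimately have "?gi ** Ji ** Ji ** g = Ji ** Ji" by (simp add: JiJ JJi)
    then have "g ** (?gi ** Ji ** Ji ** g) = g ** (Ji ** Ji)" by simp
    moreover have "g ** (?gi ** Ji ** Ji ** g) = (g ** ?gi) ** (Ji ** Ji) ** g" by (simp only: matrix_mul_assoc)
    ultimately show ?thesis by (simp add: G_inverse(2)[OF g])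
  qed
  have comm: "(J0 ** J0) ** g = g ** (J0 ** J0)" if g: "g \<in> G" for g
  proof -
    have cc: "(J0 ** J0) ** (Ji ** Ji) = mat 1" "(Ji ** Ji) ** (J0 ** J0) = mat 1"
      by (metis JJi JiJ matrix_mul_assoc matrix_mul_rid)+
    have "(J0 ** J0) ** g = (J0 ** J0) ** (g ** (Ji ** Ji)) ** (J0 ** J0)"
      by (metis cc(2) matrix_mul_assoc matrix_mul_rid)
    also have "\<dots> = ((J0 ** J0) ** (Ji ** Ji)) ** g ** (J0 ** J0)" unfolding commi[OF g, symmetric] by (simp only: matrix_mul_assoc)
    finally show ?thesis by (simp add: cc)
  qed
  obtain c where c: "J0 ** J0 = mat c" using commutant_scalar comm by blast
  have sym0: "hf (J0 *v x) y = hf x (J0 *v y)" for x y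
    unfolding hf_I ctranspose_vec matrix_vector_mul_assoc cJ0 by (simp add: matrix_mul_assoc[symmetric] I_I)
  have pos0: "hf x (J0 *v x) = of_real (Re (hf x (J0 *v x))) \<and> (x \<noteq> 0 \<longrightarrow> Re (hf x (J0 *v x)) > 0)" for x
  proof -
    have "hf x (J0 *v x) = (\<Sum>l\<in>UNIV. cnj ((h *v x) $ l) * (h *v x) $ l)"
      unfolding hf_I ctranspose_vec matrix_vector_mul_assoc J0_def by (simp add: matrix_mul_assoc I_I)
    also have "\<dots> = of_real (\<Sum>l\<in>UNIV. (cmod ((h *v x) $ l))\<^sup>2)"
      by (simp only: of_real_sum complex_norm_square mult.commute)
    finally have e: "hf x (J0 *v x) = of_real (\<Sum>l\<in>UNIV. (cmod ((h *v x) $ l))\<^sup>2)" .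
    have "(\<Sum>l\<in>UNIV. (cmod ((h *v x) $ l))\<^sup>2) > 0" if "x \<noteq> 0"
    proof -
      have "h *v x \<noteq> 0" using h that unfolding invertible_iff_ker by blast
      then obtain l where "(h *v x) $ l \<noteq> 0" by (auto simp: vec_eq_iff)
      then show ?thesis by (intro sum_pos2[of _ l]) auto
    qed
    then show ?thesis unfolding e by simp
  qed
  define x0 :: "complex^'m" where "x0 = axis q1 1"
  have x0: "x0 \<noteq> 0" by (simp add: x0_def axis_eq_0_iff)
  have "hf (J0 *v x0) (J0 *v (J0 *v x0)) = c * hf x0 (J0 *v x0)"
  proof -
    have "J0 *v (J0 *v (J0 *v x0)) = c *s (J0 *v x0)"
      using c by (metis matrix_vector_mul_assoc mat_mult_scalar(2))
    then show ?thesis by (simp add: sym0 hf_sesq)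
  qed
  moreover have "J0 *v x0 \<noteq> 0" using pos0[of x0] x0 by (auto simp: hf_sesq)
  ultimately have cpos: "c = of_real (Re c)" "Re c > 0"
  proof -
    assume eq: "hf (J0 *v x0) (J0 *v (J0 *v x0)) = c * hf x0 (J0 *v x0)" and nz: "J0 *v x0 \<noteq> 0"
    define \<alpha> where "\<alpha> = Re (hf (J0 *v x0) (J0 *v (J0 *v x0)))"
    define \<beta> where "\<beta> = Re (hf x0 (J0 *v x0))"
    have ab: "\<alpha> > 0" "\<beta> > 0" "of_real \<alpha> = c * of_real \<beta>"
      using pos0[of x0] pos0[of "J0 *v x0"] x0 nz eq by (auto simp: \<alpha>_def \<beta>_def)
    then have ceq: "c = of_real (\<alpha> / \<beta>)" by (simp add: field_simps)
    then have re: "Re c = \<alpha> / \<beta>" by (metis Re_complex_of_real)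
    show "c = of_real (Re c)" unfolding re by (rule ceq)
    show "Re c > 0" using ab unfolding re by simp
  qed
  define r where "r = Re c"
  define J where "J = (1 / sqrt r) *\<^sub>R J0"
  have r: "r > 0" "c = of_real r" using cpos by (auto simp: r_def)
  have rs: "(1 / sqrt r) * (1 / sqrt r) = 1 / r" using r by simp
  have matc: "mat c = r *\<^sub>R (mat 1 :: complex^'m^'m)" using r by (simp add: vec_eq_iff mat_def scaleR_complex)
  have JJ: "J ** J = mat 1" unfolding J_def scaleR_matrix_mult c matc using r by simp
  have Ji_eq: "Ji = (1 / r) *\<^sub>R J0"
  proof -
    have "J0 = J0 ** (J0 ** Ji)" by (simp add: JJi)
    also have "\<dots> = r *\<^sub>R Ji" by (simp add: matrix_mul_assoc c matc scaleR_matrix_mult)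
    finally show ?thesis using r by (metis scaleR_scaleR scaleR_one divide_self_if less_irrefl times_divide_eq_left mult_1)
  qed
  have thJ: "\<theta> g = J ** g ** J" if "g \<in> G" for g
    using rs by (simp add: th[OF that] J_def Ji_eq scaleR_matrix_mult)
  have Jv: "J *v x = (1 / sqrt r) *\<^sub>R (J0 *v x)" for x
    unfolding J_def by (simp add: linear_cmul[OF linear_matrix_vector_left])
  have sym: "hf (J *v x) y = hf x (J *v y)" for x y by (simp add: Jv hf_sesq sym0)
  have pos: "Re (hf x (J *v x)) > 0" if "x \<noteq> 0" for x using pos0[of x] that r by (simp add: Jv hf_sesq)
  \<comment> \<open>In the real case the complex conjugate \<open>Jb\<close> induces the same
    conjugation on \<open>G\<close>, so \<open>J ** Jb\<close> is a scalar \<open>u\<close>. The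
    entry of \<open>J\<close> at (q1, q1) is real and nonzero, whence u = 1 and \<open>J\<close> is
    real.\<close>
  have JF: "J $ i $ j \<in> F" for i j
  proof (cases "F = UNIV")
    case False
    then have F: "F = \<real>" using F_cases by auto
    define Jb where "Jb = (\<chi> i j. cnj (J $ i $ j))"
    have cm: "(\<chi> i j. cnj ((A ** B) $ i $ j)) = (\<chi> i j. cnj (A $ i $ j)) ** (\<chi> i j. cnj (B $ i $ j))" for A B :: "complex^'m^'m"
      by (simp add: vec_eq_iff matrix_matrix_mult_def)
    have cG: "(\<chi> i j. cnj (g $ i $ j)) = g" if "g \<in> G" for g
    proof -
      have "g $ i $ j \<in> \<real>" for i j using that unfolding F[symmetric] by (simp add: G_def)
      then show ?thesis by (simp add: vec_eq_iff Reals_cnj_iff)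
    qed
    have cone: "(\<chi> i j. cnj ((mat 1 :: complex^'m^'m) $ i $ j)) = mat 1" by (simp add: vec_eq_iff mat_def)
    have bb: "Jb ** Jb = mat 1" unfolding Jb_def cm[symmetric] JJ by (rule cone)
    have bg: "Jb ** g ** Jb = J ** g ** J" if "g \<in> G" for g
    proof -
      have "J ** g ** J = (\<chi> i j. cnj ((J ** g ** J) $ i $ j))" using cG[OF tG[OF that]] thJ[OF that] by simp
      also have "\<dots> = Jb ** g ** Jb" unfolding cm cG[OF that] Jb_def ..
      finally show ?thesis by simp
    qed
    have "(J ** Jb) ** g = g ** (J ** Jb)" if "g \<in> G" for g
    proof -
      have "(J ** Jb) ** g = J ** (Jb ** g ** Jb) ** Jb" by (metis bb matrix_mul_assoc matrix_mul_rid)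
      also have "\<dots> = (J ** J) ** g ** (J ** Jb)" unfolding bg[OF that] by (simp only: matrix_mul_assoc)
      finally show ?thesis by (simp add: JJ)
    qed
    then obtain u where u: "J ** Jb = mat u" using commutant_scalar by blast
    then have "Jb = J ** mat u" by (metis JJ matrix_mul_assoc matrix_mul_lid)
    then have Jbu: "cnj (J $ i $ j) = u * J $ i $ j" for i j
    proof -
      have "Jb $ i $ j = (mat u ** J) $ i $ j" using \<open>Jb = J ** mat u\<close> mat_mult_scalar(1)[of u J] by simp
      moreover have "(mat u :: complex^'m^'m) = diagm (\<lambda>_. u)" by (simp add: mat_def diagm_def)
      ultimately show ?thesis by (simp add: Jb_def diagm_mult_nth)
    qed
    define e :: "complex^'m" where "e = axis q1 1"
    have he: "hf e (J *v e) = - (J $ q1 $ q1)"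
    proof -
      have "(J *v e) $ q1 = J $ q1 $ q1" by (simp add: e_def matrix_vector_mul_component axis_def inner_vec_def matrix_vector_mult_def if_distrib[of "\<lambda>a. _ * a"] cong: if_cong)
      moreover have "hf e (J *v e) = (\<Sum>k\<in>UNIV. if k = q1 then - ((J *v e) $ q1) else 0)"
        unfolding hf_def by (rule sum.cong) (auto simp: e_def axis_def sg_def)
      ultimately show ?thesis by simp
    qed
    have e0: "e \<noteq> 0" by (simp add: e_def axis_eq_0_iff)
    have "hf e (J *v e) = cnj (hf e (J *v e))" using sym[of e e] by (simp add: hf_cnj)
    then have "cnj (J $ q1 $ q1) = J $ q1 $ q1" unfolding he by simp
    moreover have "J $ q1 $ q1 \<noteq> 0" using pos[OF e0] unfolding he by auto
    ultimately have "u = 1" using Jbu[of q1 q1] by simp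
    then show ?thesis using Jbu[of i j] F by (simp add: Reals_cnj_iff)
  qed simp
  show ?thesis using that[OF _ thJ tG] JJ JF sym pos unfolding cartanJ_def by blast
qed

section \<open>The isotropic flag fixed by a unipotent group\<close>

lemma exists_index_outside:
  assumes "card A < CARD('m)"
  shows "\<exists>k :: 'm. k \<notin> A"
proof (rule ccontr)
  assume "\<not> ?thesis"
  then have "A = UNIV" by auto
  then show False using assms by simp
qed

lemma negative_part_nonzero:
  assumes "hf v v = 0" "v \<noteq> 0"
  shows "v $ q1 \<noteq> 0 \<or> v $ q2 \<noteq> 0"
  using positive_part[of v] assms by auto

lemma isotropic_exists: "\<exists>v\<in>VF. v \<noteq> 0 \<and> hf v v = 0"
proof -
  obtain p where p: "p \<noteq> q1" "p \<noteq> q2" using exists_other_index by blast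
  define v :: "complex^'m" where "v = axis p 1 + axis q1 1"
  have "hf v v = (\<Sum>k\<in>{p, q1}. of_real (sg k))"
    unfolding hf_def by (rule sum.mono_neutral_cong_right) (use p in \<open>auto simp: v_def axis_def\<close>)
  also have "\<dots> = 0" using p by (simp add: sg_def)
  finally have "hf v v = 0" .
  moreover have "v $ p = 1" using p by (simp add: v_def axis_def)
  then have "v \<noteq> 0" by auto
  moreover have "v \<in> VF" unfolding v_def by (intro VF_closed axis_VF)
  ultimately show ?thesis by blast
qed

text \<open>The positive part of \<open>w\<close> is taken in two coordinates and the negative part
  in \<open>q1\<close>, \<open>q2\<close>, each orthogonal to the matching part of \<open>v\<close>
  and of length one. The negative parts of \<open>v\<close> and \<open>w\<close> are nonzero and
  orthogonal, so \<open>w\<close> is no multiple of \<open>v\<close>.\<close>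

lemma isotropic_orthogonal_exists:
  assumes v: "v \<in> VF" "v \<noteq> 0" "hf v v = 0"
  shows "\<exists>w\<in>VF. hf w w = 0 \<and> hf v w = 0 \<and> (\<forall>c. w \<noteq> c *s v)"
proof -
  obtain p where p: "p \<noteq> q1" "p \<noteq> q2" using exists_other_index by blast
  have "card {q1, q2, p} < CARD('m)" using card4 by (auto simp: card_insert_if)
  then obtain p' where p': "p' \<noteq> q1" "p' \<noteq> q2" "p' \<noteq> p" using exists_index_outside by blast
  define a where "a = (if v $ p = 0 \<and> v $ p' = 0 then 1 else cnj (v $ p'))"
  define a' where "a' = (if v $ p = 0 \<and> v $ p' = 0 then 0 else - cnj (v $ p))"
  define s where "s = (cmod a)\<^sup>2 + (cmod a')\<^sup>2"
  define t where "t = (cmod (v $ q1))\<^sup>2 + (cmod (v $ q2))\<^sup>2"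
  have "a \<noteq> 0 \<or> a' \<noteq> 0" by (auto simp: a_def a'_def)
  then have s0: "s > 0" unfolding s_def by (auto intro: add_pos_nonneg add_nonneg_pos)
  have q0: "v $ q1 \<noteq> 0 \<or> v $ q2 \<noteq> 0" by (rule negative_part_nonzero[OF v(3,2)])
  then have t0: "t > 0" unfolding t_def by (auto intro: add_pos_nonneg add_nonneg_pos)
  define S where "S = complex_of_real (1 / sqrt s)"
  define T where "T = complex_of_real (1 / sqrt t)"
  have ST: "cnj S = S" "cnj T = T" "S * S * of_real s = 1" "T * T * of_real t = 1" "T \<noteq> 0"
    using s0 t0 by (simp_all add: S_def T_def flip: of_real_mult)
  define w :: "complex^'m" where "w = (\<chi> k. if k = p then S * a else if k = p' then S * a'
      else if k = q1 then - (T * cnj (v $ q2)) else if k = q2 then T * cnj (v $ q1) else 0)"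
  have sum4: "(\<Sum>k\<in>UNIV. h k) = h p + h p' + h q1 + h q2" if "\<And>k. k \<notin> {p, p', q1, q2} \<Longrightarrow> h k = 0" for h :: "'m \<Rightarrow> complex"
  proof -
    have "(\<Sum>k\<in>UNIV. h k) = (\<Sum>k\<in>{p, p', q1, q2}. h k)" by (rule sum.mono_neutral_right) (use that in auto)
    then show ?thesis using p p' q12 by (simp add: add_ac)
  qed
  have wn: "w $ p = S * a" "w $ p' = S * a'" "w $ q1 = - (T * cnj (v $ q2))" "w $ q2 = T * cnj (v $ q1)"
    "\<And>k. k \<notin> {p, p', q1, q2} \<Longrightarrow> w $ k = 0"
    using p p' q12 by (auto simp: w_def)
  have sgn: "sg p = 1" "sg p' = 1" "sg q1 = - 1" "sg q2 = - 1" using p p' by (auto simp: sg_def)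
  have "hf w w = S * S * (cnj a * a + cnj a' * a') - T * T * (v $ q2 * cnj (v $ q2) + v $ q1 * cnj (v $ q1))"
    unfolding hf_def by (subst sum4) (simp_all add: wn sgn ST algebra_simps)
  also have "\<dots> = S * S * of_real s - T * T * of_real t"
    unfolding s_def t_def of_real_add complex_norm_square by (simp add: mult_ac add_ac)
  finally have ww: "hf w w = 0" by (simp add: ST)
  have "hf v w = S * (cnj (v $ p) * a + cnj (v $ p') * a')"
    unfolding hf_def by (subst sum4) (simp_all add: wn sgn algebra_simps)
  also have "cnj (v $ p) * a + cnj (v $ p') * a' = 0" by (auto simp: a_def a'_def)
  finally have vw: "hf v w = 0" by simp
  have "w \<noteq> c *s v" for c
  proof
    assume "w = c *s v"
    then have e: "c * v $ q1 = - (T * cnj (v $ q2))" "c * v $ q2 = T * cnj (v $ q1)"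
      using wn(3,4) by auto
    have "T * of_real t = T * (v $ q1 * cnj (v $ q1)) + T * (v $ q2 * cnj (v $ q2))"
      unfolding t_def of_real_add complex_norm_square by (simp add: distrib_left)
    also have "\<dots> = v $ q1 * (c * v $ q2) - v $ q2 * (c * v $ q1)" unfolding e by (simp add: algebra_simps)
    finally have "T * of_real t = 0" by (simp add: algebra_simps)
    then show False using t0 ST by simp
  qed
  moreover have "w \<in> VF"
  proof -
    have "v $ k \<in> F" for k using v by (simp add: VF_def)
    then show ?thesis by (auto simp: VF_def w_def a_def a'_def S_def T_def simp del: of_real_divide)
  qed
  ultimately show ?thesis using ww vw by blast
qed

definition line :: "complex^'m \<Rightarrow> (complex^'m) set" where "line e = {c *s e | c. c \<in> F}"

definition plane :: "complex^'m \<Rightarrow> complex^'m \<Rightarrow> (complex^'m) set" where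
  "plane e d = {c *s e + c' *s d | c c'. c \<in> F \<and> c' \<in> F}"

lemma scaleR_vscale: "r *\<^sub>R (c *s x) = (of_real r * c) *s x" for x :: "complex^'m"
  by (simp add: vec_eq_iff scaleR_complex)

lemma subspace_plane: "subspace (plane e d)"
proof (rule subspaceI)
  show "0 \<in> plane e d" unfolding plane_def by (auto intro!: exI[of _ 0])
next
  fix x y assume "x \<in> plane e d" "y \<in> plane e d"
  then obtain a b a' b' where ab: "a \<in> F" "b \<in> F" "a' \<in> F" "b' \<in> F" "x = a *s e + b *s d" "y = a' *s e + b' *s d"
    unfolding plane_def by blast
  have "x + y = (a + a') *s e + (b + b') *s d" by (simp add: ab vector_sadd_rdistrib)
  then show "x + y \<in> plane e d" unfolding plane_def using ab by blast
next
  fix r :: real and x assume "x \<in> plane e d"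
  then obtain a b where ab: "a \<in> F" "b \<in> F" "x = a *s e + b *s d" unfolding plane_def by blast
  have "r *\<^sub>R x = (of_real r * a) *s e + (of_real r * b) *s d" by (simp add: ab scaleR_vscale scaleR_add_right)
  then show "r *\<^sub>R x \<in> plane e d" unfolding plane_def using ab by blast
qed

lemma line_plane: "line e = plane e 0"
  unfolding line_def plane_def by auto

text \<open>\<open>isotropic_fixed_mod\<close> only sees real parts of the form. Over an
  \<open>F\<close>-subspace nothing is lost, as scaling \<open>x\<close> by hf x y turns the value
  of the form into its squared modulus.\<close>

lemma plane_perp:
  assumes "e \<in> VF" "d \<in> VF"
  shows "{y\<in>VF. \<forall>a\<in>plane e d. Re (hf a y) = 0} = {y\<in>VF. hf e y = 0 \<and> hf d y = 0}"
proof (rule Set.set_eqI, rule iffI)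
  fix y assume y: "y \<in> {y\<in>VF. \<forall>a\<in>plane e d. Re (hf a y) = 0}"
  have z: "hf x y = 0" if x: "x \<in> VF" and mem: "\<And>c. c \<in> F \<Longrightarrow> c *s x \<in> plane e d" for x
  proof -
    have "Re (hf (hf x y *s x) y) = 0" using y mem hf_F[OF x] by blast
    then have "(cmod (hf x y))\<^sup>2 = 0" by (simp add: hf_sesq cmod_power2 power2_eq_square complex_eq_iff)
    then show ?thesis by (simp add: complex_eq_iff)
  qed
  have "c *s e \<in> plane e d" "c *s d \<in> plane e d" if "c \<in> F" for c
  proof -
    have "c *s e = c *s e + 0 *s d" "c *s d = 0 *s e + c *s d" by auto
    then show "c *s e \<in> plane e d" "c *s d \<in> plane e d" unfolding plane_def using that F_closed(1) by blast+
  qed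
  then show "y \<in> {y\<in>VF. hf e y = 0 \<and> hf d y = 0}" using y z assms by blast
next
  fix y assume "y \<in> {y\<in>VF. hf e y = 0 \<and> hf d y = 0}"
  then show "y \<in> {y\<in>VF. \<forall>a\<in>plane e d. Re (hf a y) = 0}" by (auto simp: plane_def hf_sesq)
qed

lemma plane_VF: "e \<in> VF \<Longrightarrow> d \<in> VF \<Longrightarrow> plane e d \<subseteq> VF"
  unfolding plane_def by auto

lemma plane_isotropic:
  assumes "hf e e = 0" "hf e d = 0" "hf d d = 0" "a \<in> plane e d" "b \<in> plane e d"
  shows "hf a b = 0"
proof -
  have "hf d e = 0" using assms(2) hf_cnj[of e d] by simp
  then show ?thesis using assms by (auto simp: plane_def hf_sesq)
qed

text \<open>Three mutually orthogonal isotropic vectors have a nontrivial combination without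
  negative coordinates. It is isotropic, hence zero, so the vectors are dependent.\<close>

lemma no_isotropic_outside_plane:
  assumes e: "e \<in> VF" "d \<in> VF" "w \<in> VF" and iso: "hf e e = 0" "hf e d = 0" "hf d d = 0" "hf e w = 0" "hf d w = 0" "hf w w = 0"
    and ind: "e \<noteq> 0" "d \<notin> line e"
  shows "w \<in> plane e d"
proof -
  let ?x = "\<lambda>i::nat. if i = 1 then e else if i = 2 then d else w"
  obtain c where c: "\<And>i. i \<in> {1, 2, 3::nat} \<Longrightarrow> c i \<in> F" "\<exists>i\<in>{1, 2, 3}. c i \<noteq> 0"
    "\<And>k. k = q1 \<or> k = q2 \<Longrightarrow> c 1 * ?x 1 $ k + c 2 * ?x 2 $ k + c 3 * ?x 3 $ k = 0"
    by (rule three_vectors_combination[of ?x]) (use e in simp, rule that)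
  define y where "y = c 1 *s e + c 2 *s d + c 3 *s w"
  have sym: "hf d e = 0" "hf w e = 0" "hf w d = 0" using iso hf_cnj[of e d] hf_cnj[of e w] hf_cnj[of d w] by auto
  have "hf y y = 0" by (simp add: y_def hf_sesq iso sym)
  moreover have "y $ q1 = 0" "y $ q2 = 0" using c(3)[of q1] c(3)[of q2] by (simp_all add: y_def)
  ultimately have y0: "y = 0" using positive_part(2)[of y] by simp
  have c3: "c 3 \<noteq> 0"
  proof
    assume c3: "c 3 = 0"
    have c2: "c 2 = 0"
    proof (rule ccontr)
      assume "c 2 \<noteq> 0"
      then have "d = (- (c 1 / c 2)) *s e" using y0 c3 by (simp add: y_def vec_eq_iff field_simps add_eq_0_iff)
      moreover have "- (c 1 / c 2) \<in> F" using c(1)[of 1] c(1)[of 2] F_cases by (auto simp: Reals_divide)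
      ultimately show False using ind by (auto simp: line_def)
    qed
    then have "c 1 *s e = 0" using y0 c3 by (simp add: y_def)
    then have "c 1 = 0" using ind by simp
    then show False using c(2) c2 c3 by auto
  qed
  have "w = (- (c 1 / c 3)) *s e + (- (c 2 / c 3)) *s d"
    using y0 c3 by (simp add: y_def vec_eq_iff field_simps add_eq_0_iff)
  moreover have "- (c 1 / c 3) \<in> F" "- (c 2 / c 3) \<in> F" using c(1)[of 1] c(1)[of 2] c(1)[of 3] F_cases by (auto simp: Reals_divide)
  ultimately show ?thesis unfolding plane_def by blast
qed

lemma cartanJD:
  assumes "cartanJ J"
  shows "J ** J = mat 1" "J $ i $ j \<in> F" "hf (J *v x) y = hf x (J *v y)" "x \<noteq> 0 \<Longrightarrow> Re (hf x (J *v x)) > 0"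
    "J *v (J *v x) = x" "y \<in> VF \<Longrightarrow> J *v y \<in> VF" "hf x (J *v x) = of_real (Re (hf x (J *v x)))"
proof -
  show 1: "J ** J = mat 1" "J $ i $ j \<in> F" "hf (J *v x) y = hf x (J *v y)" "x \<noteq> 0 \<Longrightarrow> Re (hf x (J *v x)) > 0"
    using assms by (auto simp: cartanJ_def)
  show "J *v (J *v x) = x" by (simp add: matrix_vector_mul_assoc 1)
  show "y \<in> VF \<Longrightarrow> J *v y \<in> VF" using assms by (intro matrix_VF) (auto simp: cartanJ_def)
  have "cnj (hf x (J *v x)) = hf x (J *v x)" using assms by (simp add: hf_cnj cartanJ_def)
  then show "hf x (J *v x) = of_real (Re (hf x (J *v x)))" by (simp add: complex_eq_iff)
qed

lemma normalize_vector:
  assumes J: "cartanJ J" and v: "v \<noteq> 0"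
  obtains r :: real where "r > 0" "hf (r *\<^sub>R v) (J *v (r *\<^sub>R v)) = 1"
proof
  define R where "R = Re (hf v (J *v v))"
  have R: "R > 0" "hf v (J *v v) = of_real R" using cartanJD(4,7)[OF J] v by (auto simp: R_def)
  show "1 / sqrt R > 0" using R by simp
  have "(1 / sqrt R) * (1 / sqrt R) * R = 1" using R by simp
  then have "complex_of_real (1 / sqrt R) * (of_real (1 / sqrt R) * of_real R) = 1"
    by (metis of_real_1 of_real_mult mult.assoc)
  then show "hf ((1 / sqrt R) *\<^sub>R v) (J *v ((1 / sqrt R) *\<^sub>R v)) = 1"
    by (simp only: linear_cmul[OF linear_matrix_vector_right] hf_sesq R(2))
qed

text \<open>\<open>isotropic_fixed_mod\<close> is applied to 0, to the line of \<open>e\<close> and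
  to the plane. In the first two layers both alternatives give an isotropic vector, since any one
  will do when everything is fixed; in the third the first alternative contradicts
  \<open>no_isotropic_outside_plane\<close>.\<close>

lemma isotropic_flag:
  assumes J: "cartanJ J" and NG: "N \<subseteq> G" and mult: "\<And>u w. u \<in> N \<Longrightarrow> w \<in> N \<Longrightarrow> u ** w \<in> N"
    and inv: "\<And>u. u \<in> N \<Longrightarrow> matrix_inv u \<in> N" and uni: "\<And>u. u \<in> N \<Longrightarrow> unipotent u"
  obtains e d where "e \<in> VF" "d \<in> VF" "hf e e = 0" "hf e d = 0" "hf d d = 0"
    "hf e (J *v e) = 1" "hf e (J *v d) = 0" "hf d (J *v d) = 1"
    "\<And>u. u \<in> N \<Longrightarrow> u *v e = e" "\<And>u. u \<in> N \<Longrightarrow> u *v d - d \<in> line e"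
    "\<And>u y. u \<in> N \<Longrightarrow> y \<in> VF \<Longrightarrow> hf e y = 0 \<Longrightarrow> hf d y = 0 \<Longrightarrow> u *v y - y \<in> plane e d"
proof -
  note step = isotropic_fixed_mod[OF NG mult inv uni]
  have us: "u *v (c *s x) = c *s (u *v x)" for u :: "complex^'m^'m" and c x by (rule vector_scalar_commute)
  have "\<exists>v\<in>VF. v \<noteq> 0 \<and> hf v v = 0 \<and> (\<forall>u\<in>N. u *v v = v)"
  proof -
    have "(\<exists>w\<in>{y\<in>VF. \<forall>a\<in>{0}. Re (hf a y) = 0} - {0}. hf w w = 0 \<and> (\<forall>u\<in>N. u *v w - w \<in> {0})) \<or>
       (\<forall>w\<in>{y\<in>VF. \<forall>a\<in>{0}. Re (hf a y) = 0}. \<forall>u\<in>N. u *v w - w \<in> {0})"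
      by (rule step) (auto simp: hf_sesq)
    moreover have "{y\<in>VF. \<forall>a\<in>{0}. Re (hf a y) = 0} = VF" by (auto simp: hf_sesq)
    ultimately show ?thesis using isotropic_exists by auto
  qed
  then obtain v where v: "v \<in> VF" "v \<noteq> 0" "hf v v = 0" "\<And>u. u \<in> N \<Longrightarrow> u *v v = v" by blast
  obtain r where r: "r > 0" "hf (r *\<^sub>R v) (J *v (r *\<^sub>R v)) = 1" using normalize_vector[OF J v(2)] .
  define e where "e = r *\<^sub>R v"
  have e: "e \<in> VF" "e \<noteq> 0" "hf e e = 0" "hf e (J *v e) = 1" "\<And>u. u \<in> N \<Longrightarrow> u *v e = e"
    using v r by (auto simp: e_def hf_sesq linear_cmul[OF linear_matrix_vector_right])
  have z: "0 \<in> VF" by auto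
  have "\<exists>w\<in>VF. hf e w = 0 \<and> hf w w = 0 \<and> w \<notin> line e \<and> (\<forall>u\<in>N. u *v w - w \<in> line e)"
  proof -
    have "(\<exists>w\<in>{y\<in>VF. \<forall>a\<in>line e. Re (hf a y) = 0} - line e. hf w w = 0 \<and> (\<forall>u\<in>N. u *v w - w \<in> line e)) \<or>
       (\<forall>w\<in>{y\<in>VF. \<forall>a\<in>line e. Re (hf a y) = 0}. \<forall>u\<in>N. u *v w - w \<in> line e)"
    proof (rule step)
      show "subspace (line e)" unfolding line_plane by (rule subspace_plane)
      show "line e \<subseteq> VF" unfolding line_plane using plane_VF[OF e(1) z] .
      show "Re (hf a b) = 0" if "a \<in> line e" "b \<in> line e" for a b
        using that e(3) by (auto simp: line_def hf_sesq)
      show "u *v x \<in> line e" if "u \<in> N" "x \<in> line e" for u x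
        using that e(5) by (auto simp: line_def us)
    qed
    moreover have "{y\<in>VF. \<forall>a\<in>line e. Re (hf a y) = 0} = {y\<in>VF. hf e y = 0}"
      unfolding line_plane plane_perp[OF e(1) z] by (simp add: hf_sesq)
    moreover obtain w where "w \<in> VF" "hf w w = 0" "hf e w = 0" "w \<notin> line e"
      using isotropic_orthogonal_exists[OF e(1-3)] by (auto simp: line_def)
    ultimately show ?thesis by auto
  qed
  then obtain w where w: "w \<in> VF" "hf e w = 0" "hf w w = 0" "w \<notin> line e" "\<And>u. u \<in> N \<Longrightarrow> u *v w - w \<in> line e" by blast
  \<comment> \<open>Gram-Schmidt for the positive definite form hf x (J y). Subtracting a multiple
    of \<open>e\<close> keeps \<open>w\<close> isotropic and orthogonal to \<open>e\<close>.\<close>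
  define c where "c = hf e (J *v w)"
  have cF: "c \<in> F" unfolding c_def using e(1) w(1) cartanJD(6)[OF J] by (intro hf_F)
  define w' where "w' = w - c *s e"
  have w'0: "w' \<noteq> 0" using w(4) cF by (auto simp: w'_def line_def)
  obtain s where s: "s > 0" "hf (s *\<^sub>R w') (J *v (s *\<^sub>R w')) = 1" using normalize_vector[OF J w'0] .
  define d where "d = s *\<^sub>R w'"
  have we: "hf w e = 0" using w(2) hf_cnj[of e w] by simp
  have d: "d \<in> VF" "hf e d = 0" "hf d d = 0" "hf d (J *v d) = 1"
    using e w cF s by (auto simp: d_def w'_def hf_sesq we)
  have ed: "hf e (J *v d) = 0"
    by (simp add: d_def w'_def linear_cmul[OF linear_matrix_vector_right] matrix_vector_mult_diff_distrib us hf_sesq e(4) c_def)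
  have line_closed: "r *\<^sub>R x \<in> line e" if "x \<in> line e" for r x
    using that subspace_scale[OF subspace_plane] unfolding line_plane by blast
  have ud: "u *v d - d \<in> line e" if "u \<in> N" for u
  proof -
    have "u *v d - d = s *\<^sub>R (u *v w - w)"
      using e(5)[OF that] by (simp add: d_def w'_def linear_cmul[OF linear_matrix_vector_right] matrix_vector_mult_diff_distrib us scaleR_diff_right)
    then show ?thesis using line_closed[OF w(5)[OF that]] by simp
  qed
  have dl: "d \<notin> line e"
  proof
    assume "d \<in> line e"
    then obtain k where k: "d = k *s e" by (auto simp: line_def)
    then have "J *v d = k *s (J *v e)" by (simp add: us)
    then have "hf e (J *v d) = k" by (simp add: hf_sesq e(4))
    then have "k = 0" using ed by simp
    then have "d = 0" using k by simp
    then show False using d(4) by (simp add: hf_sesq)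
  qed
  have ue: "u *v y - y \<in> plane e d" if uN: "u \<in> N" and y: "y \<in> VF" "hf e y = 0" "hf d y = 0" for u y
  proof -
    have "(\<exists>w\<in>{y\<in>VF. \<forall>a\<in>plane e d. Re (hf a y) = 0} - plane e d. hf w w = 0 \<and> (\<forall>u\<in>N. u *v w - w \<in> plane e d)) \<or>
       (\<forall>w\<in>{y\<in>VF. \<forall>a\<in>plane e d. Re (hf a y) = 0}. \<forall>u\<in>N. u *v w - w \<in> plane e d)"
    proof (rule step)
      show "subspace (plane e d)" by (rule subspace_plane)
      show "plane e d \<subseteq> VF" using plane_VF[OF e(1) d(1)] .
      show "Re (hf a b) = 0" if "a \<in> plane e d" "b \<in> plane e d" for a b
        using plane_isotropic[OF e(3) d(2,3) that] by simp
      show "u *v x \<in> plane e d" if u: "u \<in> N" and x: "x \<in> plane e d" for u x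
      proof -
        obtain a b where ab: "a \<in> F" "b \<in> F" "x = a *s e + b *s d" using x by (auto simp: plane_def)
        obtain k where k: "k \<in> F" "u *v d - d = k *s e" using ud[OF u] by (auto simp: line_def)
        have "u *v d = d + k *s e" using k(2) by (simp add: algebra_simps)
        then have "u *v x = (a + b * k) *s e + b *s d"
          by (simp add: ab matrix_vector_right_distrib us e(5)[OF u] vector_add_ldistrib vector_sadd_rdistrib vector_smult_assoc)
        then show ?thesis unfolding plane_def using ab k by blast
      qed
    qed
    then show ?thesis
    proof
      assume "\<exists>w\<in>{y\<in>VF. \<forall>a\<in>plane e d. Re (hf a y) = 0} - plane e d. hf w w = 0 \<and> (\<forall>u\<in>N. u *v w - w \<in> plane e d)"
      then obtain w where "w \<in> VF" "hf e w = 0" "hf d w = 0" "w \<notin> plane e d" "hf w w = 0"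
        unfolding plane_perp[OF e(1) d(1)] by blast
      then show ?thesis using no_isotropic_outside_plane[OF e(1) d(1) _ e(3) d(2,3)] e(2) dl by blast
    qed (use uN y in \<open>unfold plane_perp[OF e(1) d(1)], blast\<close>)
  qed
  show ?thesis by (rule that[OF e(1) d(1) e(3) d(2,3) e(4) ed d(4) e(5) ud ue])
qed

end

lemma matrix_axis_nth: "((A :: complex^'n^'m) *v axis k 1) $ i = A $ i $ k"
proof -
  have "(A *v axis k 1) $ i = (\<Sum>j\<in>UNIV. if j = k then A $ i $ k else 0)"
    unfolding matrix_vector_mult_def vec_lambda_beta by (rule sum.cong) (auto simp: axis_def)
  then show ?thesis by simp
qed

context sig_form
begin

text \<open>Otherwise \<open>e - J e\<close>, \<open>d - J d\<close> and \<open>y\<close> span a nonpositive subspace of dimension three, which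
  meets the positive subspace where the coordinates \<open>q1\<close>, \<open>q2\<close> vanish.\<close>

lemma complement_positive:
  assumes J: "cartanJ J" and e: "e \<in> VF" "d \<in> VF" "hf e e = 0" "hf e d = 0" "hf d d = 0"
    "hf e (J *v e) = 1" "hf e (J *v d) = 0" "hf d (J *v d) = 1"
    and y: "y \<in> VF" "y \<noteq> 0" "hf e y = 0" "hf d y = 0" "hf (J *v e) y = 0" "hf (J *v d) y = 0"
  shows "Re (hf y y) > 0"
proof (rule ccontr)
  assume neg: "\<not> Re (hf y y) > 0"
  let ?x = "\<lambda>i::nat. if i = 1 then e - J *v e else if i = 2 then d - J *v d else y"
  have VFx: "?x i \<in> VF" for i using e y cartanJD(6)[OF J] by auto
  obtain c where c: "\<And>i. i \<in> {1, 2, 3::nat} \<Longrightarrow> c i \<in> F" "\<exists>i\<in>{1, 2, 3}. c i \<noteq> 0"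
    "\<And>k. k = q1 \<or> k = q2 \<Longrightarrow> c 1 * ?x 1 $ k + c 2 * ?x 2 $ k + c 3 * ?x 3 $ k = 0"
    by (rule three_vectors_combination[of ?x]) (rule VFx, rule that)
  define z where "z = c 1 *s (e - J *v e) + c 2 *s (d - J *v d) + c 3 *s y"
  have z12: "z $ q1 = 0" "z $ q2 = 0" using c(3)[of q1] c(3)[of q2] by (simp_all add: z_def right_diff_distrib)
  note Jsym = cartanJD(3)[OF J] and JJ = cartanJD(5)[OF J]
  have de: "hf d e = 0" using e(4) hf_cnj[of e d] by simp
  have dJe: "hf d (J *v e) = 0" using e(7) hf_cnj[of e "J *v d"] by (simp add: Jsym)
  have ye: "hf y e = 0" "hf y d = 0" "hf y (J *v e) = 0" "hf y (J *v d) = 0" "hf e (J *v y) = 0" "hf d (J *v y) = 0"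
    using y hf_cnj[of e y] hf_cnj[of d y] hf_cnj[of "J *v e" y] hf_cnj[of "J *v d" y] by (simp_all add: Jsym)
  have hz: "hf z z = - 2 * of_real ((cmod (c 1))\<^sup>2) - 2 * of_real ((cmod (c 2))\<^sup>2) + of_real ((cmod (c 3))\<^sup>2) * hf y y"
    unfolding complex_norm_square by (simp add: z_def hf_sesq Jsym JJ e de dJe y ye algebra_simps)
  have "Re (hf z z) = - 2 * (cmod (c 1))\<^sup>2 - 2 * (cmod (c 2))\<^sup>2 + (cmod (c 3))\<^sup>2 * Re (hf y y)"
    unfolding hz by (simp del: of_real_power)
  also have "\<dots> \<le> 0"
  proof -
    have "(cmod (c 3))\<^sup>2 * Re (hf y y) \<le> 0" using neg by (intro mult_nonneg_nonpos) auto
    then show ?thesis using zero_le_power2[of "cmod (c 1)"] zero_le_power2[of "cmod (c 2)"] by linarith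
  qed
  finally have "z = 0" using positive_part[OF z12] by linarith
  then have h0: "hf x z = 0" for x by (simp add: hf_sesq)
  have "c 1 = 0" using h0[of e] by (simp add: z_def hf_sesq e y)
  moreover have "c 2 = 0" using h0[of d] by (simp add: z_def hf_sesq e y de dJe)
  ultimately have "c 3 *s y = 0" using \<open>z = 0\<close> by (simp add: z_def)
  then have "c 3 = 0" using y by simp
  then show False using c(2) \<open>c 1 = 0\<close> \<open>c 2 = 0\<close> by auto
qed

section \<open>A basis adapted to the flag and the Cartan involution\<close>

lemma real_orthogonal_exists:
  assumes F: "F = \<real>" and C: "finite C" "card C < CARD('m)" "C \<subseteq> VF"
  shows "\<exists>y\<in>VF. y \<noteq> 0 \<and> (\<forall>c\<in>C. hf c y = 0)"
proof -
  define r where "r c = (\<chi> k. Re (c $ k) * sg k :: real^'m)" for c :: "complex^'m"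
  have "dim (r ` C) \<le> card (r ` C)" using C(1) by (intro dim_le_card') auto
  also have "\<dots> < CARD('m)" using C card_image_le[OF C(1), of r] by simp
  finally have "dim (r ` C) < DIM(real^'m)" by simp
  from orthogonal_to_subspace_exists[OF this] obtain x :: "real^'m" where x: "x \<noteq> 0" "\<And>y. y \<in> span (r ` C) \<Longrightarrow> orthogonal x y" by blast
  define y :: "complex^'m" where "y = (\<chi> k. of_real (x $ k))"
  have "hf c y = 0" if c: "c \<in> C" for c
  proof -
    have im: "cnj (c $ k) = of_real (Re (c $ k))" for k
    proof -
      have "c $ k \<in> F" using c C(3) by (auto simp: VF_def)
      then have "c $ k \<in> \<real>" using F by simp
      then show ?thesis by (simp add: complex_is_Real_iff complex_eq_iff)
    qed
    have "hf c y = of_real (\<Sum>k\<in>UNIV. x $ k * (Re (c $ k) * sg k))"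
      unfolding hf_def im by (simp add: y_def mult_ac)
    also have "(\<Sum>k\<in>UNIV. x $ k * (Re (c $ k) * sg k)) = x \<bullet> r c" by (simp add: inner_vec_def r_def)
    also have "\<dots> = 0" using x(2)[of "r c"] c by (simp add: orthogonal_def span_base)
    finally show ?thesis by simp
  qed
  moreover have "y \<noteq> 0" using x(1) by (auto simp: y_def vec_eq_iff)
  moreover have "y \<in> VF" by (simp add: VF_def y_def)
  ultimately show ?thesis by blast
qed

lemma orthonormal_family_exists:
  fixes T :: "'m set"
  assumes F: "F = \<real>" and C: "finite C" "C \<subseteq> VF"
    and pos: "\<And>y. y \<in> VF \<Longrightarrow> y \<noteq> 0 \<Longrightarrow> (\<And>c. c \<in> C \<Longrightarrow> hf c y = 0) \<Longrightarrow> Re (hf y y) > 0"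
    and T: "card C + card T \<le> CARD('m)"
  shows "\<exists>f. (\<forall>i\<in>T. f i \<in> VF \<and> (\<forall>c\<in>C. hf c (f i) = 0)) \<and> (\<forall>i\<in>T. \<forall>j\<in>T. hf (f i) (f j) = (if i = j then 1 else 0))"
proof -
  have "finite T" by simp
  then show ?thesis using T
  proof (induction T rule: finite_induct)
    case empty
    then show ?case by simp
  next
    case (insert t T)
    then obtain f where "(\<forall>i\<in>T. f i \<in> VF \<and> (\<forall>c\<in>C. hf c (f i) = 0)) \<and> (\<forall>i\<in>T. \<forall>j\<in>T. hf (f i) (f j) = (if i = j then 1 else 0))" by auto
    then have f: "\<And>i. i \<in> T \<Longrightarrow> f i \<in> VF" "\<And>i c. i \<in> T \<Longrightarrow> c \<in> C \<Longrightarrow> hf c (f i) = 0"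
      "\<And>i j. i \<in> T \<Longrightarrow> j \<in> T \<Longrightarrow> hf (f i) (f j) = (if i = j then 1 else 0)" by blast+
    have "card (C \<union> f ` T) \<le> card C + card T"
      using card_Un_le[of C "f ` T"] card_image_le[of T f] by simp
    also have "\<dots> < CARD('m)" using insert by simp
    finally have "card (C \<union> f ` T) < CARD('m)" .
    moreover have "C \<union> f ` T \<subseteq> VF" using C f(1) by auto
    ultimately obtain y where y: "y \<in> VF" "y \<noteq> 0" "\<And>c. c \<in> C \<union> f ` T \<Longrightarrow> hf c y = 0"
      using real_orthogonal_exists[OF F, of "C \<union> f ` T"] C(1) by auto
    define R where "R = Re (hf y y)"
    have R: "R > 0" "hf y y = of_real R" using pos[OF y(1,2)] y(3) hf_real[of y] by (auto simp: R_def)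
    define z where "z = (1 / sqrt R) *\<^sub>R y"
    have "(1 / sqrt R) * (1 / sqrt R) * R = 1" using R by simp
    then have "complex_of_real (1 / sqrt R) * (of_real (1 / sqrt R) * of_real R) = 1"
      by (metis of_real_1 of_real_mult mult.assoc)
    then have zz: "hf z z = 1" by (simp only: z_def hf_sesq R(2))
    have zV: "z \<in> VF" using y by (auto simp: z_def)
    have cz: "hf c z = 0" if "c \<in> C \<union> f ` T" for c using y(3)[OF that] by (simp add: z_def hf_sesq)
    have fz: "hf (f i) z = 0" "hf z (f i) = 0" if "i \<in> T" for i
      using cz[of "f i"] that hf_cnj[of "f i" z] by auto
    show ?case
      by (rule exI[of _ "f(t := z)"]) (use insert(2) f zz zV cz fz in auto)
  qed
qed

lemma distinct_indices_exist:
  obtains i1 i2 j2 j1 :: 'm where "distinct [i1, i2, j2, j1]"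
proof -
  obtain xs :: "'m list" where xs: "set xs = UNIV" "distinct xs" using finite_distinct_list[of "UNIV :: 'm set"] by auto
  have len: "length xs \<ge> 4" using distinct_card[OF xs(2)] xs(1) card4 by simp
  have "distinct [xs ! 0, xs ! 1, xs ! 2, xs ! 3]"
  proof -
    have "xs \<noteq> []" using len by auto
    then show ?thesis using xs(2) len by (auto simp: nth_eq_iff_index_eq)
  qed
  then show ?thesis by (rule that)
qed

text \<open>The involution \<open>J\<close> permutes the basis by \<open>sw\<close>, the same
  permutation that describes the form. Hence \<open>S\<close> is both the Gram matrix and the matrix
  of \<open>J\<close>.\<close>

lemma frame_exists:
  assumes J: "cartanJ J" and e: "e \<in> VF" "d \<in> VF" "hf e e = 0" "hf e d = 0" "hf d d = 0"
    "hf e (J *v e) = 1" "hf e (J *v d) = 0" "hf d (J *v d) = 1"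
  obtains i1 i2 j2 j1 b where "split_frame i1 i2 j2 j1 F" "\<And>i j. b $ i $ j \<in> F"
    "ctranspose b ** I ** b = split_frame.S i1 i2 j2 j1" "J ** b = b ** split_frame.S i1 i2 j2 j1"
    "b *v axis i1 1 = e" "b *v axis i2 1 = d"
    "\<And>f. f \<in> split_frame.P0 i1 i2 j2 j1 \<Longrightarrow> hf e (b *v axis f 1) = 0 \<and> hf d (b *v axis f 1) = 0"
proof -
  obtain i1 i2 j2 j1 :: 'm where ds: "distinct [i1, i2, j2, j1]" using distinct_indices_exist .
  have c4: "card {i1, i2, j2, j1} = 4" using ds by simp
  have cc: "card (- {i1, i2, j2, j1}) = CARD('m) - 4" using c4 by (simp only: Compl_eq_Diff_UNIV) (simp add: card_Diff_subset)
  have sf: "split_frame i1 i2 j2 j1 F"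
  proof
    show "F = \<real> \<and> - {i1, i2, j2, j1} \<noteq> {} \<or> F = UNIV \<and> - {i1, i2, j2, j1} = {}"
    proof (cases "F = \<real> \<and> CARD('m) \<ge> 5")
      case True
      then have "card (- {i1, i2, j2, j1}) \<noteq> 0" using cc by simp
      then show ?thesis using True by force
    next
      case False
      then have "F = UNIV" "card (- {i1, i2, j2, j1}) = 0" using F_cases cc by auto
      then show ?thesis by simp
    qed
  qed (rule ds)
  interpret sf: split_frame i1 i2 j2 j1 F by (rule sf)
  note Jsym = cartanJD(3)[OF J] and JJ = cartanJD(5)[OF J] and JVF = cartanJD(6)[OF J]
  have de: "hf d e = 0" using e(4) hf_cnj[of e d] by simp
  have dJe: "hf d (J *v e) = 0" using e(7) hf_cnj[of e "J *v d"] by (simp add: Jsym)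
  let ?C = "{e, d, J *v e, J *v d}"
  have pos: "Re (hf y y) > 0" if "y \<in> VF" "y \<noteq> 0" "\<And>c. c \<in> ?C \<Longrightarrow> hf c y = 0" for y
    by (rule complement_positive[OF J e that(1,2)]) (use that(3) in auto)
  have "\<exists>f. (\<forall>i\<in>sf.P0. f i \<in> VF \<and> (\<forall>c\<in>?C. hf c (f i) = 0)) \<and> (\<forall>i\<in>sf.P0. \<forall>j\<in>sf.P0. hf (f i) (f j) = (if i = j then 1 else 0))"
  proof (cases "sf.P0 = {}")
    case False
    then have F: "F = \<real>" using sf.rl_iff sf.rl_def by simp
    have "card ?C \<le> 4" by (simp add: card_insert_if)
    then have "card ?C + card sf.P0 \<le> CARD('m)" using cc card4 by (simp add: sf.P0_def)
    moreover have "?C \<subseteq> VF" using e JVF by auto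
    ultimately show ?thesis using orthonormal_family_exists[OF F, of ?C sf.P0] pos by blast
  qed auto
  then obtain f where f: "\<And>i. i \<in> sf.P0 \<Longrightarrow> f i \<in> VF" "\<And>i c. i \<in> sf.P0 \<Longrightarrow> c \<in> ?C \<Longrightarrow> hf c (f i) = 0"
    "\<And>i j. i \<in> sf.P0 \<Longrightarrow> j \<in> sf.P0 \<Longrightarrow> hf (f i) (f j) = (if i = j then 1 else 0)" by blast
  have Jf: "J *v f i = f i" if i: "i \<in> sf.P0" for i
  proof (rule ccontr)
    \<comment> \<open>The difference z = f i - J (f i) stays in the positive complement, while J z =
      - z would make hf z (J z) negative.\<close>
    assume ne: "J *v f i \<noteq> f i"
    define z where "z = f i - J *v f i"
    have z0: "z \<noteq> 0" using ne by (simp add: z_def)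
    have Jz: "J *v z = - z" by (simp add: z_def matrix_vector_mult_diff_distrib JJ)
    have "Re (hf z z) > 0"
    proof (rule pos)
      show "z \<in> VF" using f(1)[OF i] JVF by (auto simp: z_def)
      show "hf c z = 0" if "c \<in> ?C" for c
      proof -
        have "J *v c \<in> ?C" using that JJ by auto
        then show ?thesis using f(2)[OF i that] f(2)[OF i, of "J *v c"] by (simp add: z_def hf_sesq Jsym)
      qed
    qed (rule z0)
    moreover have "Re (hf z (J *v z)) > 0" by (rule cartanJD(4)[OF J z0])
    moreover have "hf z (J *v z) = - hf z z" unfolding Jz using hf_sesq(4)[of z 0 z] by (simp add: hf_sesq)
    ultimately show False by simp
  qed
  define col where "col k = (if k = i1 then e else if k = i2 then d else if k = j2 then J *v d else if k = j1 then J *v e else f k)" for k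
  have cols: "col i1 = e" "col i2 = d" "col j2 = J *v d" "col j1 = J *v e" "\<And>k. k \<in> sf.P0 \<Longrightarrow> col k = f k"
    by (auto simp: col_def)
  have colVF: "col k \<in> VF" for k
    by (cases k rule: sf.index_cases) (auto simp: cols e JVF f)
  have Jcol: "J *v col k = col (sf.sw k)" for k
    by (cases k rule: sf.index_cases) (auto simp: cols JJ Jf)
  have fe: "hf e (f i) = 0" "hf d (f i) = 0" "hf e (J *v f i) = 0" "hf d (J *v f i) = 0" "hf (f i) e = 0" "hf (f i) d = 0"
    "hf (f i) (J *v e) = 0" "hf (f i) (J *v d) = 0" if i: "i \<in> sf.P0" for i
  proof -
    show "hf e (f i) = 0" "hf d (f i) = 0" using f(2)[OF i] by auto
    then show "hf e (J *v f i) = 0" "hf d (J *v f i) = 0" "hf (f i) e = 0" "hf (f i) d = 0"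
      using Jf[OF i] hf_cnj[of e "f i"] hf_cnj[of d "f i"] by auto
    have "hf (J *v e) (f i) = 0" "hf (J *v d) (f i) = 0" using f(2)[OF i] by auto
    then show "hf (f i) (J *v e) = 0" "hf (f i) (J *v d) = 0"
      using hf_cnj[of "J *v e" "f i"] hf_cnj[of "J *v d" "f i"] by auto
  qed
  have gram: "hf (col i) (col j) = (if j = sf.sw i then 1 else 0)" for i j
    by (cases i rule: sf.index_cases; cases j rule: sf.index_cases)
      (auto simp: cols e de dJe Jsym JJ f(3) fe)
  define b where "b = (\<chi> i j. col j $ i)"
  have bax: "b *v axis k 1 = col k" for k
    by (simp add: vec_eq_iff matrix_axis_nth b_def)
  show ?thesis
  proof (rule that[OF sf, of b])
    show "b $ i $ j \<in> F" for i j using colVF[of j] by (simp add: b_def VF_def)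
    have "(ctranspose b ** I ** b) $ i $ j = hf (col i) (col j)" for i j
      unfolding matrix_matrix_mult_def[of "ctranspose b ** I"] hf_def by (simp add: b_def mult_ac)
    then show "ctranspose b ** I ** b = sf.S" by (simp add: vec_eq_iff gram sf.S_nth)
    have "(J ** b) $ i $ j = (J *v col j) $ i" for i j
      by (simp add: matrix_matrix_mult_def matrix_vector_mult_def b_def)
    then show "J ** b = b ** sf.S" by (simp add: vec_eq_iff Jcol b_def)
    show "b *v axis i1 1 = e" "b *v axis i2 1 = d" by (simp_all add: bax cols)
    show "hf e (b *v axis k 1) = 0 \<and> hf d (b *v axis k 1) = 0" if "k \<in> sf.P0" for k
      using that by (simp add: bax cols fe)
  qed
qed

end

lemma group_hom_conj:
  assumes "invertible (b :: complex^'m^'m)"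
  shows "group_hom GL GL (\<lambda>g. b ** g ** matrix_inv b)"
proof -
  have bb: "matrix_inv b ** b = mat 1" using matrix_inv_mult[OF assms] by auto
  have "(\<lambda>g. b ** g ** matrix_inv b) \<in> hom GL GL"
    using assms invertible_imp_matrix_inv[OF assms]
    by (auto simp: hom_def intro!: invertible_mult) (metis bb matrix_mul_assoc matrix_mul_rid)
  then show ?thesis using group_GL by (simp add: group_hom_def group_hom_axioms_def)
qed

context sig_form
begin

section \<open>Integrability for an arbitrary Iwasawa decomposition\<close>

lemma tame_integrable:
  assumes iw: "iwasawa G \<theta> N A K" and haar: "haar_measure (derived GL N) M" and dd: "dd > 0"
  shows "integrable M (\<lambda>n. inverse (a_rho N (iwasawa_A \<theta> N A K n)) * (1 + ln (a_rho N (iwasawa_A \<theta> N A K n))) powr dd)"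
proof -
  from iw obtain T where cart: "cartan_involution G \<theta>" and K: "K = {g\<in>G. \<theta> g = g}" and maxN: "maximal_unipotent G N"
    and T: "maximal_split_torus G T" "\<And>t. t \<in> T \<Longrightarrow> (\<lambda>n. t ** n ** matrix_inv t) ` N = N"
    "A = connected_component_set T (mat 1)"
    and thA: "\<And>a. a \<in> A \<Longrightarrow> \<theta> a = matrix_inv a"
    and bij: "bij_betw (\<lambda>(v, a, k). v ** a ** k) (\<theta> ` N \<times> A \<times> K) G"
    unfolding iwasawa_def by blast
  obtain J where J: "cartanJ J" and thJ: "\<And>g. g \<in> G \<Longrightarrow> \<theta> g = J ** g ** J" by (rule cartan_involution_J[OF cart]) (blast intro: that)
  have NG: "N \<subseteq> G" and sN: "subgroup N GL" and uni: "\<And>u. u \<in> N \<Longrightarrow> unipotent u"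
    and Nmax: "\<And>U. U \<subseteq> G \<Longrightarrow> subgroup U GL \<Longrightarrow> (\<And>u. u \<in> U \<Longrightarrow> unipotent u) \<Longrightarrow> N \<subseteq> U \<Longrightarrow> U = N"
    using maxN unfolding maximal_unipotent_def maximal_with_def by auto
  have mult: "u ** w \<in> N" if "u \<in> N" "w \<in> N" for u w using subgroup.m_closed[OF sN that] by simp
  have inv: "matrix_inv u \<in> N" if "u \<in> N" for u
    using subgroup.m_inv_closed[OF sN that] inv_GL[of u] G_inverse(3)[of u] NG that by auto
  obtain e d where e: "e \<in> VF" "d \<in> VF" "hf e e = 0" "hf e d = 0" "hf d d = 0"
    "hf e (J *v e) = 1" "hf e (J *v d) = 0" "hf d (J *v d) = 1"
    and flag: "\<And>u. u \<in> N \<Longrightarrow> u *v e = e" "\<And>u. u \<in> N \<Longrightarrow> u *v d - d \<in> line e"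
    "\<And>u y. u \<in> N \<Longrightarrow> y \<in> VF \<Longrightarrow> hf e y = 0 \<Longrightarrow> hf d y = 0 \<Longrightarrow> u *v y - y \<in> plane e d"
  proof (rule isotropic_flag[OF J NG mult inv uni], goal_cases)
    case (5 e d)
    show ?case by (rule that[OF 5(2-)])
  qed
  obtain i1 i2 j2 j1 b where sf: "split_frame i1 i2 j2 j1 F" and bF: "\<And>i j. b $ i $ j \<in> F"
    and bS: "ctranspose b ** I ** b = split_frame.S i1 i2 j2 j1" and Jb: "J ** b = b ** split_frame.S i1 i2 j2 j1"
    and be: "b *v axis i1 1 = e" "b *v axis i2 1 = d"
    and bf: "\<And>f. f \<in> split_frame.P0 i1 i2 j2 j1 \<Longrightarrow> hf e (b *v axis f 1) = 0 \<and> hf d (b *v axis f 1) = 0"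
  proof (rule frame_exists[OF J e], goal_cases)
    case (1 i1 i2 j2 j1 b)
    show ?case by (rule that[OF 1(2-)])
  qed
  interpret sf: split_frame i1 i2 j2 j1 F by (rule sf)
  define bi where "bi = sf.S ** ctranspose b ** I"
  have bib: "bi ** b = mat 1"
  proof -
    have "bi ** b = sf.S ** (ctranspose b ** I ** b)" by (simp add: bi_def matrix_mul_assoc)
    then show ?thesis by (simp add: bS)
  qed
  then have bbi: "b ** bi = mat 1" by (simp add: matrix_left_right_inverse)
  have b: "invertible b" and inv_b: "matrix_inv b = bi" using invertibleI[OF bbi] matrix_inv_eqI[OF bbi] by auto
  have biF: "bi $ i $ j \<in> F" for i j by (simp add: bi_def bF)
  \<comment> \<open>\<open>c\<close> and its inverse \<open>c'\<close> pass between adapted and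
    given coordinates; in the adapted ones \<theta> is conjugation by \<open>S\<close>.\<close>
  define c where "c g = b ** g ** bi" for g
  define c' where "c' g = bi ** g ** b" for g
  have cc: "c (c' g) = g" "c' (c g) = g" for g
    unfolding c_def c'_def using bib bbi by (metis matrix_mul_assoc matrix_mul_lid matrix_mul_rid)+
  have cm: "c (g ** h) = c g ** c h" "c' (g ** h) = c' g ** c' h" for g h
    unfolding c_def c'_def using bib bbi by (metis matrix_mul_assoc matrix_mul_rid)+
  have c1: "c (mat 1) = mat 1" "c' (mat 1) = mat 1" by (simp_all add: c_def c'_def bib bbi)
  have c'J: "c' (J ** g ** J) = sf.S ** c' g ** sf.S" for g
  proof -
    have "c' J = sf.S" unfolding c'_def matrix_mul_assoc[symmetric] Jb by (simp add: matrix_mul_assoc bib)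
    then show ?thesis by (simp add: cm)
  qed
  have cbi: "ctranspose bi = I ** b ** sf.S"
    by (simp add: bi_def ctranspose_mult ctranspose_I matrix_mul_assoc)
  have iso': "ctranspose (c' g) ** sf.S ** c' g = sf.S" and F': "\<And>i j. c' g $ i $ j \<in> F" if g: "g \<in> G" for g
  proof -
    have "ctranspose (c' g) ** sf.S ** c' g = ctranspose b ** (ctranspose g ** I ** (b ** bi) ** g) ** b"
      by (simp add: c'_def ctranspose_mult cbi matrix_mul_assoc)
    then show "ctranspose (c' g) ** sf.S ** c' g = sf.S" by (simp add: bbi G_I[OF g] bS)
    have "g $ i $ j \<in> F" for i j using g by (simp add: G_def)
    then show "c' g $ i $ j \<in> F" for i j unfolding c'_def by (intro matrix_mult_F biF bF)
  qed
  have ISb: "I = ctranspose bi ** sf.S ** bi"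
  proof -
    have "ctranspose bi ** sf.S ** bi = ctranspose bi ** ctranspose b ** I ** (b ** bi)"
      unfolding bS[symmetric] by (simp add: matrix_mul_assoc)
    also have "ctranspose bi ** ctranspose b = mat 1" by (simp add: ctranspose_mult[symmetric] bbi)
    finally show ?thesis by (simp add: bbi)
  qed
  have det_b: "det b * det bi = 1" by (simp add: det_mul[symmetric] bbi)
  have cNS_G: "c ` sf.NS \<subseteq> G"
  proof
    fix x assume "x \<in> c ` sf.NS"
    then obtain g where g: "g \<in> sf.NS" "x = c g" by auto
    have "ctranspose (c g) ** I ** c g = ctranspose bi ** (ctranspose g ** (ctranspose b ** I ** b) ** g) ** bi"
      by (simp add: c_def ctranspose_mult matrix_mul_assoc)
    also have "\<dots> = I" using g by (simp add: bS sf.NSD(3) ISb[symmetric])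
    finally have "ctranspose (c g) ** I ** c g = I" .
    moreover have "det (c g) = 1" using det_b sf.NS_det[OF g(1)] by (simp add: c_def det_mul)
    moreover have "c g $ i $ j \<in> F" for i j
      unfolding c_def using sf.NSD(2)[OF g(1)] by (intro matrix_mult_F biF bF)
    ultimately show "x \<in> G" by (simp add: G_def g)
  qed
  have hom: "group_hom GL GL c" using group_hom_conj[OF b] unfolding inv_b c_def[abs_def] .
  have bi_ax: "bi *v (b *v x) = x" for x by (simp add: matrix_vector_mul_assoc bib)
  have c'N: "c' u \<in> sf.NS" if u: "u \<in> N" for u
  proof (rule sf.NS_from_columns)
    have uG: "u \<in> G" using u NG by auto
    show "c' u $ i $ j \<in> F" for i j by (rule F'[OF uG])
    show "ctranspose (c' u) ** sf.S ** c' u = sf.S" by (rule iso'[OF uG])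
    have entry: "c' u $ k $ l = (bi *v (u *v (b *v axis l 1))) $ k" for k l
    proof -
      have "bi *v (u *v (b *v axis l 1)) = c' u *v axis l 1" by (simp add: c'_def matrix_vector_mul_assoc matrix_mul_assoc)
      then show ?thesis by (simp add: matrix_axis_nth)
    qed
    have bie: "bi *v e = axis i1 1" "bi *v d = axis i2 1" using bi_ax be by metis+
    show "c' u $ k $ i1 = (if k = i1 then 1 else 0)" for k
      unfolding entry be flag(1)[OF u] bie by (simp add: axis_def)
    show "c' u $ k $ i2 = (if k = i2 then 1 else 0)" if "k \<noteq> i1" for k
    proof -
      obtain t where "u *v d - d = t *s e" using flag(2)[OF u] by (auto simp: line_def)
      then have "u *v d = d + t *s e" by (simp add: algebra_simps)
      then have "bi *v (u *v d) = axis i2 1 + t *s axis i1 1"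
        by (simp add: matrix_vector_right_distrib vector_scalar_commute bie)
      then show ?thesis using that unfolding entry be by (simp add: axis_def)
    qed
    show "c' u $ k $ f = (if k = f then 1 else 0)" if f: "f \<in> sf.P0" and k: "k \<noteq> i1" "k \<noteq> i2" for f k
    proof -
      let ?y = "b *v axis f 1"
      have "?y \<in> VF" by (rule matrix_VF[OF bF axis_VF])
      then have "u *v ?y - ?y \<in> plane e d" using flag(3)[OF u] bf[OF f] by blast
      then obtain s t where "u *v ?y - ?y = s *s e + t *s d" by (auto simp: plane_def)
      then have "u *v ?y = ?y + (s *s e + t *s d)" by (simp add: algebra_simps)
      then have "bi *v (u *v ?y) = axis f 1 + (s *s axis i1 1 + t *s axis i2 1)"
        by (simp add: matrix_vector_right_distrib vector_scalar_commute bie bi_ax)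
      then show ?thesis using k by (simp add: entry axis_def)
    qed
  qed
  have N_eq: "N = c ` sf.NS"
  proof -
    \<comment> \<open>The flag places \<open>N\<close> inside this unipotent group, and maximality
      of \<open>N\<close> turns the inclusion into equality.\<close>
    have "c ` sf.NS = N"
    proof (rule Nmax[OF cNS_G])
      show "subgroup (c ` sf.NS) GL" by (rule group_hom.subgroup_img_is_subgroup[OF hom sf.subgroup_NS])
      show "unipotent u" if "u \<in> c ` sf.NS" for u
        using that unipotent_conj[OF b] sf.NS_unipotent unfolding inv_b c_def by auto
      show "N \<subseteq> c ` sf.NS" using c'N cc(1) by (metis image_eqI subsetI)
    qed
    then show ?thesis by simp
  qed
  have der: "derived GL N = c ` sf.D"
  proof -
    have "sf.NS \<subseteq> carrier GL" using sf.NS_inverse(1) by auto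
    from group_hom.derived_img[OF hom this] show ?thesis unfolding N_eq sf.derived_NS .
  qed
  have TG: "T \<subseteq> G" and T1: "mat 1 \<in> T"
    using T(1) subgroup.one_closed[of T GL] unfolding maximal_split_torus_def maximal_with_def split_torus_def by auto
  have AT: "A \<subseteq> T" unfolding T(3) by (rule connected_component_subset)
  have lin: "linear c'" unfolding c'_def[abs_def] by (rule linear_conj)
  have conn: "connected (c' ` A)"
  proof (rule connected_continuous_image)
    show "continuous_on A c'" using lin linear_conv_bounded_linear by (metis linear_continuous_on)
    show "connected A" unfolding T(3) by (rule connected_connected_component)
  qed
  have oneA: "mat 1 \<in> c' ` A"
  proof -
    have "mat 1 \<in> A" unfolding T(3) using T1 by simp
    then show ?thesis using c1(2) by (metis image_eqI)
  qed
  have hermA: "ctranspose (c' a) = c' a" if a: "a \<in> A" for a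
  proof -
    have aG: "a \<in> G" using a AT TG by auto
    have "(J ** a ** J) ** a = mat 1" using thA[OF a] thJ[OF aG] matrix_inv_mult(2)[OF G_inverse(3)[OF aG]] by simp
    then have "c' (J ** a ** J) ** c' a = mat 1" by (metis cm(2) c1(2))
    then have 1: "(sf.S ** c' a ** sf.S) ** c' a = mat 1" unfolding c'J .
    have 2: "(sf.S ** ctranspose (c' a) ** sf.S) ** c' a = mat 1" by (rule sf.isometry_inverse(1)[OF iso'[OF aG]])
    \<comment> \<open>Both sides are inverses of \<open>c' a\<close>: the left one because \<theta>
      inverts \<open>A\<close>, the right one by the isometry relation.\<close>
    have "sf.S ** c' a ** sf.S = sf.S ** ctranspose (c' a) ** sf.S"
      using 1 2 by (metis matrix_inv_eqI(2))
    then have "sf.S ** (sf.S ** c' a ** sf.S) ** sf.S = sf.S ** (sf.S ** ctranspose (c' a) ** sf.S) ** sf.S" by simp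
    then show ?thesis by (simp add: matrix_mul_assoc)
  qed
  have normA: "\<exists>n'\<in>sf.NS. n ** c' a = c' a ** n'" if a: "a \<in> A" and n: "n \<in> sf.NS" for a n
  proof -
    have "c n \<in> (\<lambda>n. a ** n ** matrix_inv a) ` N" using T(2)[of a] a AT n unfolding N_eq by auto
    then obtain n2 where n2: "n2 \<in> N" "c n = a ** n2 ** matrix_inv a" by auto
    have "matrix_inv a ** a = mat 1" using a AT TG by (intro matrix_inv_mult G_inverse) auto
    then have "c n ** a = a ** n2" unfolding n2(2) by (metis matrix_mul_assoc matrix_mul_rid)
    then have "n ** c' a = c' a ** c' n2" by (metis cc(2) cm(2))
    then show ?thesis using c'N[OF n2(1)] by blast
  qed
  have diag: "\<exists>p q. p > 0 \<and> q > 0 \<and> c' a = sf.dg p q" if a: "a \<in> A" for a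
  proof -
    have "c' a \<in> c' ` A" using a by blast
    then obtain p q where "p > 0" "q > 0" "c' a = sf.dg p q"
    proof (rule sf.connected_normalizer_diagonal[OF conn oneA, rotated 3])
      show "ctranspose x = x" if "x \<in> c' ` A" for x using that hermA by auto
      show "ctranspose x ** sf.S ** x = sf.S" if "x \<in> c' ` A" for x using that iso' AT TG by auto
      show "\<exists>n'\<in>sf.NS. n ** x = x ** n'" if "x \<in> c' ` A" "n \<in> sf.NS" for x n using that normA by auto
    qed
    then show ?thesis by blast
  qed
  have rho: "a_rho N (iwasawa_A \<theta> N A K (c g)) = sf.rhog g" if g: "g \<in> sf.D" for g
  proof -
    have "c g \<in> N" using g unfolding N_eq sf.D_def by auto
    then have cgG: "c g \<in> G" using NG by auto
    then have "c g \<in> (\<lambda>(v, a, k). v ** a ** k) ` (\<theta> ` N \<times> A \<times> K)" using bij by (simp add: bij_betw_def)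
    then obtain v a k where vak: "v \<in> \<theta> ` N" "a \<in> A" "k \<in> K" "c g = v ** a ** k" by auto
    have "iwasawa_A \<theta> N A K (c g) = a"
      unfolding iwasawa_A_def
    proof (rule the_equality)
      show "a \<in> A \<and> (\<exists>v\<in>\<theta> ` N. \<exists>k\<in>K. c g = v ** a ** k)" using vak by blast
      fix a' assume "a' \<in> A \<and> (\<exists>v\<in>\<theta> ` N. \<exists>k\<in>K. c g = v ** a' ** k)"
      then obtain v' k' where v': "v' \<in> \<theta> ` N" "k' \<in> K" "a' \<in> A" "c g = v' ** a' ** k'" by blast
      have "inj_on (\<lambda>(v, a, k). v ** a ** k) (\<theta> ` N \<times> A \<times> K)" using bij by (simp add: bij_betw_def)
      from inj_onD[OF this, of "(v', a', k')" "(v, a, k)"] v' vak show "a' = a" by auto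
    qed
    moreover obtain p q where pq: "p > 0" "q > 0" "c' a = sf.dg p q" using diag[OF vak(2)] by blast
    moreover have "a = c (sf.dg p q)" using pq(3) cc(1) by metis
    ultimately have r: "a_rho N (iwasawa_A \<theta> N A K (c g)) = sf.rho p q"
      using sf.a_rho_conj[OF b pq(1,2)] unfolding inv_b N_eq c_def[abs_def] by simp
    obtain u where u: "u \<in> N" "v = \<theta> u" using vak(1) by auto
    have v': "c' v = sf.S ** c' u ** sf.S" using u thJ NG c'J by auto
    have kG: "k \<in> G" "\<theta> k = k" using vak(3) K by auto
    then have Sk: "sf.S ** c' k ** sf.S = c' k" using thJ[OF kG(1)] c'J[of k] by simp
    \<comment> \<open>For an isometry, being fixed by \<theta> amounts to being unitary in adapted
      coordinates.\<close>
    have "ctranspose (c' k) ** c' k = ctranspose (c' k) ** sf.S ** c' k ** sf.S"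
      by (subst Sk[symmetric], simp only: matrix_mul_assoc)
    also have "\<dots> = mat 1" by (simp add: iso'[OF kG(1)])
    finally have "c' k ** ctranspose (c' k) = mat 1" by (simp add: matrix_left_right_inverse)
    moreover have "g = (sf.S ** c' u ** sf.S) ** sf.dg p q ** c' k"
      using vak(4) cm(2) cc(2) v' pq(3) by metis
    ultimately have "sf.nrm g = p\<^sup>2" "sf.gram g = (p * q)\<^sup>2" using sf.iwasawa_rows[OF c'N[OF u(1)]] by auto
    then show ?thesis using r sf.rho_rhog[OF pq(1,2)] by simp
  qed
  show ?thesis
  proof (rule sf.haar_integrable[OF b _ dd])
    show "haar_measure ((\<lambda>g. b ** g ** matrix_inv b) ` sf.D) M"
      using haar unfolding der c_def[abs_def] inv_b .
    show "inverse (a_rho N (iwasawa_A \<theta> N A K (b ** g ** matrix_inv b))) * (1 + ln (a_rho N (iwasawa_A \<theta> N A K (b ** g ** matrix_inv b)))) powr dd =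
      inverse (sf.rhog g) * (1 + ln (sf.rhog g)) powr dd" if "g \<in> sf.D" for g
      using rho[OF that] unfolding c_def inv_b by simp
  qed
qed

section \<open>Real algebraicity and reductivity\<close>

definition cpoly :: "(complex^'m^'m \<Rightarrow> complex) \<Rightarrow> bool" where
  "cpoly f \<longleftrightarrow> real_polynomial_function (\<lambda>g. Re (f g)) \<and> real_polynomial_function (\<lambda>g. Im (f g))"

lemma cpoly_const: "cpoly (\<lambda>_. a)"
  by (simp add: cpoly_def real_polynomial_function.intros(2))

lemma cpoly_add: "cpoly f \<Longrightarrow> cpoly h \<Longrightarrow> cpoly (\<lambda>g. f g + h g)"
  by (simp add: cpoly_def real_polynomial_function.intros(3))

lemma cpoly_mult: "cpoly f \<Longrightarrow> cpoly h \<Longrightarrow> cpoly (\<lambda>g. f g * h g)"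
  by (simp add: cpoly_def real_polynomial_function.intros(3) real_polynomial_function_diff real_polynomial_function.intros(4))

lemma cpoly_cnj: "cpoly f \<Longrightarrow> cpoly (\<lambda>g. cnj (f g))"
  using real_polynomial_function_minus[of "\<lambda>g. Im (f g)"] by (simp add: cpoly_def)

lemma cpoly_entry: "cpoly (\<lambda>g. g $ i $ j)"
proof -
  have "bounded_linear (\<lambda>g :: complex^'m^'m. Re (g $ i $ j))" "bounded_linear (\<lambda>g :: complex^'m^'m. Im (g $ i $ j))"
    by (auto simp: linear_conv_bounded_linear[symmetric] intro!: linearI)
  then show ?thesis unfolding cpoly_def by (auto intro: real_polynomial_function.intros(1))
qed

lemma cpoly_sum: "(\<And>k. k \<in> A \<Longrightarrow> cpoly (f k)) \<Longrightarrow> cpoly (\<lambda>g. \<Sum>k\<in>A. f k g)"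
  by (induction A rule: infinite_finite_induct) (simp_all add: cpoly_const cpoly_add)

lemma cpoly_prod: "(\<And>k. k \<in> A \<Longrightarrow> cpoly (f k)) \<Longrightarrow> cpoly (\<lambda>g. \<Prod>k\<in>A. f k g)"
  by (induction A rule: infinite_finite_induct) (simp_all add: cpoly_const cpoly_mult)

text \<open>The equations are drawn from all real polynomials vanishing on \<open>G\<close>. They
  include the real and imaginary parts of the defining relations, so every common zero lies in
  \<open>G\<close>.\<close>

lemma real_algebraic_G: "real_algebraic G"
proof -
  define P where "P = {f. cpoly f \<and> (\<forall>g\<in>G. f g = 0)}"
  define S where "S = (\<lambda>f g. Re (f g)) ` P \<union> (\<lambda>f g. Im (f g)) ` P \<union>
     {p. real_polynomial_function p \<and> (\<forall>g\<in>G. p g = 0)}"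
  have poly: "real_polynomial_function p" if "p \<in> S" for p using that by (auto simp: S_def P_def cpoly_def)
  have van: "p g = 0" if "p \<in> S" "g \<in> G" for p g using that by (auto simp: S_def P_def)
  have "g \<in> G" if g: "\<forall>p\<in>S. p g = 0" for g
  proof -
    have z: "f g = 0" if "f \<in> P" for f
      using g that by (auto simp: S_def complex_eq_iff)
    have "(\<lambda>g. (ctranspose g ** I ** g) $ i $ j + (- 1) * I $ i $ j) \<in> P" for i j
    proof -
      have "cpoly (\<lambda>g. (ctranspose g ** I ** g) $ i $ j + (- 1) * I $ i $ j)"
        unfolding matrix_matrix_mult_def vec_lambda_beta ctranspose_nth
        by (intro cpoly_add cpoly_mult cpoly_sum cpoly_cnj cpoly_entry cpoly_const)
      then show ?thesis by (simp add: P_def G_I)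
    qed
    from z[OF this] have "ctranspose g ** I ** g = I" by (simp add: vec_eq_iff)
    moreover have "(\<lambda>g. det g + (- 1)) \<in> P"
    proof -
      have "cpoly (\<lambda>g. det g + (- 1))"
        unfolding det_def by (intro cpoly_add cpoly_mult cpoly_sum cpoly_prod cpoly_entry cpoly_const)
      then show ?thesis by (simp add: P_def G_def)
    qed
    from z[OF this] have "det g = 1" by simp
    moreover have "g $ i $ j \<in> F" for i j
    proof (cases "F = UNIV")
      case False
      then have F: "F = \<real>" using F_cases by auto
      have "(\<lambda>g. Im (g $ i $ j)) \<in> S"
      proof -
        have "real_polynomial_function (\<lambda>g :: complex^'m^'m. Im (g $ i $ j))" using cpoly_entry by (simp add: cpoly_def)
        moreover have "Im (g $ i $ j) = 0" if "g \<in> G" for g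
        proof -
          have "g $ i $ j \<in> F" using that by (simp add: G_def)
          then show ?thesis unfolding F by (simp add: complex_is_Real_iff)
        qed
        ultimately show ?thesis by (simp add: S_def)
      qed
      from bspec[OF g this] have "Im (g $ i $ j) = 0" by simp
      then show ?thesis unfolding F by (simp add: complex_is_Real_iff)
    qed simp
    ultimately show ?thesis by (simp add: G_def)
  qed
  then have "G = {g. invertible g \<and> (\<forall>p\<in>S. p g = 0)}" using van G_inverse(3) by blast
  then show ?thesis unfolding real_algebraic_def using poly by blast
qed

text \<open>The inverse conjugate transpose acts on \<open>G\<close> as conjugation by
  \<open>I\<close>, so it preserves \<open>G\<close> and h = 1 serves as the witness.\<close>

lemma real_reductive_G: "real_reductive G"
proof -
  have m1: "matrix_inv (mat 1 :: complex^'m^'m) = mat 1" by (rule matrix_inv_eqI) simp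
  have eq: "matrix_inv (ctranspose g) = I ** g ** I" if "g \<in> G" for g
  proof (rule matrix_inv_eqI)
    have "ctranspose g ** (I ** g ** I) = (ctranspose g ** I ** g) ** I" by (simp add: matrix_mul_assoc)
    then show "ctranspose g ** (I ** g ** I) = mat 1" by (simp add: G_I[OF that] I_I)
  qed
  have mem: "I ** g ** I \<in> G" if g: "g \<in> G" for g
  proof -
    have "ctranspose (I ** g ** I) ** I ** (I ** g ** I) = I ** (ctranspose g ** I ** g) ** I"
      by (simp add: ctranspose_mult ctranspose_I matrix_mul_assoc I_I_cancel)
    then have "ctranspose (I ** g ** I) ** I ** (I ** g ** I) = I" by (simp add: G_I[OF g] I_I)
    moreover have "det I * det I = 1" by (simp add: det_mul[symmetric] I_I)
    then have "det (I ** g ** I) = 1" using g by (simp add: det_mul G_def)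
    ultimately show ?thesis using g by (simp add: G_def)
  qed
  have involutive: "I ** (I ** g ** I) ** I = g" for g by (simp add: matrix_mul_assoc I_I I_I_cancel)
  have "cartan_involution G (\<lambda>g. matrix_inv (ctranspose g))"
    unfolding cartan_involution_def
  proof (intro conjI exI[of _ "mat 1"] ballI)
    show "(\<lambda>g. matrix_inv (ctranspose g)) ` G = G"
    proof
      show "(\<lambda>g. matrix_inv (ctranspose g)) ` G \<subseteq> G" using eq mem by auto
      show "G \<subseteq> (\<lambda>g. matrix_inv (ctranspose g)) ` G"
      proof
        fix g assume g: "g \<in> G"
        show "g \<in> (\<lambda>g. matrix_inv (ctranspose g)) ` G"
          by (rule image_eqI[OF _ mem[OF g]]) (simp only: eq[OF mem[OF g]] involutive)
      qed
    qed
  qed (simp_all add: m1 invertibleI[of "mat 1" "mat 1"])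
  then show ?thesis unfolding real_reductive_def using subgroup_G real_algebraic_G by blast
qed

lemma tame_G: "tame G"
  unfolding tame_def using real_reductive_G tame_integrable by blast

end

section \<open>The groups SO(n+2,2) and SU(2,2)\<close>

lemma det_map_matrix_of_real: "det (map_matrix complex_of_real g) = of_real (det g)"
  by (simp add: det_def map_matrix_def)

text \<open>The type 2 has the two elements 1 and 2, so \<open>Inr 1\<close> and
  \<open>Inr 2\<close> are all the negative directions.\<close>

lemma I_indef_eq:
  assumes "sig_form (Inr 1 :: 'p::finite + 2) (Inr 2) F"
  shows "(I_indef :: complex^('p + 2)^('p + 2)) = sig_form.I (Inr 1) (Inr 2)"
proof -
  interpret sig_form "Inr 1 :: 'p + 2" "Inr 2" F by (rule assms)
  have "sg i = (case i of Inl _ \<Rightarrow> 1 | Inr _ \<Rightarrow> - 1)" for i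
    using exhaust_2 by (cases i) (auto simp: sg_def)
  then show ?thesis by (auto simp: I_indef_def I_def diagm_def vec_eq_iff split: sum.split)
qed

lemma tame_SO_indef:
  assumes "CARD('p::finite) \<ge> 3"
  shows "tame (SO_indef :: (complex^('p + 2)^('p + 2)) set)"
proof -
  have sf: "sig_form (Inr 1 :: 'p + 2) (Inr 2) \<real>"
    by unfold_locales (use assms in auto)
  interpret sig_form "Inr 1 :: 'p + 2" "Inr 2" \<real> by (rule sf)
  have "SO_indef = G"
  proof
    have iso: "ctranspose (map_matrix complex_of_real g) ** I ** map_matrix complex_of_real g = map_matrix complex_of_real (transpose g ** I_indef ** g)"
      for g :: "real^('p + 2)^('p + 2)"
      unfolding I_indef_eq[OF sf, symmetric]
      by (simp add: vec_eq_iff matrix_matrix_mult_def map_matrix_def ctranspose_def transpose_def I_indef_def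
          if_distrib[of complex_of_real] if_distrib[of "\<lambda>a. _ * a"] if_distrib[of "\<lambda>a. a * _"] sum_distrib_left split: sum.split cong: if_cong)
        (intro allI sum.cong refl, simp split: sum.split)
    have Ir: "map_matrix complex_of_real I_indef = I"
      unfolding I_indef_eq[OF sf, symmetric] by (auto simp: vec_eq_iff map_matrix_def I_indef_def split: sum.split)
    have inj: "map_matrix complex_of_real A = map_matrix complex_of_real B \<longleftrightarrow> A = B" for A B :: "real^('p + 2)^('p + 2)"
      by (simp add: map_matrix_def vec_eq_iff)
    show "SO_indef \<subseteq> G"
      unfolding SO_indef_def G_def by (auto simp: iso Ir det_map_matrix_of_real)
    show "G \<subseteq> SO_indef"
    proof
      fix g assume g: "g \<in> G"
      define r where "r = (\<chi> i j. Re (g $ i $ j))"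
      have gr: "g = map_matrix complex_of_real r"
        using g by (auto simp: G_def r_def map_matrix_def vec_eq_iff complex_is_Real_iff complex_eq_iff)
      have "transpose r ** I_indef ** r = I_indef"
      proof -
        have "map_matrix complex_of_real (transpose r ** I_indef ** r) = map_matrix complex_of_real I_indef"
          using G_I[OF g] unfolding gr iso Ir .
        then show ?thesis unfolding inj .
      qed
      moreover have "det r = 1"
      proof -
        have "complex_of_real (det r) = 1" using g unfolding G_def gr by (simp add: det_map_matrix_of_real)
        then show ?thesis by simp
      qed
      ultimately show "g \<in> SO_indef" unfolding SO_indef_def gr by blast
    qed
  qed
  then show ?thesis using tame_G by simp
qed

lemma tame_SU_indef: "tame (SU_indef :: (complex^(2 + 2)^(2 + 2)) set)"
proof -
  have sf: "sig_form (Inr 1 :: 2 + 2) (Inr 2) UNIV"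
    by unfold_locales auto
  interpret sig_form "Inr 1 :: 2 + 2" "Inr 2" UNIV by (rule sf)
  have "SU_indef = G" by (simp add: SU_indef_def G_def I_indef_eq[OF sf])
  then show ?thesis using tame_G by simp
qed

theorem mainTheorem4:
  shows "(\<forall>n::nat. n \<ge> 1 \<and> CARD('p::finite) = n + 2 \<longrightarrow>
            tame (SO_indef :: (complex^('p + 2)^('p + 2)) set)) \<and>
         tame (SU_indef :: (complex^(2 + 2)^(2 + 2)) set)"
  using tame_SU_indef by (auto intro!: tame_SO_indef)

end
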